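(* Let $X$ be a real Lévy process with $X\in\mathcal D_{\alpha,\rho}$ which is not monotone (i.e. neither $X$ nor $-X$ is non-decreasing). Let $M=\sup\{X_t:t\in[0,1]\}$ and let $\tau=\inf\{t\ge0:X_t\vee X_{t-}=M\}$ be the time of the supremum on the interval $[0,1]$. Then, as functions of $\varepsilon\downarrow0$, $$\mathbb P(\tau\le\varepsilon)\in\mathrm{RV}_{\rho},\qquad \mathbb P(\tau\ge1-\varepsilon)\in\mathrm{RV}_{1-\rho}.$$
   Context: $X\in\mathcal D_{\alpha,\rho}$ means: there are a function $a_\varepsilon>0$ and a random variable $\widehat X_1$, not identically $0$, with $X_\varepsilon/a_\varepsilon\to\widehat X_1$ in distribution as $\varepsilon\downarrow0$. Then $\widehat X_1$ is the time-1 value of a Lévy process $\widehat X$ which is necessarily $1/\alpha$-self-similar for some $\alpha\in(0,2]$ (a driftless Brownian motion with $\alpha=2$, a non-zero linear drift with $\alpha=1$, or a strictly $\alpha$-stable process with $\alpha\in(0,2)$); $\alpha$ is this index and $\rho=\mathbb P(\widehat X_1>0)$. $\mathrm{RV}_r$ is the class of functions regularly varying at $0$ with index $r$. *)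

theory Defs
  imports "HOL-Probability.Probability"
begin

text \<open>Time runs through the reals, but only times \<open>t \<ge> 0\<close> are constrained or used.\<close>

definition cadlag :: "(real \<Rightarrow> real) \<Rightarrow> bool" where
  "cadlag f \<longleftrightarrow>
     (\<forall>t\<ge>0. (f \<longlongrightarrow> f t) (at_right t)) \<and> (\<forall>t>0. \<exists>l. (f \<longlongrightarrow> l) (at_left t))"

text \<open>Convention: \<open>X\<^bsub>0-\<^esub> = X\<^sub>0\<close>.\<close>

definition left_lim :: "(real \<Rightarrow> real) \<Rightarrow> real \<Rightarrow> real" where
  "left_lim f t = (if 0 < t then Lim (at_left t) f else f t)"

text \<open>All paths, not just almost all, are cadlag, so that the events concerning the
  supremum time below are measurable although \<open>M\<close> need not be complete.\<close>

locale levy_process = prob_space M for M :: "'a measure" +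
  fixes X :: "real \<Rightarrow> 'a \<Rightarrow> real"
  assumes random_variable_X: "\<And>t. 0 \<le> t \<Longrightarrow> random_variable borel (X t)"
    and start_zero: "AE \<omega> in M. X 0 \<omega> = 0"
    and indep_increments: "\<And>(t :: nat \<Rightarrow> real) n. 0 \<le> t 0 \<Longrightarrow> (\<And>i. i < n \<Longrightarrow> t i \<le> t (Suc i)) \<Longrightarrow>
      indep_vars (\<lambda>_. borel) (\<lambda>i \<omega>. X (t (Suc i)) \<omega> - X (t i) \<omega>) {..<n}"
    and stationary_increments: "\<And>s h. 0 \<le> s \<Longrightarrow> 0 \<le> h \<Longrightarrow>
      distr M borel (\<lambda>\<omega>. X (s + h) \<omega> - X s \<omega>) = distr M borel (X h)"
    and cadlag_paths: "\<And>\<omega>. \<omega> \<in> space M \<Longrightarrow> cadlag (\<lambda>t. X t \<omega>)"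

text \<open>Equality in law of \<open>(X\<^bsub>ct\<^esub>)\<close> and \<open>(c\<^sup>H X\<^sub>t)\<close> is equality of the finite-dimensional
  distributions.\<close>

definition self_similar :: "'a measure \<Rightarrow> (real \<Rightarrow> 'a \<Rightarrow> real) \<Rightarrow> real \<Rightarrow> bool" where
  "self_similar M X H \<longleftrightarrow>
     (\<forall>c>0. \<forall>J. finite J \<and> J \<subseteq> {0..} \<longrightarrow>
        distr M (Pi\<^sub>M J (\<lambda>_. borel)) (\<lambda>\<omega>. \<lambda>t\<in>J. X (c * t) \<omega>) =
        distr M (Pi\<^sub>M J (\<lambda>_. borel)) (\<lambda>\<omega>. \<lambda>t\<in>J. c powr H * X t \<omega>))"

text \<open>The library's \<^const>\<open>weak_conv_m\<close>, for a general filter in place of \<^const>\<open>sequentially\<close>.\<close>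

definition weak_conv_filter :: "('i \<Rightarrow> real measure) \<Rightarrow> real measure \<Rightarrow> 'i filter \<Rightarrow> bool" where
  "weak_conv_filter \<mu> \<nu> F \<longleftrightarrow>
     (\<forall>x. isCont (cdf \<nu>) x \<longrightarrow> ((\<lambda>i. cdf (\<mu> i) x) \<longlongrightarrow> cdf \<nu> x) F)"

text \<open>The limit process \<open>Y\<close> matters only through its law, and every cadlag process has a
  version on path space; hence it loses no generality to take its probability space on the
  type of paths.\<close>

definition small_time_domain :: "'a measure \<Rightarrow> (real \<Rightarrow> 'a \<Rightarrow> real) \<Rightarrow> real \<Rightarrow> real \<Rightarrow> bool" where
  "small_time_domain M X \<alpha> \<rho> \<longleftrightarrow>
     0 < \<alpha> \<and> \<alpha> \<le> 2 \<and>
     (\<exists>(a :: real \<Rightarrow> real) (N :: (real \<Rightarrow> real) measure) Y.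
        (\<forall>\<epsilon>>0. 0 < a \<epsilon>) \<and>
        levy_process N Y \<and>
        \<not> (AE \<omega> in N. Y 1 \<omega> = 0) \<and>
        weak_conv_filter (\<lambda>\<epsilon>. distr M borel (\<lambda>\<omega>. X \<epsilon> \<omega> / a \<epsilon>)) (distr N borel (Y 1)) (at_right 0) \<and>
        self_similar N Y (1 / \<alpha>) \<and>
        \<rho> = measure N {\<omega> \<in> space N. 0 < Y 1 \<omega>})"

definition nondecreasing_process :: "'a measure \<Rightarrow> (real \<Rightarrow> 'a \<Rightarrow> real) \<Rightarrow> bool" where
  "nondecreasing_process M X \<longleftrightarrow> (AE \<omega> in M. mono_on {0..} (\<lambda>t. X t \<omega>))"

definition sup_value :: "(real \<Rightarrow> real) \<Rightarrow> real" where
  "sup_value f = (SUP t\<in>{0..1}. f t)"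

definition sup_time :: "(real \<Rightarrow> real) \<Rightarrow> real" where
  "sup_time f = Inf {t. 0 \<le> t \<and> max (f t) (left_lim f t) = sup_value f}"

definition regularly_varying_at_0 :: "real \<Rightarrow> (real \<Rightarrow> real) \<Rightarrow> bool" where
  "regularly_varying_at_0 r f \<longleftrightarrow>
     (\<exists>\<delta>>0. f \<in> borel_measurable (restrict_space borel {0<..<\<delta>}) \<and> (\<forall>x\<in>{0<..<\<delta>}. 0 < f x)) \<and>
     (\<forall>c>0. ((\<lambda>x. f (c * x) / f x) \<longlongrightarrow> c powr r) (at_right 0))"

end

theory Submission
  imports Defs "HOL-Library.Diagonal_Subsequence"
begin

text \<open>
  Sample \<open>X\<close>, with a small drift \<open>-\<delta>t\<close> added, on a grid of mesh \<open>1/N\<close>, and let \<open>S\<close> be the resulting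
  random walk. With \<open>a\<^sub>k = P(S\<^sub>1, \<dots>, S\<^sub>k > 0)\<close> and \<open>b\<^sub>k = P(S\<^sub>1, \<dots>, S\<^sub>k \<le> 0)\<close>, the first maximum of
  \<open>S\<^sub>0, \<dots>, S\<^sub>N\<close> is at \<open>k\<close> with probability \<open>a\<^sub>k b\<^bsub>N-k\<^esub>\<close>. Sparre Andersen's recursion
  \<open>E L\<^bsub>n+1\<^esub> = E L\<^sub>n + P(S\<^bsub>n+1\<^esub> > 0)\<close> for the position \<open>L\<^sub>n\<close> of the first maximum is equivalent to
  \<open>n a\<^sub>n = \<Sum>\<^bsub>1\<le>k\<le>n\<^esub> p\<^sub>k a\<^bsub>n-k\<^esub>\<close> with \<open>p\<^sub>k = P(S\<^sub>k > 0)\<close>. As \<open>p\<^sub>k\<close> is close to \<open>\<rho>\<close> when \<open>k/N\<close> is small,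
  \<open>n a\<^sub>n \<approx> \<rho> (a\<^sub>0 + \<dots> + a\<^bsub>n-1\<^esub>)\<close>, so the partial sums of \<open>a\<close> behave like a power with exponent \<open>\<rho>\<close>,
  without recourse to a Tauberian theorem. The same recursion for \<open>b\<close> bounds \<open>b\<^sub>N\<close> from below by a
  multiple of \<open>b\<^bsub>N/2\<^esub>\<close>, and \<open>b\<^bsub>N-k\<^esub>\<close> is nearly constant over the relevant range of \<open>k\<close>. Exchanging
  \<open>a\<close> and \<open>b\<close> turns the first claim into the second.
\<close>

section \<open>Convolution recursions and regular variation\<close>

text \<open>Two limits are nested: at fixed \<epsilon> the mesh tends to 0, and only then does
  \<epsilon>. Estimates are therefore made on index windows proportional to \<epsilon>N, uniformly
  over all sufficiently late walks. For indices below such a window nothing is known about p_k, and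
  monotonicity of a has to absorb them.

  The hypotheses enter at separate places. The exponent needs P(X_t > 0) -> \<rho>, hence a limit
  law without atom at 0; self-similarity provides this. Non-monotonicity makes P(X_t > 0) and P(X_t
  < 0) positive for every t > 0, hence bounded below on compact subsets of (0, 1]; this is what
  compares b_N with b at N/2 and keeps the limiting probabilities positive.

  The normalised b converges only along a subsequence. This is enough, because the probabilities for
  the supremum time do not depend on it. Upper bounds for ratios are also enough, because replacing
  the scale factor c by 1/c yields the lower ones.\<close>

lemma convolution_recurrence:
  fixes u v p :: "nat \<Rightarrow> real"
  assumes conv: "\<And>n. (\<Sum>k\<le>n. u k * v (n - k)) = 1"
    and mean: "\<And>n. (\<Sum>k\<le>n. real k * u k * v (n - k)) = (\<Sum>k=1..n. p k)"
  shows "real n * u n = (\<Sum>k=1..n. p k * u (n - k))"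
proof -
  define U where "U = Abs_fps u"
  define V where "V = Abs_fps v"
  define P where "P = Abs_fps (\<lambda>k. if k = 0 then 0 else p k)"
  define D where "D = Abs_fps (\<lambda>k. real k * u k)"
  have UV: "fps_nth (U * V) m = 1" for m
    using conv[of m] by (simp add: fps_mult_nth U_def V_def atLeast0AtMost)
  have split0: "(\<Sum>k\<le>m. if k = 0 then 0 else f k) = (\<Sum>k=1..m. f k)" for m and f :: "nat \<Rightarrow> real"
    by (rule sum.mono_neutral_cong_right) auto
  \<comment> \<open>In generating functions, \<open>conv\<close> reads U V = 1/(1 - z), and
    \<open>mean\<close> reads z U' V = P/(1 - z), since multiplication by 1/(1 - z) forms partial
    sums. Cancelling V leaves z U' = P U, which is the recursion.\<close>
  have "D * V = P * (U * V)"
  proof (rule fps_ext)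
    fix m
    have "fps_nth (P * (U * V)) m = (\<Sum>k\<le>m. fps_nth P k * fps_nth (U * V) (m - k))"
      by (simp only: fps_mult_nth atLeast0AtMost)
    also have "\<dots> = (\<Sum>k=1..m. p k)"
      by (simp add: UV P_def split0)
    finally show "fps_nth (D * V) m = fps_nth (P * (U * V)) m"
      using mean[of m] by (simp add: fps_mult_nth D_def V_def atLeast0AtMost)
  qed
  then have "D * V = (P * U) * V" by (simp add: mult.assoc)
  moreover have "V \<noteq> 0" using UV[of 0] by auto
  ultimately have "D = P * U" by simp
  then have "fps_nth D n = fps_nth (P * U) n" by simp
  also have "\<dots> = (\<Sum>k\<le>n. if k = 0 then 0 else p k * u (n - k))"
    unfolding fps_mult_nth atLeast0AtMost by (rule sum.cong) (auto simp: P_def U_def)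
  finally show ?thesis by (simp add: D_def split0)
qed

text \<open>For k \<ge> s, replacing \<open>p k\<close> by \<rho> costs a factor \<eta>. At most s
  terms remain; there k < s \<le> n/2, so monotonicity bounds each by \<open>u (n div 2)\<close>,
  and n/2 times this value is at most the whole sum. With 2s \<le> \<eta>n they cost a second
  \<eta>.\<close>

lemma recurrence_increment_bound:
  fixes u p :: "nat \<Rightarrow> real" and \<rho> \<eta> s :: real
  assumes nonneg: "\<And>k. 0 \<le> u k" and dec: "antimono u"
    and rec: "real n * u n = (\<Sum>k=1..n. p k * u (n - k))"
    and p01: "\<And>k. 0 \<le> p k \<and> p k \<le> 1" and \<rho>: "0 \<le> \<rho>" "\<rho> \<le> 1"
    and close: "\<And>k. s \<le> real k \<Longrightarrow> k \<le> n \<Longrightarrow> \<bar>p k - \<rho>\<bar> \<le> \<eta>"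
    and s: "0 \<le> s" "2 * s \<le> \<eta> * real n" and \<eta>: "0 < \<eta>" "\<eta> \<le> 1" and n: "0 < n"
  shows "\<bar>real n * u n - \<rho> * (\<Sum>j<n. u j)\<bar> \<le> 2 * \<eta> * (\<Sum>j<n. u j)"
proof -
  have rev: "(\<Sum>k=1..n. u (n - k)) = (\<Sum>j<n. u j)"
    by (rule sum.reindex_bij_witness[of _ "\<lambda>j. n - j" "\<lambda>k. n - k"]) auto
  have sn: "2 * s \<le> real n" using s(2) \<eta> n by (smt (verit) mult_left_le_one_le of_nat_0_le_iff)
  have each: "\<bar>(p k - \<rho>) * u (n - k)\<bar> \<le> \<eta> * u (n - k) + (if real k < s then u (n div 2) else 0)"
    if "k \<in> {1..n}" for k
  proof (cases "real k < s")
    case True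
    then have "n div 2 \<le> n - k" using sn by linarith
    then have "u (n - k) \<le> u (n div 2)" using dec by (auto simp: antimono_def)
    moreover have "\<bar>p k - \<rho>\<bar> \<le> 1" using p01[of k] \<rho> by auto
    ultimately have "\<bar>(p k - \<rho>) * u (n - k)\<bar> \<le> 1 * u (n div 2)"
      unfolding abs_mult using nonneg by (intro mult_mono) auto
    moreover have "0 \<le> \<eta> * u (n - k)" using \<eta> nonneg by simp
    ultimately show ?thesis using True by simp
  next
    case False
    then have "\<bar>p k - \<rho>\<bar> \<le> \<eta>" using close that by simp
    then show ?thesis using False nonneg by (simp add: abs_mult mult_right_mono)
  qed
  have card: "real (card {k\<in>{1..n}. real k < s}) \<le> s"
  proof -
    have "{k\<in>{1..n}. real k < s} \<subseteq> {1..nat \<lfloor>s\<rfloor>}" by (auto simp: le_nat_floor)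
    then have "card {k\<in>{1..n}. real k < s} \<le> nat \<lfloor>s\<rfloor>"
      using card_mono[of "{1..nat \<lfloor>s\<rfloor>}"] by simp
    then show ?thesis using s(1) by linarith
  qed
  have half: "real n / 2 * u (n div 2) \<le> (\<Sum>j<n. u j)"
  proof -
    have "real n / 2 * u (n div 2) \<le> real (card {..n div 2}) * u (n div 2)"
      using nonneg by (intro mult_right_mono) auto
    also have "\<dots> \<le> (\<Sum>j\<le>n div 2. u j)"
      using dec by (intro sum_bounded_below) (auto simp: antimono_def)
    also have "\<dots> \<le> (\<Sum>j<n. u j)"
      using n nonneg by (intro sum_mono2) auto
    finally show ?thesis .
  qed
  have "\<bar>real n * u n - \<rho> * (\<Sum>j<n. u j)\<bar> = \<bar>\<Sum>k=1..n. (p k - \<rho>) * u (n - k)\<bar>"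
    unfolding rec rev[symmetric] by (simp add: sum_distrib_left left_diff_distrib sum_subtractf)
  also have "\<dots> \<le> (\<Sum>k=1..n. \<bar>(p k - \<rho>) * u (n - k)\<bar>)" by (rule sum_abs)
  also have "\<dots> \<le> (\<Sum>k=1..n. \<eta> * u (n - k) + (if real k < s then u (n div 2) else 0))"
    using each by (intro sum_mono) auto
  also have "\<dots> = \<eta> * (\<Sum>j<n. u j) + real (card {k\<in>{1..n}. real k < s}) * u (n div 2)"
    by (simp add: sum.distrib sum_distrib_left[symmetric] rev sum.inter_filter[symmetric] del: One_nat_def)
  also have "\<dots> \<le> \<eta> * (\<Sum>j<n. u j) + s * u (n div 2)"
    using card nonneg by (intro add_left_mono mult_right_mono) auto
  also have "s * u (n div 2) \<le> \<eta> * (real n / 2 * u (n div 2))"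
    using s(2) nonneg[of "n div 2"] mult_right_mono[of "2 * s" "\<eta> * real n" "u (n div 2)"] by simp
  also have "\<dots> \<le> \<eta> * (\<Sum>j<n. u j)" using half \<eta> by (intro mult_left_mono) auto
  finally show ?thesis by (simp add: algebra_simps)
qed

section \<open>Power growth of partial sums\<close>

lemma one_plus_le_powr_ratio:
  fixes \<sigma> :: real
  assumes "2 \<le> n" and "0 \<le> \<sigma>"
  shows "1 + \<sigma> / real n \<le> (real n / (real n - 1)) powr \<sigma>"
proof -
  have n: "real n \<ge> 2" using assms by simp
  have "ln ((real n - 1) / real n) \<le> (real n - 1) / real n - 1"
    using n by (intro ln_le_minus_one) auto
  then have "1 / real n \<le> ln (real n / (real n - 1))"
    using n by (simp add: ln_div field_simps)
  then have "\<sigma> / real n \<le> \<sigma> * ln (real n / (real n - 1))"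
    using assms mult_left_mono[of "1 / real n" "ln (real n / (real n - 1))" \<sigma>] by simp
  then have "1 + \<sigma> / real n \<le> exp (\<sigma> * ln (real n / (real n - 1)))"
    using exp_ge_add_one_self[of "\<sigma> / real n"] by (meson exp_le_cancel_iff order_trans)
  then show ?thesis using n by (simp add: powr_def)
qed

text \<open>Weighted arithmetic-geometric mean inequality for 1 + 1/n and 1 with weights \<sigma>
  and 1 - \<sigma>; hence the restriction to \<sigma> \<le> 1.\<close>

lemma powr_ratio_le_one_plus:
  fixes \<sigma> :: real
  assumes "0 < n" "0 \<le> \<sigma>" "\<sigma> \<le> 1"
  shows "((real n + 1) / real n) powr \<sigma> \<le> 1 + \<sigma> / real n"
proof -
  have "(1 + 1 / real n) powr \<sigma> * 1 powr (1 - \<sigma>) \<le> \<sigma> * (1 + 1 / real n) + (1 - \<sigma>) * 1"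
    using assms by (intro Youngs_inequality_0) (auto intro: add_pos_nonneg)
  then show ?thesis using assms by (simp add: field_simps)
qed


text \<open>A discrete form of integrating S'/S \<le> \<sigma>/x. Each step multiplies the sum by at
  most 1 + \<sigma>/n; the larger factor (n/(n - 1))^\<sigma> telescopes, at the price of the shift
  by 1 in the final ratio.\<close>

lemma partial_sum_ratio_upper:
  fixes u :: "nat \<Rightarrow> real"
  assumes m: "2 \<le> m" "m \<le> m'" and "0 \<le> \<sigma>" and nonneg: "\<And>k. 0 \<le> u k"
    and bound: "\<And>n. m \<le> n \<Longrightarrow> n < m' \<Longrightarrow> real n * u n \<le> \<sigma> * (\<Sum>j<n. u j)"
  shows "(\<Sum>j<m'. u j) \<le> (\<Sum>j<m. u j) * ((real m' - 1) / (real m - 1)) powr \<sigma>"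
  using m(2) bound
proof (induction m' rule: dec_induct)
  case base
  then show ?case using m by simp
next
  case (step n)
  have n: "2 \<le> n" using m step by simp
  have S0: "0 \<le> (\<Sum>j<n. u j)" using nonneg by (simp add: sum_nonneg)
  have "u n \<le> \<sigma> * (\<Sum>j<n. u j) / real n"
    using step(4)[of n] step(1) n by (simp add: field_simps)
  then have "(\<Sum>j<Suc n. u j) \<le> (\<Sum>j<n. u j) * (1 + \<sigma> / real n)"
    by (simp add: algebra_simps)
  also have "\<dots> \<le> (\<Sum>j<n. u j) * (real n / (real n - 1)) powr \<sigma>"
    using one_plus_le_powr_ratio[OF n \<open>0 \<le> \<sigma>\<close>] S0 by (rule mult_left_mono)
  also have "\<dots> \<le> (\<Sum>j<m. u j) * ((real n - 1) / (real m - 1)) powr \<sigma> * (real n / (real n - 1)) powr \<sigma>"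
    using step by (intro mult_right_mono) auto
  also have "\<dots> = (\<Sum>j<m. u j) * ((real (Suc n) - 1) / (real m - 1)) powr \<sigma>"
    using n m by (simp add: mult.assoc powr_mult[symmetric])
  finally show ?case .
qed

text \<open>The same telescoping from below, with ((n + 1)/n)^\<sigma> \<le> 1 + \<sigma>/n; here
  the ratio has no shift, but the exponent must not exceed 1.\<close>

lemma partial_sum_ratio_lower:
  fixes u :: "nat \<Rightarrow> real"
  assumes m: "0 < m" "m \<le> m'" and \<sigma>: "0 \<le> \<sigma>" "\<sigma> \<le> 1" and nonneg: "\<And>k. 0 \<le> u k"
    and bound: "\<And>n. m \<le> n \<Longrightarrow> n < m' \<Longrightarrow> \<sigma> * (\<Sum>j<n. u j) \<le> real n * u n"
  shows "(\<Sum>j<m. u j) * (real m' / real m) powr \<sigma> \<le> (\<Sum>j<m'. u j)"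
  using m(2) bound
proof (induction m' rule: dec_induct)
  case base
  then show ?case using m by simp
next
  case (step n)
  have n: "0 < n" using m step by simp
  have S0: "0 \<le> (\<Sum>j<n. u j)" using nonneg by (simp add: sum_nonneg)
  have "(\<Sum>j<m. u j) * (real (Suc n) / real m) powr \<sigma>
      = (\<Sum>j<m. u j) * (real n / real m) powr \<sigma> * ((real n + 1) / real n) powr \<sigma>"
    using n m by (simp add: mult.assoc powr_mult[symmetric] add.commute)
  also have "\<dots> \<le> (\<Sum>j<n. u j) * ((real n + 1) / real n) powr \<sigma>"
    using step by (intro mult_right_mono) auto
  also have "\<dots> \<le> (\<Sum>j<n. u j) * (1 + \<sigma> / real n)"
    using powr_ratio_le_one_plus[OF n \<sigma>] S0 by (rule mult_left_mono)
  also have "\<dots> \<le> (\<Sum>j<Suc n. u j)"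
    using step(4)[of n] step(1) n by (simp add: field_simps)
  finally show ?case .
qed

section \<open>Arrays of convolution recursions\<close>

text \<open>Row i abstracts the walk with N i steps. In \<open>p_close\<close> the upper cut-off t0
  depends on \<eta> alone, whereas the lower one t1 is arbitrary and decides how late the row must
  be. Apart from \<open>q_pos\<close>, the assumptions are invariant under exchanging a with b and
  replacing p, \<rho> by 1 - p, 1 - \<rho>; this permits a second instance for the end of the time
  interval.\<close>

locale renewal_array =
  fixes a b p :: "nat \<Rightarrow> nat \<Rightarrow> real" and N :: "nat \<Rightarrow> nat" and \<rho> :: real
  assumes a_nonneg: "\<And>i k. 0 \<le> a i k" and b_nonneg: "\<And>i k. 0 \<le> b i k"
    and a_dec: "\<And>i. antimono (a i)" and b_dec: "\<And>i. antimono (b i)"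
    and conv: "\<And>i n. (\<Sum>k\<le>n. a i k * b i (n - k)) = 1"
    and a_rec: "\<And>i n. real n * a i n = (\<Sum>k=1..n. p i k * a i (n - k))"
    and b_rec: "\<And>i n. real n * b i n = (\<Sum>k=1..n. (1 - p i k) * b i (n - k))"
    and p01: "\<And>i k. 0 \<le> p i k \<and> p i k \<le> 1" and rho01: "0 \<le> \<rho>" "\<rho> \<le> 1"
    and N_top: "filterlim N at_top sequentially"
    and p_close: "\<And>\<eta>. 0 < \<eta> \<Longrightarrow> \<exists>t0>0. \<forall>t1>0. \<forall>\<^sub>F i in sequentially.
      \<forall>k. t1 * real (N i) \<le> real k \<longrightarrow> real k \<le> t0 * real (N i) \<longrightarrow> \<bar>p i k - \<rho>\<bar> \<le> \<eta>"
    and q_pos: "\<And>t. 0 < t \<Longrightarrow> \<exists>c>0. \<forall>\<^sub>F i in sequentially.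
      \<forall>k. t * real (N i) \<le> real k \<longrightarrow> k \<le> N i \<longrightarrow> c \<le> 1 - p i k"
begin

definition g :: "nat \<Rightarrow> real \<Rightarrow> nat" where "g i x = nat \<lfloor>x * real (N i)\<rfloor>"

text \<open>For the walks this is the probability that the first maximum falls within the first xN
  steps, and with a and b exchanged within the last xN steps.\<close>

definition W :: "nat \<Rightarrow> real \<Rightarrow> real" where
  "W i x = (\<Sum>k\<le>g i x. a i k * b i (N i - k))"

lemma N_large: "\<forall>\<^sub>F i in sequentially. K \<le> real (N i)"
proof -
  have "\<forall>\<^sub>F i in sequentially. nat \<lceil>K\<rceil> \<le> N i" using N_top unfolding filterlim_at_top by blast
  then show ?thesis by eventually_elim linarith
qed

lemma g_le: "0 \<le> x \<Longrightarrow> real (g i x) \<le> x * real (N i)"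
  unfolding g_def by simp

lemma less_g: "x * real (N i) < real (g i x) + 1"
  unfolding g_def by linarith

lemma g_mono: "x \<le> y \<Longrightarrow> g i x \<le> g i y"
  unfolding g_def by (intro nat_mono floor_mono mult_right_mono) auto

text \<open>The offset d takes up the off-by-one terms of the two growth lemmas: d = 0 serves the
  upper bound, d = 1 the lower one.\<close>

lemma g_tendsto:
  assumes "0 \<le> x"
  shows "(\<lambda>i. (real (g i x) + d) / real (N i)) \<longlonglongrightarrow> x"
proof -
  have "filterlim (\<lambda>i. real (N i)) at_top sequentially"
    using N_top filterlim_real_sequentially filterlim_compose by blast
  then have inv: "(\<lambda>i. e / real (N i)) \<longlonglongrightarrow> 0" for e
    by (intro tendsto_divide_0[OF tendsto_const] filterlim_at_top_imp_at_infinity)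
  have "(\<lambda>i. real (g i x) / real (N i)) \<longlonglongrightarrow> x"
  proof (rule tendsto_sandwich)
    show "(\<lambda>i. x - 1 / real (N i)) \<longlonglongrightarrow> x" using tendsto_diff[OF tendsto_const inv] by fastforce
    show "(\<lambda>_. x) \<longlonglongrightarrow> x" by simp
    show "\<forall>\<^sub>F i in sequentially. x - 1 / real (N i) \<le> real (g i x) / real (N i)"
      using N_large[of 1]
    proof eventually_elim
      case (elim i)
      have "(x * real (N i) - 1) / real (N i) \<le> real (g i x) / real (N i)"
        using less_g[of x i] by (intro divide_right_mono) auto
      then show ?case using elim by (simp add: diff_divide_distrib)
    qed
    show "\<forall>\<^sub>F i in sequentially. real (g i x) / real (N i) \<le> x"
      using N_large[of 1]
    proof eventually_elim
      case (elim i)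
      then show ?case using g_le[OF assms, of i] by (simp add: field_simps)
    qed
  qed
  from tendsto_add[OF this inv[of d]] show ?thesis by (simp add: add_divide_distrib)
qed

lemma g_ratio_tendsto:
  assumes "0 \<le> x" "0 < y"
  shows "(\<lambda>i. (real (g i x) + d) / (real (g i y) + d)) \<longlonglongrightarrow> x / y"
proof -
  have "(\<lambda>i. ((real (g i x) + d) / real (N i)) / ((real (g i y) + d) / real (N i))) \<longlonglongrightarrow> x / y"
    using assms by (intro tendsto_divide g_tendsto) auto
  then show ?thesis
  proof (rule Lim_transform_eventually)
    show "\<forall>\<^sub>F i in sequentially. ((real (g i x) + d) / real (N i)) / ((real (g i y) + d) / real (N i))
        = (real (g i x) + d) / (real (g i y) + d)"
      using N_large[of 1] by eventually_elim simp
  qed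
qed

lemma g_large:
  assumes "0 < x"
  shows "\<forall>\<^sub>F i in sequentially. K \<le> g i x"
  using N_large[of "(real K + 1) / x"]
proof eventually_elim
  case (elim i)
  then have "real K + 1 \<le> x * real (N i)" using assms by (simp add: field_simps)
  then show ?case using less_g[of x i] by linarith
qed

text \<open>For \<epsilon> < t0/C all lags k \<le> n lie below t0 N. With t1 =
  \<eta>\<kappa>\<epsilon>/2 the cut-off s = t1 N satisfies 2s \<le> \<eta>n throughout the window,
  as \<open>recurrence_increment_bound\<close> demands. As t1 depends on \<epsilon>, so does the row
  from which the estimate holds.\<close>

lemma increment_close:
  assumes "0 < \<eta>" "\<eta> \<le> 1" "0 < \<kappa>" "\<kappa> \<le> C"
  shows "\<exists>\<epsilon>0>0. \<forall>\<epsilon>. 0 < \<epsilon> \<longrightarrow> \<epsilon> < \<epsilon>0 \<longrightarrow> (\<forall>\<^sub>F i in sequentially.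
    \<forall>n. \<kappa> * \<epsilon> * real (N i) \<le> real n \<longrightarrow> real n \<le> C * \<epsilon> * real (N i) \<longrightarrow>
      \<bar>real n * a i n - \<rho> * (\<Sum>j<n. a i j)\<bar> \<le> 2 * \<eta> * (\<Sum>j<n. a i j))"
proof -
  from p_close[OF assms(1)] obtain t0 where t0: "t0 > 0" and
    close: "\<And>t1. 0 < t1 \<Longrightarrow> \<forall>\<^sub>F i in sequentially.
      \<forall>k. t1 * real (N i) \<le> real k \<longrightarrow> real k \<le> t0 * real (N i) \<longrightarrow> \<bar>p i k - \<rho>\<bar> \<le> \<eta>"
    by auto
  show ?thesis
  proof (intro exI[of _ "t0 / C"] conjI allI impI)
    show "t0 / C > 0" using t0 assms by simp
    fix \<epsilon> assume \<epsilon>: "0 < \<epsilon>" "\<epsilon> < t0 / C"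
    define t1 where "t1 = \<eta> * \<kappa> * \<epsilon> / 2"
    have t1: "t1 > 0" using assms \<epsilon> by (simp add: t1_def)
    have C: "C * \<epsilon> \<le> t0" using \<epsilon> assms by (simp add: field_simps)
    show "\<forall>\<^sub>F i in sequentially. \<forall>n. \<kappa> * \<epsilon> * real (N i) \<le> real n \<longrightarrow> real n \<le> C * \<epsilon> * real (N i) \<longrightarrow>
      \<bar>real n * a i n - \<rho> * (\<Sum>j<n. a i j)\<bar> \<le> 2 * \<eta> * (\<Sum>j<n. a i j)"
      using close[OF t1] N_large[of 1]
    proof eventually_elim
      case (elim i)
      show ?case
      proof (intro allI impI)
        fix n assume n: "\<kappa> * \<epsilon> * real (N i) \<le> real n" "real n \<le> C * \<epsilon> * N i"
        have n0: "0 < n" using n(1) assms \<epsilon> elim(2)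
          by (smt (verit, best) mult_pos_pos of_nat_0_less_iff)
        have top: "real k \<le> t0 * N i" if "k \<le> n" for k
          using n(2) mult_right_mono[OF C, of "real (N i)"] that by simp
        show "\<bar>real n * a i n - \<rho> * (\<Sum>j<n. a i j)\<bar> \<le> 2 * \<eta> * (\<Sum>j<n. a i j)"
        proof (rule recurrence_increment_bound[where p = "p i" and s = "t1 * N i"])
          show "2 * (t1 * real (N i)) \<le> \<eta> * real n"
            using mult_left_mono[OF n(1), of \<eta>] assms by (simp add: t1_def algebra_simps)
        qed (use a_nonneg a_dec a_rec p01 rho01 elim top t1 assms n0 in auto)
      qed
    qed
  qed
qed

text \<open>Between c\<epsilon>N and \<epsilon>N the partial sums grow at a rate with exponent
  between \<rho> - 2\<eta> and \<rho> + 2\<eta>. For c \<ge> 1 the claim is the upper growth bound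
  from \<epsilon>N to c\<epsilon>N; for c < 1 it is the lower growth bound from c\<epsilon>N to
  \<epsilon>N, solved for the smaller sum.\<close>

lemma a_sum_ratio:
  assumes c: "0 < c" and \<zeta>: "0 < \<zeta>"
  shows "\<exists>\<epsilon>0>0. \<forall>\<epsilon>. 0 < \<epsilon> \<longrightarrow> \<epsilon> < \<epsilon>0 \<longrightarrow> (\<forall>\<^sub>F i in sequentially.
      (\<Sum>j\<le>g i (c * \<epsilon>). a i j) \<le> (1 + \<zeta>) * c powr \<rho> * (\<Sum>j\<le>g i \<epsilon>. a i j))"
proof -
  \<comment> \<open>An error of 2\<eta> in the exponent costs at most the factor
    \<open>D powr (2 * \<eta>)\<close> in either case; \<eta> is chosen to bring this below 1 +
    \<zeta>.\<close>
  define D where "D = max c (1 / c)"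
  have D: "D \<ge> 1" "D > 0" using c by (cases "1 \<le> c", auto simp: D_def le_max_iff_disj less_max_iff_disj)
  have "((\<lambda>\<eta>. D powr (2 * \<eta>)) \<longlongrightarrow> D powr (2 * 0)) (at_right 0)"
    using D by (intro tendsto_intros) auto
  then have "\<forall>\<^sub>F \<eta> in at_right 0. D powr (2 * \<eta>) < 1 + \<zeta>"
    using \<zeta> D by (intro order_tendstoD(2)[where y = "D powr (2 * 0)"]) auto
  moreover have "\<forall>\<^sub>F \<eta> in at_right 0. \<eta> < (1::real)"
    by (auto simp: eventually_at_right_field intro: exI[of _ 1])
  moreover have "\<forall>\<^sub>F \<eta> in at_right 0. (0::real) < \<eta>"
    by (auto simp: eventually_at_right_field intro: exI[of _ 1])
  ultimately have "\<forall>\<^sub>F \<eta> in at_right 0. 0 < \<eta> \<and> \<eta> < 1 \<and> D powr (2 * \<eta>) < 1 + \<zeta>"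
    by eventually_elim auto
  then obtain \<eta> where \<eta>: "0 < \<eta>" "\<eta> < 1" "D powr (2 * \<eta>) < 1 + \<zeta>"
    using eventually_happens' trivial_limit_at_right_real by blast
  have sub: "{..g i x} = {..<g i x + 1}" for i x by auto
  have "0 < min c 1" "min c 1 \<le> max c 1" using c by auto
  from increment_close[OF \<eta>(1) less_imp_le[OF \<eta>(2)] this]
  obtain \<epsilon>0 where \<epsilon>0: "\<epsilon>0 > 0" and incr:
    "\<forall>\<epsilon>. 0 < \<epsilon> \<longrightarrow> \<epsilon> < \<epsilon>0 \<longrightarrow> (\<forall>\<^sub>F i in sequentially.
      \<forall>n. min c 1 * \<epsilon> * real (N i) \<le> real n \<longrightarrow> real n \<le> max c 1 * \<epsilon> * real (N i) \<longrightarrow>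
        \<bar>real n * a i n - \<rho> * (\<Sum>j<n. a i j)\<bar> \<le> 2 * \<eta> * (\<Sum>j<n. a i j))"
    by (elim exE conjE) (rule that)
  show ?thesis
  proof (intro exI[of _ \<epsilon>0] conjI \<epsilon>0 allI impI)
    fix \<epsilon> assume \<epsilon>: "0 < \<epsilon>" "\<epsilon> < \<epsilon>0"
    note incr = incr[rule_format, OF \<epsilon>]
    have S0: "0 \<le> (\<Sum>j<n. a i j)" for i n by (simp add: sum_nonneg a_nonneg)
    show "\<forall>\<^sub>F i in sequentially.
      (\<Sum>j\<le>g i (c * \<epsilon>). a i j) \<le> (1 + \<zeta>) * c powr \<rho> * (\<Sum>j\<le>g i \<epsilon>. a i j)"
    proof (cases "1 \<le> c")
      case True
      define \<sigma> where "\<sigma> = \<rho> + 2 * \<eta>"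
      have "(\<lambda>i. ((real (g i (c * \<epsilon>)) + 0) / (real (g i \<epsilon>) + 0)) powr \<sigma>) \<longlonglongrightarrow> (c * \<epsilon> / \<epsilon>) powr \<sigma>"
        using c \<epsilon> rho01 \<eta> by (intro tendsto_intros g_ratio_tendsto) (auto simp: \<sigma>_def)
      moreover have "(c * \<epsilon> / \<epsilon>) powr \<sigma> < (1 + \<zeta>) * c powr \<rho>"
      proof -
        have "1 / c \<le> 1" using True by simp
        then have "D = c" using True unfolding D_def by linarith
        then have "c powr (2 * \<eta>) * c powr \<rho> < (1 + \<zeta>) * c powr \<rho>" using \<eta> c by simp
        then show ?thesis using \<epsilon> by (simp add: \<sigma>_def powr_add mult.commute)
      qed
      ultimately have "\<forall>\<^sub>F i in sequentially. (real (g i (c * \<epsilon>)) / real (g i \<epsilon>)) powr \<sigma> < (1 + \<zeta>) * c powr \<rho>"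
        using order_tendstoD(2) by fastforce
      then show ?thesis using incr g_large[OF \<epsilon>(1), of 1]
      proof eventually_elim
        case (elim i)
        have "(\<Sum>j<g i (c * \<epsilon>) + 1. a i j) \<le> (\<Sum>j<g i \<epsilon> + 1. a i j) *
            ((real (g i (c * \<epsilon>) + 1) - 1) / (real (g i \<epsilon> + 1) - 1)) powr \<sigma>"
        proof (rule partial_sum_ratio_upper)
          show "g i \<epsilon> + 1 \<le> g i (c * \<epsilon>) + 1" using True \<epsilon> by (simp add: g_mono)
          fix n assume n: "g i \<epsilon> + 1 \<le> n" "n < g i (c * \<epsilon>) + 1"
          have "\<epsilon> * real (N i) \<le> real n" using less_g[of \<epsilon> i] n by linarith
          moreover have "real n \<le> c * \<epsilon> * N i" using g_le[of "c * \<epsilon>" i] n c \<epsilon> by simp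
          ultimately have "\<bar>real n * a i n - \<rho> * (\<Sum>j<n. a i j)\<bar> \<le> 2 * \<eta> * (\<Sum>j<n. a i j)"
            using elim(2) True by (simp add: min_def max_def)
          then show "real n * a i n \<le> \<sigma> * (\<Sum>j<n. a i j)"
            by (simp add: \<sigma>_def algebra_simps)
        qed (use elim a_nonneg rho01 \<eta> in \<open>auto simp: \<sigma>_def\<close>)
        also have "\<dots> \<le> (\<Sum>j<g i \<epsilon> + 1. a i j) * ((1 + \<zeta>) * c powr \<rho>)"
          using elim(1) by (intro mult_left_mono S0) simp
        finally show ?case by (simp add: sub mult.commute)
      qed
    next
      case False
      \<comment> \<open>The lower growth bound wants a nonnegative exponent. When \<rho> - 2\<eta>
        \<le> 0, exponent 0 is trivially admissible because the terms are nonnegative.\<close>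
      define \<sigma> where "\<sigma> = max 0 (\<rho> - 2 * \<eta>)"
      have \<sigma>: "0 \<le> \<sigma>" "\<sigma> \<le> 1" "\<rho> - 2 * \<eta> \<le> \<sigma>" using rho01 \<eta> by (auto simp: \<sigma>_def)
      have "(\<lambda>i. ((real (g i (c * \<epsilon>)) + 1) / (real (g i \<epsilon>) + 1)) powr \<sigma>) \<longlonglongrightarrow> (c * \<epsilon> / \<epsilon>) powr \<sigma>"
        using c \<epsilon> \<sigma> by (intro tendsto_intros g_ratio_tendsto) auto
      moreover have "(c * \<epsilon> / \<epsilon>) powr \<sigma> < (1 + \<zeta>) * c powr \<rho>"
      proof -
        have "(c * \<epsilon> / \<epsilon>) powr \<sigma> \<le> c powr (\<rho> - 2 * \<eta>)"
          using c \<epsilon> False \<sigma> by (simp add: powr_mono')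
        also have "\<dots> = D powr (2 * \<eta>) * c powr \<rho>"
        proof -
          have "1 \<le> 1 / c" using c False by simp
          then have "D = 1 / c" using False unfolding D_def by linarith
          then show ?thesis by (simp add: powr_diff powr_divide)
        qed
        also have "\<dots> < (1 + \<zeta>) * c powr \<rho>" using \<eta> c by simp
        finally show ?thesis .
      qed
      ultimately have "\<forall>\<^sub>F i in sequentially. ((real (g i (c * \<epsilon>)) + 1) / (real (g i \<epsilon>) + 1)) powr \<sigma> < (1 + \<zeta>) * c powr \<rho>"
        using order_tendstoD(2) by fastforce
      then show ?thesis using incr
      proof eventually_elim
        case (elim i)
        have "(\<Sum>j<g i (c * \<epsilon>) + 1. a i j) * (real (g i \<epsilon> + 1) / real (g i (c * \<epsilon>) + 1)) powr \<sigma>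
          \<le> (\<Sum>j<g i \<epsilon> + 1. a i j)"
        proof (rule partial_sum_ratio_lower)
          show "g i (c * \<epsilon>) + 1 \<le> g i \<epsilon> + 1" using False \<epsilon> c by (simp add: g_mono)
          fix n assume n: "g i (c * \<epsilon>) + 1 \<le> n" "n < g i \<epsilon> + 1"
          have "c * \<epsilon> * real (N i) \<le> real n" using less_g[of "c * \<epsilon>" i] n by linarith
          moreover have "real n \<le> \<epsilon> * N i" using g_le[of "\<epsilon>" i] n c \<epsilon> by simp
          ultimately have bd: "\<bar>real n * a i n - \<rho> * (\<Sum>j<n. a i j)\<bar> \<le> 2 * \<eta> * (\<Sum>j<n. a i j)"
            using elim(2) False by (simp add: min_def max_def)
          show "\<sigma> * (\<Sum>j<n. a i j) \<le> real n * a i n"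
          proof (cases "\<rho> - 2 * \<eta> \<le> 0")
            case True
            then show ?thesis using a_nonneg by (simp add: \<sigma>_def max_def)
          next
            case False
            then show ?thesis using bd by (simp add: \<sigma>_def max_def algebra_simps)
          qed
        qed (use a_nonneg \<sigma> in auto)
        then have "(\<Sum>j<g i (c * \<epsilon>) + 1. a i j)
          \<le> (\<Sum>j<g i \<epsilon> + 1. a i j) * ((real (g i (c * \<epsilon>)) + 1) / (real (g i \<epsilon>) + 1)) powr \<sigma>"
          by (simp add: powr_divide field_simps)
        also have "\<dots> \<le> (\<Sum>j<g i \<epsilon> + 1. a i j) * ((1 + \<zeta>) * c powr \<rho>)"
          using elim(1) by (intro mult_left_mono S0) simp
        finally show ?case by (simp add: sub mult.commute)
      qed
    qed
  qed
qed

section \<open>The behaviour of b near the end of its range\<close>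

lemma a0_b0: "a i 0 * b i 0 = 1"
  using conv[of i 0] by simp

lemma b_decD: "k \<le> l \<Longrightarrow> b i l \<le> b i k"
  using b_dec[of i] by (auto simp: antimono_def)

lemma b0_pos: "0 < b i 0"
  using a0_b0[of i] b_nonneg[of i 0] by (cases "b i 0 = 0") auto

text \<open>Write the recursion for b at n = N in terms of j = N - k. Then j \<le> xN forces k \<ge>
  (1 - x)N, where \<open>q_pos\<close> bounds the weight 1 - p_k from below; all other terms are
  nonnegative.\<close>

lemma b_sum_le:
  assumes x: "0 < x" "x < 1"
  obtains c where "c > 0" "\<forall>\<^sub>F i in sequentially. c * (\<Sum>j\<le>g i x. b i j) \<le> real (N i) * b i (N i)"
proof -
  from q_pos[of "1 - x"] x obtain c where c: "c > 0" and
    ev: "\<forall>\<^sub>F i in sequentially. \<forall>k. (1 - x) * real (N i) \<le> real k \<longrightarrow> k \<le> N i \<longrightarrow> c \<le> 1 - p i k"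
    by auto
  show thesis
  proof (rule that[OF c])
    show "\<forall>\<^sub>F i in sequentially. c * (\<Sum>j\<le>g i x. b i j) \<le> real (N i) * b i (N i)"
      using ev N_large[of 1]
    proof eventually_elim
      case (elim i)
      have le: "real (g i x) \<le> x * real (N i)" using g_le x by simp
      also have "\<dots> < 1 * real (N i)" using x elim(2) by (intro mult_strict_right_mono) auto
      finally have m: "g i x < N i" by simp
      have "c * (\<Sum>j\<le>g i x. b i j) = (\<Sum>j\<le>g i x. c * b i j)" by (rule sum_distrib_left)
      also have "\<dots> \<le> (\<Sum>j\<le>g i x. (1 - p i (N i - j)) * b i j)"
      proof (intro sum_mono mult_right_mono b_nonneg)
        fix j assume "j \<in> {..g i x}"
        then have "real j \<le> real (g i x)" by simp
        then have "(1 - x) * real (N i) \<le> real (N i - j)" using le m \<open>j \<in> {..g i x}\<close>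
          by (simp add: of_nat_diff algebra_simps)
        then show "c \<le> 1 - p i (N i - j)" using elim(1) by simp
      qed
      also have "\<dots> \<le> (\<Sum>j<N i. (1 - p i (N i - j)) * b i j)"
        using m p01 b_nonneg by (intro sum_mono2) auto
      also have "\<dots> = (\<Sum>k=1..N i. (1 - p i k) * b i (N i - k))"
        by (rule sum.reindex_bij_witness[of _ "\<lambda>k. N i - k" "\<lambda>j. N i - j"]) auto
      also have "\<dots> = real (N i) * b i (N i)" by (rule b_rec[symmetric])
      finally show ?case .
    qed
  qed
qed

lemma b_N_pos: "\<forall>\<^sub>F i in sequentially. 0 < b i (N i)"
proof -
  obtain c where c: "c > 0"
    and ev: "\<forall>\<^sub>F i in sequentially. c * (\<Sum>j\<le>g i (1/2). b i j) \<le> real (N i) * b i (N i)"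
    by (rule b_sum_le[of "1/2"]) auto
  show ?thesis using ev
  proof eventually_elim
    case (elim i)
    have "b i 0 \<le> (\<Sum>j\<le>g i (1/2). b i j)"
      using b_nonneg by (intro member_le_sum) auto
    then have "0 < c * (\<Sum>j\<le>g i (1/2). b i j)"
      using b0_pos[of i] c by (intro mult_pos_pos) auto
    then have "0 < real (N i) * b i (N i)" using elim by linarith
    then show ?case using b_nonneg[of i "N i"] by (auto simp: zero_less_mult_iff)
  qed
qed

text \<open>By monotonicity N/2 times b at N/2 is at most the sum of b over [0, N/2], which
  \<open>b_sum_le\<close> bounds by a multiple of N b_N.\<close>

lemma b_doubling:
  obtains c where "c > 0" "\<forall>\<^sub>F i in sequentially. c * b i (g i (1/2)) \<le> b i (N i)"
proof -
  obtain c where c: "c > 0"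
    and ev: "\<forall>\<^sub>F i in sequentially. c * (\<Sum>j\<le>g i (1/2). b i j) \<le> real (N i) * b i (N i)"
    by (rule b_sum_le[of "1/2"]) auto
  show thesis
  proof (rule that[of "c / 2"])
    show "\<forall>\<^sub>F i in sequentially. c / 2 * b i (g i (1/2)) \<le> b i (N i)"
      using ev N_large[of 1]
    proof eventually_elim
      case (elim i)
      have "real (N i) * (c / 2 * b i (g i (1/2))) \<le> c * ((real (g i (1/2)) + 1) * b i (g i (1/2)))"
        using less_g[of "1/2" i] c mult_right_mono[of "real (N i) / 2" "real (g i (1/2)) + 1" "c * b i (g i (1/2))"] b_nonneg
        by (simp add: algebra_simps)
      also have "(real (g i (1/2)) + 1) * b i (g i (1/2)) \<le> (\<Sum>j\<le>g i (1/2). b i j)"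
        using sum_bounded_below[of "{..g i (1/2)}" "b i (g i (1/2))" "b i"] b_decD
        by (auto simp: add.commute)
      also have "c * (\<Sum>j\<le>g i (1/2). b i j) \<le> real (N i) * b i (N i)" by (rule elim)
      finally show ?case using elim c by simp
    qed
  qed (use c in auto)
qed

text \<open>Summing \<open>conv\<close> gives n + 1 as the sum of a_j b_k over the triangle j + k
  \<le> n, which is contained in the square.\<close>

lemma convolution_le_product:
  "real n + 1 \<le> (\<Sum>j\<le>n. a i j) * (\<Sum>j\<le>n. b i j)"
proof -
  have "real n + 1 = (\<Sum>m\<le>n. \<Sum>k\<le>m. a i k * b i (m - k))" by (simp add: conv)
  also have "\<dots> = (\<Sum>(j, k)\<in>{(j, k). j + k \<le> n}. a i j * b i k)"
    by (rule sum.triangle_reindex_eq[symmetric])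
  also have "\<dots> \<le> (\<Sum>(j, k)\<in>{..n} \<times> {..n}. a i j * b i k)"
    using a_nonneg b_nonneg by (intro sum_mono2) auto
  also have "\<dots> = (\<Sum>j\<le>n. a i j) * (\<Sum>j\<le>n. b i j)"
    by (simp add: sum_product sum.cartesian_product)
  finally show ?thesis .
qed

lemma W_ge: "b i (N i) * (\<Sum>k\<le>g i x. a i k) \<le> W i x"
  unfolding W_def sum_distrib_left
  by (intro sum_mono) (simp add: mult.commute mult_left_mono a_nonneg b_decD)

text \<open>Let A and B be the sums of a and b up to xN. Then W \<ge> b_N A, while N b_N \<ge> c B
  and A B \<ge> xN; hence W \<ge> cx. The bound, uniform in the row, makes the limit function
  strictly positive.\<close>

lemma W_lower:
  assumes x: "0 < x" "x < 1"
  obtains c where "c > 0" "\<forall>\<^sub>F i in sequentially. c \<le> W i x"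
proof -
  obtain c where c: "c > 0"
    and ev: "\<forall>\<^sub>F i in sequentially. c * (\<Sum>j\<le>g i x. b i j) \<le> real (N i) * b i (N i)"
    by (rule b_sum_le[OF x])
  show thesis
  proof (rule that[of "c * x"])
    show "\<forall>\<^sub>F i in sequentially. c * x \<le> W i x"
      using ev N_large[of 1]
    proof eventually_elim
      case (elim i)
      have "real (N i) * (c * x) \<le> c * (real (g i x) + 1)"
        using less_g[of x i] c by (simp add: mult.commute mult.left_commute)
      also have "\<dots> \<le> c * ((\<Sum>j\<le>g i x. a i j) * (\<Sum>j\<le>g i x. b i j))"
        using convolution_le_product c by (intro mult_left_mono) auto
      also have "\<dots> = (\<Sum>j\<le>g i x. a i j) * (c * (\<Sum>j\<le>g i x. b i j))" by simp
      also have "\<dots> \<le> (\<Sum>j\<le>g i x. a i j) * (real (N i) * b i (N i))"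
        using elim a_nonneg by (intro mult_left_mono) (auto intro: sum_nonneg)
      also have "\<dots> = real (N i) * (b i (N i) * (\<Sum>j\<le>g i x. a i j))" by simp
      also have "\<dots> \<le> real (N i) * W i x" using W_ge by (intro mult_left_mono) auto
      finally show ?case using elim by simp
    qed
  qed (use c x in auto)
qed

text \<open>Along a subsequence the monotone functions \<open>t \<mapsto> b(tN) / b(N/2)\<close> converge at the points
  \<open>1 - 2\<^bsup>-j-1\<^esup>\<close>; the limits decrease to a positive number, hence \<open>b\<close> is nearly constant on
  \<open>[N - C\<epsilon>N, N - \<kappa>\<epsilon>N]\<close>. The lower bound \<open>\<kappa> > 0\<close> is essential: \<open>b\<close> may have a jump at \<open>N\<close>.\<close>

lemma b_flat_near_end:
  "\<exists>r. strict_mono r \<and>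
    (\<forall>\<kappa>>0. \<forall>C>0. \<forall>\<zeta>>0. \<exists>\<epsilon>0>0. \<forall>\<epsilon>. 0 < \<epsilon> \<longrightarrow> \<epsilon> < \<epsilon>0 \<longrightarrow> (\<forall>\<^sub>F i in sequentially.
      \<forall>k l. real k \<le> C * \<epsilon> * real (N (r i)) \<longrightarrow> \<kappa> * \<epsilon> * real (N (r i)) \<le> real l \<longrightarrow>
        b (r i) (N (r i) - k) \<le> (1 + \<zeta>) * b (r i) (N (r i) - l)))"
proof -
  define t :: "nat \<Rightarrow> real" where "t j = 1 - (1/2) ^ Suc j" for j
  define \<beta> where "\<beta> i j = b i (g i (t j)) / b i (g i (1/2))" for i j
  have t_ge: "1/2 \<le> t j" for j unfolding t_def using power_le_one[of "1/2 :: real" j] by simp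
  have t_mono: "t j \<le> t k" if "j \<le> k" for j k
    using power_decreasing[OF that, of "1/2 :: real"] by (simp add: t_def)
  have \<beta>01: "0 \<le> \<beta> i j" "\<beta> i j \<le> 1" for i j
    using b_nonneg[of i "g i (t j)"] b_nonneg[of i "g i (1/2)"] b_decD[OF g_mono[OF t_ge[of j], of i], of i]
    by (simp_all add: \<beta>_def divide_le_eq_1) linarith
  let ?P = "\<lambda>n s. convergent (\<lambda>k. \<beta> (s k) n)"
  interpret diag: subseqs ?P
  proof
    fix n :: nat and s :: "nat \<Rightarrow> nat"
    have "\<exists>l\<in>{0..1}. \<exists>s'. strict_mono s' \<and> ((\<lambda>k. \<beta> (s k) n) \<circ> s') \<longlonglongrightarrow> l"
      using compact_imp_seq_compact[OF compact_Icc[of 0 "1 :: real"]]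
      by (rule seq_compactE[where f = "\<lambda>k. \<beta> (s k) n"]) (use \<beta>01 in auto)
    then show "\<exists>r'. strict_mono r' \<and> convergent (\<lambda>k. \<beta> ((s \<circ> r') k) n)"
      by (auto simp: convergent_def comp_def)
  qed
  define r where "r = diag.diagseq"
  have r: "strict_mono r" unfolding r_def by (rule diag.subseq_diagseq)
  define L where "L j = lim (\<lambda>i. \<beta> (r i) j)" for j
  have "convergent (\<lambda>i. \<beta> (r i) j)" for j
  proof -
    \<comment> \<open>Only from index j + 1 on is the diagonal sequence a subsequence of the one
      extracted for the point t_j, so convergence is first obtained for a tail.\<close>
    have "?P j (r \<circ> ((+) (Suc j)))"
      unfolding r_def
    proof (rule diag.diagseq_holds)
      fix q s :: "nat \<Rightarrow> nat" and n assume "strict_mono q" "convergent (\<lambda>k. \<beta> (s k) n)"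
      then show "convergent (\<lambda>k. \<beta> ((s \<circ> q) k) n)"
        using convergent_subseq_convergent[of "\<lambda>k. \<beta> (s k) n" q] by (simp add: comp_def)
    qed
    then have "convergent (\<lambda>k. \<beta> (r (k + Suc j)) j)" by (simp add: comp_def add.commute)
    then show ?thesis by (subst (asm) convergent_ignore_initial_segment)
  qed
  then have L: "(\<lambda>i. \<beta> (r i) j) \<longlonglongrightarrow> L j" for j
    by (simp add: L_def convergent_LIMSEQ_iff)
  have \<beta>_dec: "\<beta> i k \<le> \<beta> i j" if "j \<le> k" for i j k
    unfolding \<beta>_def by (intro divide_right_mono b_decD g_mono t_mono that b_nonneg)
  have L_dec: "decseq L"
  proof
    fix j k :: nat assume "j \<le> k"
    then show "L k \<le> L j" by (intro LIMSEQ_le[OF L L] exI[of _ 0]) (auto intro: \<beta>_dec)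
  qed
  obtain c where c: "c > 0" and dbl: "\<forall>\<^sub>F i in sequentially. c * b i (g i (1/2)) \<le> b i (N i)"
    by (rule b_doubling)
  have half_pos: "\<forall>\<^sub>F i in sequentially. 0 < b i (g i (1/2))"
    using b_N_pos
  proof eventually_elim
    case (elim i)
    have "g i (1/2) \<le> N i" using g_le[of "1/2" i] by linarith
    then show ?case using elim b_decD[of "g i (1/2)" "N i" i] by linarith
  qed
  have L_ge: "c \<le> L j" for j
  proof (rule tendsto_lowerbound[OF L])
    have "\<forall>\<^sub>F i in sequentially. c \<le> \<beta> i j"
      using dbl half_pos
    proof eventually_elim
      case (elim i)
      have "real (g i (t j)) \<le> 1 * real (N i)"
        using g_le[of "t j" i] t_ge[of j] mult_right_mono[of "t j" 1 "real (N i)"] by (simp add: t_def)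
      then have "b i (N i) \<le> b i (g i (t j))" using b_decD by simp
      then show ?case using elim by (simp add: \<beta>_def field_simps)
    qed
    then show "\<forall>\<^sub>F i in sequentially. c \<le> \<beta> (r i) j" by (rule eventually_subseq[OF r])
  qed simp
  obtain \<beta>\<^sub>0 where \<beta>\<^sub>0: "L \<longlonglongrightarrow> \<beta>\<^sub>0" "\<forall>j. \<beta>\<^sub>0 \<le> L j"
    by (rule decseq_convergent[OF L_dec, of c]) (use L_ge in auto)
  have "c \<le> \<beta>\<^sub>0" by (rule tendsto_lowerbound[OF \<beta>\<^sub>0(1)]) (simp_all add: L_ge)
  show ?thesis
  proof (intro exI[of _ r] conjI r allI impI)
    fix \<kappa> C \<zeta> :: real assume pos: "0 < \<kappa>" "0 < C" "0 < \<zeta>"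
    have "\<beta>\<^sub>0 < (1 + \<zeta>) * \<beta>\<^sub>0" using pos \<open>c \<le> \<beta>\<^sub>0\<close> c by simp
    \<comment> \<open>J brings \<open>L J\<close> within a factor 1 + \<zeta> of the limit, hence of
      every \<open>L K\<close>. The bound on \<epsilon> keeps N - C\<epsilon>N to the right of t_J
      N; afterwards K, depending on \<epsilon>, is taken so large that N - \<kappa>\<epsilon>N lies
      to the left of t_K N.\<close>
    then obtain J where J: "L J < (1 + \<zeta>) * \<beta>\<^sub>0"
      using order_tendstoD(2)[OF \<beta>\<^sub>0(1)] by (metis eventually_happens' sequentially_bot)
    show "\<exists>\<epsilon>0>0. \<forall>\<epsilon>. 0 < \<epsilon> \<longrightarrow> \<epsilon> < \<epsilon>0 \<longrightarrow> (\<forall>\<^sub>F i in sequentially.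
      \<forall>k l. real k \<le> C * \<epsilon> * real (N (r i)) \<longrightarrow> \<kappa> * \<epsilon> * real (N (r i)) \<le> real l \<longrightarrow>
        b (r i) (N (r i) - k) \<le> (1 + \<zeta>) * b (r i) (N (r i) - l))"
    proof (intro exI[of _ "(1/2) ^ Suc J / C"] conjI allI impI)
      show "0 < (1/2) ^ Suc J / C" using pos by simp
      fix \<epsilon> assume \<epsilon>: "0 < \<epsilon>" "\<epsilon> < (1/2) ^ Suc J / C"
      have C: "C * \<epsilon> \<le> 1 - t J" using \<epsilon> pos by (simp add: t_def field_simps)
      obtain K where "(1/2) ^ K < \<kappa> * \<epsilon>"
        using real_arch_pow_inv[of "\<kappa> * \<epsilon>" "1/2"] pos \<epsilon> by auto
      moreover have "(1/2 :: real) ^ Suc K \<le> (1/2) ^ K" by simp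
      ultimately have K: "1 - t K \<le> \<kappa> * \<epsilon>" unfolding t_def by linarith
      have "L J < (1 + \<zeta>) * L K"
        using J mult_left_mono[OF spec[OF \<beta>\<^sub>0(2), of K], of "1 + \<zeta>"] pos by linarith
      then have "L J - (1 + \<zeta>) * L K < 0" by simp
      moreover have "(\<lambda>i. \<beta> (r i) J - (1 + \<zeta>) * \<beta> (r i) K) \<longlonglongrightarrow> L J - (1 + \<zeta>) * L K"
        by (intro tendsto_intros L)
      ultimately have "\<forall>\<^sub>F i in sequentially. \<beta> (r i) J - (1 + \<zeta>) * \<beta> (r i) K < 0"
        by (rule order_tendstoD(2)[rotated])
      then show "\<forall>\<^sub>F i in sequentially.
        \<forall>k l. real k \<le> C * \<epsilon> * real (N (r i)) \<longrightarrow> \<kappa> * \<epsilon> * real (N (r i)) \<le> real l \<longrightarrow>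
          b (r i) (N (r i) - k) \<le> (1 + \<zeta>) * b (r i) (N (r i) - l)"
        using eventually_subseq[OF r half_pos]
      proof eventually_elim
        case (elim i)
        let ?i = "r i"
        have main: "b ?i (g ?i (t J)) \<le> (1 + \<zeta>) * b ?i (g ?i (t K))"
          using elim by (simp add: \<beta>_def pos_divide_less_eq)
        show ?case
        proof (intro allI impI)
          fix k l
          assume k: "real k \<le> C * \<epsilon> * real (N ?i)" and l: "\<kappa> * \<epsilon> * real (N ?i) \<le> real l"
          have "real k \<le> (1 - t J) * real (N ?i)"
            using k mult_right_mono[OF C, of "real (N ?i)"] by linarith
          then have "real (g ?i (t J)) \<le> real (N ?i - k)"
            using g_le[of "t J" ?i] t_ge[of J] by (simp add: left_diff_distrib)
          then have 1: "b ?i (N ?i - k) \<le> b ?i (g ?i (t J))" using b_decD by simp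
          have "(1 - t K) * real (N ?i) \<le> real l"
            using l mult_right_mono[OF K, of "real (N ?i)"] by linarith
          then have "real (N ?i) - real l \<le> t K * real (N ?i)" by (simp add: left_diff_distrib)
          then have "N ?i - l \<le> g ?i (t K)"
            using less_g[of "t K" ?i] by linarith
          then have "b ?i (g ?i (t K)) \<le> b ?i (N ?i - l)" using b_decD by simp
          then have "(1 + \<zeta>) * b ?i (g ?i (t K)) \<le> (1 + \<zeta>) * b ?i (N ?i - l)"
            using pos by (intro mult_left_mono) auto
          then show "b ?i (N ?i - k) \<le> (1 + \<zeta>) * b ?i (N ?i - l)" using 1 main by linarith
        qed
      qed
    qed
  qed
qed

section \<open>Ratios of W and their transfer to the limit\<close>

text \<open>For \<rho> > 0, pick \<kappa> with \<kappa>^\<rho> = x small: indices up to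
  \<kappa>\<epsilon>N carry at most the share 2x of the a-sum up to \<epsilon>N, and beyond them b(N
  - k) is nearly constant, so the ratio of W is nearly that of the a-sums. For \<rho> = 0 no
  \<kappa> makes this share small. But then the a-sum is slowly varying: from \<epsilon> to
  c\<epsilon> it gains only a share \<zeta>d, and the crude comparison d b(N/2) \<le> b(N)
  suffices.\<close>

lemma W_ratio:
  "\<exists>r. strict_mono r \<and>
    (\<forall>c>0. \<forall>\<zeta>>0. \<exists>\<epsilon>0>0. \<forall>\<epsilon>. 0 < \<epsilon> \<longrightarrow> \<epsilon> < \<epsilon>0 \<longrightarrow>
      (\<forall>\<^sub>F i in sequentially. W (r i) (c * \<epsilon>) \<le> (1 + \<zeta>) * c powr \<rho> * W (r i) \<epsilon>))"
proof -
  obtain r where r: "strict_mono r" and flat: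
    "\<forall>\<kappa>>0. \<forall>C>0. \<forall>\<zeta>>0. \<exists>\<epsilon>0>0. \<forall>\<epsilon>. 0 < \<epsilon> \<longrightarrow> \<epsilon> < \<epsilon>0 \<longrightarrow> (\<forall>\<^sub>F i in sequentially.
      \<forall>k l. real k \<le> C * \<epsilon> * real (N (r i)) \<longrightarrow> \<kappa> * \<epsilon> * real (N (r i)) \<le> real l \<longrightarrow>
        b (r i) (N (r i) - k) \<le> (1 + \<zeta>) * b (r i) (N (r i) - l))"
    using b_flat_near_end by (elim exE conjE) (rule that)
  have split: "W i y = W i x + (\<Sum>k\<in>{g i x<..g i y}. a i k * b i (N i - k))" if "x \<le> y" for i x y
  proof -
    have "{..g i y} = {..g i x} \<union> {g i x<..g i y}" using g_mono[OF that, of i] by auto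
    then show ?thesis unfolding W_def by (simp add: sum.union_disjoint ivl_disj_int)
  qed
  have splitA: "(\<Sum>k\<le>g i y. a i k) = (\<Sum>k\<le>g i x. a i k) + (\<Sum>k\<in>{g i x<..g i y}. a i k)" if "x \<le> y" for i x y
  proof -
    have "{..g i y} = {..g i x} \<union> {g i x<..g i y}" using g_mono[OF that, of i] by auto
    then show ?thesis by (simp add: sum.union_disjoint ivl_disj_int)
  qed
  have W_nonneg: "0 \<le> W i x" for i x
    unfolding W_def by (intro sum_nonneg mult_nonneg_nonneg a_nonneg b_nonneg)
  have A_nonneg: "0 \<le> (\<Sum>k\<le>g i x. a i k)" for i x by (intro sum_nonneg a_nonneg)
  show ?thesis
  proof (intro exI[of _ r] conjI r allI impI)
    fix c \<zeta> :: real assume c: "0 < c" and \<zeta>: "0 < \<zeta>"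
    show "\<exists>\<epsilon>0>0. \<forall>\<epsilon>. 0 < \<epsilon> \<longrightarrow> \<epsilon> < \<epsilon>0 \<longrightarrow>
      (\<forall>\<^sub>F i in sequentially. W (r i) (c * \<epsilon>) \<le> (1 + \<zeta>) * c powr \<rho> * W (r i) \<epsilon>)"
    proof (cases "\<rho> = 0")
      case True
      show ?thesis
      proof (cases "c \<le> 1")
        case c1: True
        have "W i (c * \<epsilon>) \<le> (1 + \<zeta>) * c powr \<rho> * W i \<epsilon>" if "0 < \<epsilon>" for i \<epsilon>
        proof -
          have "c * \<epsilon> \<le> \<epsilon>" using c1 that by simp
          then have "W i (c * \<epsilon>) \<le> W i \<epsilon>"
            using split[of "c * \<epsilon>" \<epsilon> i] by (simp add: sum_nonneg a_nonneg b_nonneg)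
          also have "\<dots> \<le> (1 + \<zeta>) * W i \<epsilon>" using W_nonneg \<zeta> mult_right_mono[of 1 "1 + \<zeta>" "W i \<epsilon>"] by simp
          finally show ?thesis using True c by simp
        qed
        then show ?thesis by (intro exI[of _ 1]) auto
      next
        case c1: False
        obtain d where d: "d > 0" and dbl: "\<forall>\<^sub>F i in sequentially. d * b i (g i (1/2)) \<le> b i (N i)"
          by (rule b_doubling)
        have "0 < \<zeta> * d" using \<zeta> d by simp
        then obtain \<epsilon>1 where \<epsilon>1: "\<epsilon>1 > 0" and ratio:
          "\<forall>\<epsilon>. 0 < \<epsilon> \<longrightarrow> \<epsilon> < \<epsilon>1 \<longrightarrow> (\<forall>\<^sub>F i in sequentially.
            (\<Sum>j\<le>g i (c * \<epsilon>). a i j) \<le> (1 + \<zeta> * d) * c powr \<rho> * (\<Sum>j\<le>g i \<epsilon>. a i j))"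
          using a_sum_ratio[OF c \<open>0 < \<zeta> * d\<close>] by (elim exE conjE) (rule that)
        show ?thesis
        proof (intro exI[of _ "min \<epsilon>1 (1 / (2 * c))"] conjI allI impI)
          show "0 < min \<epsilon>1 (1 / (2 * c))" using \<epsilon>1 c by simp
          fix \<epsilon> assume \<epsilon>: "0 < \<epsilon>" "\<epsilon> < min \<epsilon>1 (1 / (2 * c))"
          have \<epsilon>1': "\<epsilon> < \<epsilon>1" using \<epsilon> by simp
          \<comment> \<open>With c\<epsilon> \<le> 1/2 every index k in play leaves N - k \<ge> N/2,
            where b is at most its value at N/2.\<close>
          have ce: "c * \<epsilon> \<le> 1/2" "\<epsilon> \<le> c * \<epsilon>" using \<epsilon> c c1 by (auto simp: field_simps)
          have "\<forall>\<^sub>F i in sequentially. W i (c * \<epsilon>) \<le> (1 + \<zeta>) * c powr \<rho> * W i \<epsilon>"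
            using ratio[rule_format, OF \<epsilon>(1) \<epsilon>1'] dbl
          proof eventually_elim
            case (elim i)
            have "(\<Sum>k\<in>{g i \<epsilon><..g i (c * \<epsilon>)}. a i k * b i (N i - k))
              \<le> (\<Sum>k\<in>{g i \<epsilon><..g i (c * \<epsilon>)}. a i k * b i (g i (1/2)))"
            proof (intro sum_mono mult_left_mono a_nonneg b_decD)
              fix k assume "k \<in> {g i \<epsilon><..g i (c * \<epsilon>)}"
              then have "k \<le> g i (1/2)" using g_mono[OF ce(1), of i] by auto
              then show "g i (1/2) \<le> N i - k" using g_le[of "1/2" i] by linarith
            qed
            also have "\<dots> = b i (g i (1/2)) * ((\<Sum>k\<le>g i (c * \<epsilon>). a i k) - (\<Sum>k\<le>g i \<epsilon>. a i k))"
              using splitA[OF ce(2), of i] by (simp add: sum_distrib_left mult.commute)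
            also have "\<dots> \<le> b i (g i (1/2)) * (\<zeta> * d * (\<Sum>k\<le>g i \<epsilon>. a i k))"
              using elim(1) \<epsilon> True c b_nonneg by (intro mult_left_mono) (auto simp: algebra_simps)
            also have "\<dots> = \<zeta> * ((d * b i (g i (1/2))) * (\<Sum>k\<le>g i \<epsilon>. a i k))" by simp
            also have "\<dots> \<le> \<zeta> * (b i (N i) * (\<Sum>k\<le>g i \<epsilon>. a i k))"
              using elim(2) A_nonneg \<zeta> by (intro mult_left_mono mult_right_mono) auto
            also have "\<dots> \<le> \<zeta> * W i \<epsilon>" using W_ge \<zeta> by (intro mult_left_mono) auto
            finally show ?case using split[OF ce(2), of i] True c by (simp add: algebra_simps)
          qed
          then show "\<forall>\<^sub>F i in sequentially. W (r i) (c * \<epsilon>) \<le> (1 + \<zeta>) * c powr \<rho> * W (r i) \<epsilon>"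
            by (rule eventually_subseq[OF r])
        qed
      qed
    next
      case False
      then have \<rho>: "\<rho> > 0" using rho01 by simp
      \<comment> \<open>One factor 1 + x comes from the ratio of the a-sums, the other from the
        flatness of b; 1 - 2x is what remains after discarding the indices up to
        \<kappa>\<epsilon>N.\<close>
      have "((\<lambda>x. (1 + x)\<^sup>2 / (1 - 2 * x)) \<longlongrightarrow> (1 + 0)\<^sup>2 / (1 - 2 * 0)) (at_right (0::real))"
        by (intro tendsto_intros) auto
      then have "\<forall>\<^sub>F x in at_right 0. (1 + x)\<^sup>2 / (1 - 2 * x) < 1 + \<zeta>"
        using \<zeta> by (intro order_tendstoD(2)) auto
      moreover have "\<forall>\<^sub>F x in at_right (0::real). x < 1/2"
        by (auto simp: eventually_at_right_field intro: exI[of _ "1/2"])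
      moreover have "\<forall>\<^sub>F x in at_right (0::real). 0 < x"
        by (auto simp: eventually_at_right_field intro: exI[of _ 1])
      ultimately have "\<forall>\<^sub>F x in at_right (0::real). 0 < x \<and> x < 1/2 \<and> (1 + x)\<^sup>2 / (1 - 2 * x) < 1 + \<zeta>"
        by eventually_elim auto
      then obtain x :: real where x: "0 < x" "x < 1/2" "(1 + x)\<^sup>2 / (1 - 2 * x) < 1 + \<zeta>"
        using eventually_happens' trivial_limit_at_right_real by blast
      define \<kappa> where "\<kappa> = x powr (1 / \<rho>)"
      have \<kappa>: "0 < \<kappa>" "\<kappa> \<le> 1" "\<kappa> powr \<rho> = x"
        using x \<rho> by (auto simp: \<kappa>_def powr_powr powr_le1)
      obtain \<epsilon>1 where \<epsilon>1: "\<epsilon>1 > 0" and ratio1: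
        "\<forall>\<epsilon>. 0 < \<epsilon> \<longrightarrow> \<epsilon> < \<epsilon>1 \<longrightarrow> (\<forall>\<^sub>F i in sequentially.
          (\<Sum>j\<le>g i (c * \<epsilon>). a i j) \<le> (1 + x) * c powr \<rho> * (\<Sum>j\<le>g i \<epsilon>. a i j))"
        using a_sum_ratio[OF c x(1)] by (elim exE conjE) (rule that)
      obtain \<epsilon>2 where \<epsilon>2: "\<epsilon>2 > 0" and ratio2:
        "\<forall>\<epsilon>. 0 < \<epsilon> \<longrightarrow> \<epsilon> < \<epsilon>2 \<longrightarrow> (\<forall>\<^sub>F i in sequentially.
          (\<Sum>j\<le>g i (\<kappa> * \<epsilon>). a i j) \<le> (1 + 1) * \<kappa> powr \<rho> * (\<Sum>j\<le>g i \<epsilon>. a i j))"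
        using a_sum_ratio[OF \<kappa>(1) zero_less_one] by (elim exE conjE) (rule that)
      obtain \<epsilon>3 where \<epsilon>3: "\<epsilon>3 > 0" and flat3: "\<forall>\<epsilon>. 0 < \<epsilon> \<longrightarrow> \<epsilon> < \<epsilon>3 \<longrightarrow> (\<forall>\<^sub>F i in sequentially.
        \<forall>k l. real k \<le> c * \<epsilon> * real (N (r i)) \<longrightarrow> \<kappa> * \<epsilon> * real (N (r i)) \<le> real l \<longrightarrow>
          b (r i) (N (r i) - k) \<le> (1 + x) * b (r i) (N (r i) - l))"
        using flat[rule_format, OF \<kappa>(1) c x(1)] by (elim exE conjE) (rule that)
      show ?thesis
      proof (intro exI[of _ "min \<epsilon>1 (min \<epsilon>2 \<epsilon>3)"] conjI allI impI)
        show "0 < min \<epsilon>1 (min \<epsilon>2 \<epsilon>3)" using \<epsilon>1 \<epsilon>2 \<epsilon>3 by simp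
        fix \<epsilon> assume \<epsilon>: "0 < \<epsilon>" "\<epsilon> < min \<epsilon>1 (min \<epsilon>2 \<epsilon>3)"
        have \<kappa>\<epsilon>: "\<kappa> * \<epsilon> \<le> \<epsilon>" using \<kappa> \<epsilon> by simp
        have "\<forall>\<^sub>F i in sequentially.
            (\<Sum>j\<le>g (r i) (c * \<epsilon>). a (r i) j) \<le> (1 + x) * c powr \<rho> * (\<Sum>j\<le>g (r i) \<epsilon>. a (r i) j)"
          using eventually_subseq[OF r ratio1[rule_format, OF \<epsilon>(1)]] \<epsilon> by simp
        moreover have "\<forall>\<^sub>F i in sequentially.
            (\<Sum>j\<le>g (r i) (\<kappa> * \<epsilon>). a (r i) j) \<le> (1 + 1) * \<kappa> powr \<rho> * (\<Sum>j\<le>g (r i) \<epsilon>. a (r i) j)"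
          using eventually_subseq[OF r ratio2[rule_format, OF \<epsilon>(1)]] \<epsilon> by simp
        moreover have "\<forall>\<^sub>F i in sequentially.
          \<forall>k l. real k \<le> c * \<epsilon> * real (N (r i)) \<longrightarrow> \<kappa> * \<epsilon> * real (N (r i)) \<le> real l \<longrightarrow>
            b (r i) (N (r i) - k) \<le> (1 + x) * b (r i) (N (r i) - l)"
          using flat3[rule_format, OF \<epsilon>(1)] \<epsilon> by simp
        ultimately show "\<forall>\<^sub>F i in sequentially. W (r i) (c * \<epsilon>) \<le> (1 + \<zeta>) * c powr \<rho> * W (r i) \<epsilon>"
        proof eventually_elim
          case (elim i)
          let ?i = "r i"
          define A where "A = (\<Sum>j\<le>g ?i \<epsilon>. a ?i j)"
          \<comment> \<open>The successor is the first index beyond \<kappa>\<epsilon>N: it meets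
            the lower bound on l in \<open>flat3\<close>, and still every k >
            \<open>g ?i (\<kappa> * \<epsilon>)\<close> has b(N - k) \<ge> D.\<close>
          define D where "D = b ?i (N ?i - Suc (g ?i (\<kappa> * \<epsilon>)))"
          have D: "0 \<le> D" and A: "0 \<le> A" using b_nonneg A_nonneg by (auto simp: D_def A_def)
          have "W ?i (c * \<epsilon>) \<le> (\<Sum>k\<le>g ?i (c * \<epsilon>). a ?i k * ((1 + x) * D))"
            unfolding W_def
          proof (intro sum_mono mult_left_mono a_nonneg)
            fix k assume "k \<in> {..g ?i (c * \<epsilon>)}"
            then have "real k \<le> c * \<epsilon> * real (N ?i)" using g_le[of "c * \<epsilon>" ?i] c \<epsilon> by (simp add: order_trans)
            moreover have "\<kappa> * \<epsilon> * real (N ?i) \<le> real (Suc (g ?i (\<kappa> * \<epsilon>)))" using less_g[of "\<kappa> * \<epsilon>" ?i] by simp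
            ultimately show "b ?i (N ?i - k) \<le> (1 + x) * D" using elim(3) unfolding D_def by blast
          qed
          also have "\<dots> = (1 + x) * D * (\<Sum>k\<le>g ?i (c * \<epsilon>). a ?i k)" by (simp add: sum_distrib_left mult.commute)
          also have "\<dots> \<le> (1 + x) * D * ((1 + x) * c powr \<rho> * A)"
            using elim(1) D x unfolding A_def by (intro mult_left_mono) auto
          finally have up: "W ?i (c * \<epsilon>) \<le> (1 + x)\<^sup>2 * c powr \<rho> * (D * A)"
            by (simp add: power2_eq_square algebra_simps)
          have "D * (A - 2 * x * A) \<le> D * (\<Sum>k\<in>{g ?i (\<kappa> * \<epsilon>)<..g ?i \<epsilon>}. a ?i k)"
            using splitA[OF \<kappa>\<epsilon>, of ?i] elim(2) \<kappa>(3) D unfolding A_def by (intro mult_left_mono) auto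
          also have "\<dots> \<le> (\<Sum>k\<in>{g ?i (\<kappa> * \<epsilon>)<..g ?i \<epsilon>}. a ?i k * b ?i (N ?i - k))"
            unfolding sum_distrib_left D_def mult.commute[of _ "a _ _"]
            by (intro sum_mono mult_left_mono a_nonneg b_decD) auto
          also have "\<dots> \<le> W ?i \<epsilon>" using split[OF \<kappa>\<epsilon>, of ?i] W_nonneg by simp
          finally have low: "D * A \<le> W ?i \<epsilon> / (1 - 2 * x)" using x by (simp add: field_simps)
          have "W ?i (c * \<epsilon>) \<le> (1 + x)\<^sup>2 * c powr \<rho> * (W ?i \<epsilon> / (1 - 2 * x))"
            using up mult_left_mono[OF low, of "(1 + x)\<^sup>2 * c powr \<rho>"] by simp
          also have "\<dots> = ((1 + x)\<^sup>2 / (1 - 2 * x)) * (c powr \<rho> * W ?i \<epsilon>)" by simp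
          also have "\<dots> \<le> (1 + \<zeta>) * (c powr \<rho> * W ?i \<epsilon>)"
            using x W_nonneg by (intro mult_right_mono) auto
          finally show ?case by simp
        qed
      qed
    qed
  qed
qed

text \<open>F and W are comparable only at slightly different arguments, which costs a factor u on
  either side: F(c\<epsilon>) is bounded through W(uc\<epsilon>), and F(\<epsilon>) through
  W(\<epsilon>/u). The sandwich is inherited by the subsequence of \<open>W_ratio\<close>, and the
  inequality left for F no longer mentions it.\<close>

theorem regularly_varying_of_sandwich:
  assumes mono: "\<And>x y. 0 < x \<Longrightarrow> x \<le> y \<Longrightarrow> y < 1 \<Longrightarrow> F x \<le> F y"
    and low: "\<And>x x' z. 0 < x \<Longrightarrow> x < x' \<Longrightarrow> x' < 1 \<Longrightarrow> 0 < z \<Longrightarrow> \<forall>\<^sub>F i in sequentially. F x \<le> W i x' + z"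
    and up: "\<And>x x' z. 0 < x \<Longrightarrow> x < x' \<Longrightarrow> x' < 1 \<Longrightarrow> 0 < z \<Longrightarrow> \<forall>\<^sub>F i in sequentially. W i x \<le> F x' + z"
  shows "regularly_varying_at_0 \<rho> F"
proof -
  have F_pos: "0 < F x" if x: "0 < x" "x < 1" for x
  proof -
    obtain c where c: "c > 0" "\<forall>\<^sub>F i in sequentially. c \<le> W i (x/2)"
      by (rule W_lower[of "x/2"]) (use x in auto)
    have "\<forall>\<^sub>F i in sequentially. W i (x/2) \<le> F x + c / 2"
      using up[of "x/2" x "c/2"] x c(1) by simp
    then have "\<forall>\<^sub>F i in sequentially. c \<le> F x + c / 2"
      using c(2) by eventually_elim linarith
    then show ?thesis using c(1) by (simp add: eventually_const)
  qed
  obtain r where r: "strict_mono r" and W_r: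
    "\<forall>c>0. \<forall>\<zeta>>0. \<exists>\<epsilon>0>0. \<forall>\<epsilon>. 0 < \<epsilon> \<longrightarrow> \<epsilon> < \<epsilon>0 \<longrightarrow>
      (\<forall>\<^sub>F i in sequentially. W (r i) (c * \<epsilon>) \<le> (1 + \<zeta>) * c powr \<rho> * W (r i) \<epsilon>)"
    using W_ratio by (elim exE conjE) (rule that)
  have ratio: "\<exists>\<epsilon>0>0. \<forall>\<epsilon>. 0 < \<epsilon> \<longrightarrow> \<epsilon> < \<epsilon>0 \<longrightarrow> F (c * \<epsilon>) \<le> (1 + \<zeta>) * c powr \<rho> * F \<epsilon>"
    if c: "0 < c" and \<zeta>: "0 < \<zeta>" for c \<zeta>
  proof -
    \<comment> \<open>W is compared with accuracy 1 + \<zeta>/2 at the ratio u^2 c. As \<rho> \<le>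
      1, the surplus (u^2)^\<rho> is at most u^2, and (1 + \<zeta>/2) u^2 = 1 + \<zeta>.\<close>
    define u where "u = sqrt ((1 + \<zeta>) / (1 + \<zeta> / 2))"
    have q: "1 < (1 + \<zeta>) / (1 + \<zeta> / 2)" using \<zeta> by simp
    have u: "1 < u" "u\<^sup>2 = (1 + \<zeta>) / (1 + \<zeta> / 2)" using q by (simp_all add: u_def)
    have u2: "(u\<^sup>2) powr \<rho> \<le> u\<^sup>2" using powr_mono[of \<rho> 1 "u\<^sup>2"] rho01 u(1) by simp
    have c': "0 < u\<^sup>2 * c" using u(1) c by simp
    define K where "K = (1 + \<zeta>/2) * (u\<^sup>2 * c) powr \<rho>"
    have K: "0 \<le> K" "K \<le> (1 + \<zeta>) * c powr \<rho>"
    proof -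
      show "0 \<le> K" using \<zeta> by (simp add: K_def)
      have "K = ((1 + \<zeta>/2) * (u\<^sup>2) powr \<rho>) * c powr \<rho>" by (simp add: K_def powr_mult)
      also have "\<dots> \<le> ((1 + \<zeta>/2) * u\<^sup>2) * c powr \<rho>"
        using u2 \<zeta> by (intro mult_right_mono mult_left_mono) auto
      also have "\<dots> = (1 + \<zeta>) * c powr \<rho>" using \<zeta> by (simp add: u(2))
      finally show "K \<le> (1 + \<zeta>) * c powr \<rho>" .
    qed
    obtain \<epsilon>0 where \<epsilon>0: "\<epsilon>0 > 0" and Wr: "\<forall>\<epsilon>. 0 < \<epsilon> \<longrightarrow> \<epsilon> < \<epsilon>0 \<longrightarrow>
        (\<forall>\<^sub>F i in sequentially. W (r i) (u\<^sup>2 * c * \<epsilon>) \<le> K * W (r i) \<epsilon>)"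
      using W_r[rule_format, OF c' half_gt_zero[OF \<zeta>], folded K_def] by (elim exE conjE) (rule that)
    show ?thesis
    proof (intro exI[of _ "min \<epsilon>0 (min 1 (1 / (u * c)))"] conjI allI impI)
      show "0 < min \<epsilon>0 (min 1 (1 / (u * c)))" using \<epsilon>0 u c by simp
      fix \<epsilon> assume \<epsilon>: "0 < \<epsilon>" "\<epsilon> < min \<epsilon>0 (min 1 (1 / (u * c)))"
      have lt: "c * \<epsilon> < u * c * \<epsilon>" "u * c * \<epsilon> < 1" "\<epsilon> / u < \<epsilon>" "0 < \<epsilon> / u"
        using \<epsilon> c u by (auto simp: field_simps)
      have eq: "u\<^sup>2 * c * (\<epsilon> / u) = u * c * \<epsilon>" using u(1) by (simp add: power2_eq_square)
      have "\<forall>\<^sub>F i in sequentially. W (r i) (u * c * \<epsilon>) \<le> K * W (r i) (\<epsilon> / u)"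
        using Wr[rule_format, of "\<epsilon> / u"] lt \<epsilon> eq by simp
      moreover have "\<forall>\<^sub>F i in sequentially. F (c * \<epsilon>) \<le> W (r i) (u * c * \<epsilon>) + z" if "z > 0" for z
        using eventually_subseq[OF r low[of "c * \<epsilon>" "u * c * \<epsilon>" z]] lt c \<epsilon> that by simp
      moreover have "\<forall>\<^sub>F i in sequentially. W (r i) (\<epsilon> / u) \<le> F \<epsilon> + z" if "z > 0" for z
        using eventually_subseq[OF r up[of "\<epsilon> / u" \<epsilon> z]] lt \<epsilon> that by simp
      ultimately have approx: "F (c * \<epsilon>) \<le> K * (F \<epsilon> + z) + z" if z: "z > 0" for z
      proof -
        have "\<forall>\<^sub>F i in sequentially. F (c * \<epsilon>) \<le> K * (F \<epsilon> + z) + z"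
          using \<open>\<forall>\<^sub>F i in sequentially. W (r i) (u * c * \<epsilon>) \<le> K * W (r i) (\<epsilon> / u)\<close>
            \<open>\<And>z. z > 0 \<Longrightarrow> \<forall>\<^sub>F i in sequentially. F (c * \<epsilon>) \<le> W (r i) (u * c * \<epsilon>) + z\<close>[OF z]
            \<open>\<And>z. z > 0 \<Longrightarrow> \<forall>\<^sub>F i in sequentially. W (r i) (\<epsilon> / u) \<le> F \<epsilon> + z\<close>[OF z]
        proof eventually_elim
          case (elim i)
          show ?case using elim(1,2) mult_left_mono[OF elim(3) K(1)] by linarith
        qed
        then show ?thesis by (simp add: eventually_const)
      qed
      have "F (c * \<epsilon>) \<le> K * F \<epsilon>"
      proof (rule field_le_epsilon)
        fix e :: real assume e: "0 < e"
        define z where "z = e / (K + 1)"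
        have z: "0 < z" "(K + 1) * z = e" using e K by (simp_all add: z_def)
        have "F (c * \<epsilon>) \<le> K * F \<epsilon> + (K + 1) * z" using approx[OF z(1)] by (simp add: algebra_simps)
        then show "F (c * \<epsilon>) \<le> K * F \<epsilon> + e" by (simp add: z(2))
      qed
      also have "\<dots> \<le> (1 + \<zeta>) * c powr \<rho> * F \<epsilon>"
        using K F_pos[of \<epsilon>] \<epsilon> by (intro mult_right_mono) auto
      finally show "F (c * \<epsilon>) \<le> (1 + \<zeta>) * c powr \<rho> * F \<epsilon>" .
    qed
  qed
  have "((\<lambda>x. F (c * x) / F x) \<longlongrightarrow> c powr \<rho>) (at_right 0)" if c: "0 < c" for c
  proof (rule order_tendstoI)
    fix y assume y: "c powr \<rho> < y"
    define \<zeta> where "\<zeta> = (y / c powr \<rho> - 1) / 2"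
    have \<zeta>: "0 < \<zeta>" "(1 + \<zeta>) * c powr \<rho> < y" using y c by (auto simp: \<zeta>_def field_simps)
    obtain \<epsilon>0 where \<epsilon>0: "\<epsilon>0 > 0" "\<forall>\<epsilon>. 0 < \<epsilon> \<longrightarrow> \<epsilon> < \<epsilon>0 \<longrightarrow> F (c * \<epsilon>) \<le> (1 + \<zeta>) * c powr \<rho> * F \<epsilon>"
      using ratio[OF c \<zeta>(1)] by (elim exE conjE) (rule that)
    show "\<forall>\<^sub>F x in at_right 0. F (c * x) / F x < y"
      unfolding eventually_at_right_field
    proof (intro exI[of _ "min \<epsilon>0 1"] conjI allI impI)
      fix x assume x: "0 < x" "x < min \<epsilon>0 1"
      have "F (c * x) / F x \<le> (1 + \<zeta>) * c powr \<rho>"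
        using \<epsilon>0(2)[rule_format, of x] F_pos[of x] x by (simp add: field_simps)
      then show "F (c * x) / F x < y" using \<zeta> by simp
    qed (use \<epsilon>0 in auto)
  next
    fix y assume y: "y < c powr \<rho>"
    \<comment> \<open>The lower bound is the upper ratio bound for 1/c at the argument cx. For y
      \<le> 0 any positive \<zeta> works; otherwise half of the available slack is used.\<close>
    define \<zeta> where "\<zeta> = (if y \<le> 0 then 1 else (c powr \<rho> / y - 1) / 2)"
    have \<zeta>: "0 < \<zeta>" "y * (1 + \<zeta>) < c powr \<rho>"
      using y c by (auto simp: \<zeta>_def field_simps)
    obtain \<epsilon>0 where \<epsilon>0: "\<epsilon>0 > 0" "\<forall>\<epsilon>. 0 < \<epsilon> \<longrightarrow> \<epsilon> < \<epsilon>0 \<longrightarrow> F (1 / c * \<epsilon>) \<le> (1 + \<zeta>) * (1 / c) powr \<rho> * F \<epsilon>"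
      using ratio[OF divide_pos_pos[OF zero_less_one c] \<zeta>(1)] by (elim exE conjE) (rule that)
    show "\<forall>\<^sub>F x in at_right 0. y < F (c * x) / F x"
      unfolding eventually_at_right_field
    proof (intro exI[of _ "min (\<epsilon>0 / c) 1"] conjI allI impI)
      fix x assume x: "0 < x" "x < min (\<epsilon>0 / c) 1"
      have "F x \<le> (1 + \<zeta>) * (1 / c) powr \<rho> * F (c * x)"
        using \<epsilon>0(2)[rule_format, of "c * x"] x c by (simp add: field_simps)
      then have "c powr \<rho> * F x \<le> (1 + \<zeta>) * F (c * x)"
        using c by (simp add: powr_divide field_simps)
      then have "c powr \<rho> / (1 + \<zeta>) \<le> F (c * x) / F x"
        using F_pos[of x] x \<zeta> by (simp add: field_simps)
      moreover have "y < c powr \<rho> / (1 + \<zeta>)" using \<zeta> by (simp add: field_simps)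
      ultimately show "y < F (c * x) / F x" by simp
    qed (use \<epsilon>0 c in auto)
  qed
  moreover have "F \<in> borel_measurable (restrict_space borel {0<..<1})"
    by (rule borel_measurable_mono_on_fnc) (auto simp: mono_on_def intro: mono)
  ultimately show ?thesis
    unfolding regularly_varying_at_0_def using F_pos by (auto intro!: exI[of _ 1])
qed

end

section \<open>The first maximum of a random walk\<close>

definition partial_sum :: "(nat \<Rightarrow> real) \<Rightarrow> nat \<Rightarrow> real" where
  "partial_sum x n = (\<Sum>i<n. x i)"

text \<open>Ties go to the earliest index, so comparisons are strict before the maximum and weak
  after it. This matches the strict inequality in \<open>pos\<close> and the weak one in
  \<open>neg\<close>.\<close>

definition first_argmax :: "(nat \<Rightarrow> real) \<Rightarrow> nat \<Rightarrow> nat" where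
  "first_argmax x n = (LEAST k. k \<le> n \<and> (\<forall>j\<le>n. partial_sum x j \<le> partial_sum x k))"

lemma first_argmax_ex:
  "\<exists>k\<le>n. \<forall>j\<le>n. partial_sum x j \<le> partial_sum x k"
proof -
  have "Max (partial_sum x ` {..n}) \<in> partial_sum x ` {..n}" by (intro Max_in) auto
  then obtain k where "Max (partial_sum x ` {..n}) = partial_sum x k" "k \<in> {..n}" by (rule imageE)
  then show ?thesis using Max_ge[of "partial_sum x ` {..n}"] by (intro exI[of _ k]) auto
qed

lemma first_argmax_props:
  shows first_argmax_le: "first_argmax x n \<le> n"
    and first_argmax_ge: "j \<le> n \<Longrightarrow> partial_sum x j \<le> partial_sum x (first_argmax x n)"
    and first_argmax_gt: "j < first_argmax x n \<Longrightarrow> partial_sum x j < partial_sum x (first_argmax x n)"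
proof -
  let ?P = "\<lambda>k. k \<le> n \<and> (\<forall>j\<le>n. partial_sum x j \<le> partial_sum x k)"
  have P: "?P (first_argmax x n)"
    unfolding first_argmax_def by (rule LeastI_ex) (rule first_argmax_ex)
  then show le: "first_argmax x n \<le> n" and ge: "j \<le> n \<Longrightarrow> partial_sum x j \<le> partial_sum x (first_argmax x n)"
    by auto
  show "partial_sum x j < partial_sum x (first_argmax x n)" if "j < first_argmax x n"
  proof (rule ccontr)
    assume "\<not> partial_sum x j < partial_sum x (first_argmax x n)"
    then have "?P j" using P that by (auto intro: order_trans)
    moreover have "\<not> ?P j" using not_less_Least[of j ?P] that unfolding first_argmax_def by blast
    ultimately show False by blast
  qed
qed

lemma first_argmax_eqI:
  assumes "k \<le> n" "\<And>j. j < k \<Longrightarrow> partial_sum x j < partial_sum x k"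
    "\<And>j. k < j \<Longrightarrow> j \<le> n \<Longrightarrow> partial_sum x j \<le> partial_sum x k"
  shows "first_argmax x n = k"
proof (rule antisym)
  have "partial_sum x j \<le> partial_sum x k" if "j \<le> n" for j
    using assms(2)[of j] assms(3)[of j] that by (cases j k rule: linorder_cases) auto
  then show "first_argmax x n \<le> k"
    unfolding first_argmax_def using assms(1) by (intro Least_le) auto
  show "k \<le> first_argmax x n"
    using first_argmax_ge[OF assms(1), of x] assms(2) by (meson leD not_le_imp_less)
qed

lemma first_argmax_eq_iff:
  assumes "k \<le> n"
  shows "first_argmax x n = k \<longleftrightarrow> (\<forall>j<k. partial_sum x j < partial_sum x k) \<and>
    (\<forall>j. k < j \<longrightarrow> j \<le> n \<longrightarrow> partial_sum x j \<le> partial_sum x k)"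
proof
  assume "first_argmax x n = k"
  then show "(\<forall>j<k. partial_sum x j < partial_sum x k) \<and>
    (\<forall>j. k < j \<longrightarrow> j \<le> n \<longrightarrow> partial_sum x j \<le> partial_sum x k)"
    using first_argmax_ge[of _ n x] first_argmax_gt[of _ x n] by auto
next
  assume "(\<forall>j<k. partial_sum x j < partial_sum x k) \<and>
    (\<forall>j. k < j \<longrightarrow> j \<le> n \<longrightarrow> partial_sum x j \<le> partial_sum x k)"
  then show "first_argmax x n = k" by (intro first_argmax_eqI[OF assms]) blast+
qed

lemma partial_sum_cong: "(\<And>i. i < n \<Longrightarrow> x i = y i) \<Longrightarrow> partial_sum x n = partial_sum y n"
  by (simp add: partial_sum_def)

lemma first_argmax_cong:
  assumes "\<And>i. i < n \<Longrightarrow> x i = y i"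
  shows "first_argmax x n = first_argmax y n"
proof -
  have "partial_sum x j = partial_sum y j" if "j \<le> n" for j
    using assms that by (intro partial_sum_cong) auto
  then have "(\<lambda>k. k \<le> n \<and> (\<forall>j\<le>n. partial_sum x j \<le> partial_sum x k))
      = (\<lambda>k. k \<le> n \<and> (\<forall>j\<le>n. partial_sum y j \<le> partial_sum y k))"
    by (intro ext) auto
  then show ?thesis unfolding first_argmax_def by simp
qed

lemma partial_sum_Suc_shift: "partial_sum x (Suc n) = x 0 + partial_sum (\<lambda>i. x (Suc i)) n"
  unfolding partial_sum_def by (rule sum.lessThan_Suc_shift)

lemma first_argmax_Suc_nonpos:
  assumes "partial_sum x (Suc n) \<le> 0"
  shows "first_argmax x (Suc n) = first_argmax x n"
proof (rule first_argmax_eqI)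
  show "first_argmax x n \<le> Suc n" using first_argmax_le[of x n] by simp
  show "partial_sum x j < partial_sum x (first_argmax x n)" if "j < first_argmax x n" for j
    using first_argmax_gt[OF that] .
  show "partial_sum x j \<le> partial_sum x (first_argmax x n)" if "j \<le> Suc n" for j
  proof (cases "j = Suc n")
    case True
    then show ?thesis using assms first_argmax_ge[of 0 n x] by (simp add: partial_sum_def)
  next
    case False
    then show ?thesis using that by (intro first_argmax_ge) auto
  qed
qed

text \<open>As S_0 = 0 < S_{n+1}, index 0 is not a maximiser; on the remaining indices, removing the
  first step subtracts a constant.\<close>

lemma first_argmax_Suc_pos:
  assumes "0 < partial_sum x (Suc n)"
  shows "first_argmax x (Suc n) = Suc (first_argmax (\<lambda>i. x (Suc i)) n)"
proof (rule first_argmax_eqI)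
  let ?y = "\<lambda>i. x (Suc i)"
  let ?k = "first_argmax ?y n"
  show "Suc ?k \<le> Suc n" using first_argmax_le[of ?y n] by simp
  show "partial_sum x j < partial_sum x (Suc ?k)" if "j < Suc ?k" for j
  proof (cases j)
    case 0
    have "partial_sum x (Suc n) \<le> partial_sum x (Suc ?k)"
      using first_argmax_ge[of n n ?y] by (simp add: partial_sum_Suc_shift)
    then show ?thesis using assms 0 by (simp add: partial_sum_def[of x 0])
  next
    case (Suc i)
    then show ?thesis using first_argmax_gt[of i ?y n] that by (simp add: partial_sum_Suc_shift)
  qed
  show "partial_sum x j \<le> partial_sum x (Suc ?k)" if "Suc ?k < j" "j \<le> Suc n" for j
    using that first_argmax_ge[of "j - 1" n ?y] by (cases j) (auto simp: partial_sum_Suc_shift)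
qed

lemma borel_measurable_pred_le [measurable (raw)]:
  fixes f g :: "'a \<Rightarrow> real"
  shows "f \<in> borel_measurable M \<Longrightarrow> g \<in> borel_measurable M \<Longrightarrow> Measurable.pred M (\<lambda>w. f w \<le> g w)"
  unfolding Measurable.pred_def by (rule borel_measurable_le)

lemma measurable_partial_sum [measurable]:
  "(\<lambda>x. partial_sum x n) \<in> borel_measurable (Pi\<^sub>M UNIV (\<lambda>_. borel))"
  unfolding partial_sum_def by measurable

lemma measurable_first_argmax [measurable]:
  "(\<lambda>x. first_argmax x n) \<in> measurable (Pi\<^sub>M UNIV (\<lambda>_. borel)) (count_space UNIV)"
  unfolding first_argmax_def by measurable

section \<open>Walks with independent, identically distributed steps\<close>

locale iid_walk = prob_space M for M :: "'a measure" +
  fixes \<xi> :: "nat \<Rightarrow> 'a \<Rightarrow> real"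
  assumes indep: "indep_vars (\<lambda>_. borel) \<xi> UNIV"
    and ident: "\<And>n. distr M borel (\<xi> n) = distr M borel (\<xi> 0)"
begin

abbreviation (input) path :: "'a \<Rightarrow> nat \<Rightarrow> real" where "path \<omega> \<equiv> \<lambda>i. \<xi> i \<omega>"

definition pos :: "nat \<Rightarrow> real" where
  "pos n = \<P>(\<omega> in M. \<forall>k. 1 \<le> k \<longrightarrow> k \<le> n \<longrightarrow> 0 < partial_sum (path \<omega>) k)"

definition neg :: "nat \<Rightarrow> real" where
  "neg n = \<P>(\<omega> in M. \<forall>k. 1 \<le> k \<longrightarrow> k \<le> n \<longrightarrow> partial_sum (path \<omega>) k \<le> 0)"

definition p :: "nat \<Rightarrow> real" where
  "p n = \<P>(\<omega> in M. 0 < partial_sum (path \<omega>) n)"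

lemma rv [measurable]: "\<xi> n \<in> borel_measurable M"
  using indep by (auto simp: indep_vars_def)

lemma path_measurable [measurable]: "path \<in> measurable M (Pi\<^sub>M UNIV (\<lambda>_. borel))"
  by (rule measurable_PiM_single') auto

text \<open>Both laws are the infinite product of the common step law. Three reindexings are of
  interest: reversal of the first k steps, a shift, and a cyclic permutation.\<close>

lemma distr_reindex:
  assumes "inj \<pi>"
  shows "distr M (Pi\<^sub>M UNIV (\<lambda>_. borel)) (\<lambda>\<omega> i. \<xi> (\<pi> i) \<omega>) = distr M (Pi\<^sub>M UNIV (\<lambda>_. borel)) path"
proof -
  let ?B = "Pi\<^sub>M UNIV (\<lambda>_ :: nat. borel :: real measure)"
  let ?D = "Pi\<^sub>M UNIV (\<lambda>_ :: nat. distr M borel (\<xi> 0))"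
  have "distr M ?B path = Pi\<^sub>M UNIV (\<lambda>n. distr M borel (\<xi> n))"
    using indep_vars_iff_distr_eq_PiM[where I = UNIV and M' = "\<lambda>_. borel" and X = \<xi>] indep
    by (simp add: restrict_UNIV)
  also have "\<dots> = ?D" by (intro PiM_cong ident refl)
  finally have D: "distr M ?B path = ?D" .
  have sets: "sets ?D = sets ?B" by (intro sets_PiM_cong) auto
  have "distr M ?B (\<lambda>\<omega> i. \<xi> (\<pi> i) \<omega>) = distr (distr M ?B path) ?B (\<lambda>x i. x (\<pi> i))"
    by (subst distr_distr) (auto simp: comp_def intro!: measurable_PiM_single')
  also have "\<dots> = distr ?D ?D (\<lambda>x. \<lambda>i\<in>UNIV. x (\<pi> i))"
    unfolding D by (intro distr_cong) (simp_all add: sets restrict_UNIV)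
  also have "\<dots> = ?D"
    using distr_PiM_reindex[of UNIV "\<lambda>_. distr M borel (\<xi> 0)" \<pi> UNIV] assms by (simp add: prob_space_distr)
  finally show ?thesis by (simp add: D)
qed

lemma prob_reindex:
  assumes "inj \<pi>" and [measurable]: "Measurable.pred (Pi\<^sub>M UNIV (\<lambda>_. borel)) Q"
  shows "\<P>(\<omega> in M. Q (\<lambda>i. \<xi> (\<pi> i) \<omega>)) = \<P>(\<omega> in M. Q (path \<omega>))"
proof -
  let ?B = "Pi\<^sub>M UNIV (\<lambda>_ :: nat. borel :: real measure)"
  have [measurable]: "(\<lambda>\<omega> i. \<xi> (\<pi> i) \<omega>) \<in> measurable M ?B"
    by (intro measurable_PiM_single') auto
  have "\<P>(\<omega> in M. Q (f \<omega>)) = measure (distr M ?B f) {x \<in> space ?B. Q x}"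
    if [measurable]: "f \<in> measurable M ?B" for f
    by (subst measure_distr) (auto intro!: arg_cong[where f = prob] measurable_space[OF that])
  from this[of "\<lambda>\<omega> i. \<xi> (\<pi> i) \<omega>"] this[of path] show ?thesis by (simp add: distr_reindex[OF assms(1)])
qed

lemma expectation_reindex:
  assumes "inj \<pi>" and [measurable]: "f \<in> borel_measurable (Pi\<^sub>M UNIV (\<lambda>_. borel))"
  shows "expectation (\<lambda>\<omega>. f (\<lambda>i. \<xi> (\<pi> i) \<omega>)) = (expectation (\<lambda>\<omega>. f (path \<omega>)) :: real)"
proof -
  let ?B = "Pi\<^sub>M UNIV (\<lambda>_ :: nat. borel :: real measure)"
  have [measurable]: "(\<lambda>\<omega> i. \<xi> (\<pi> i) \<omega>) \<in> measurable M ?B"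
    by (intro measurable_PiM_single') auto
  show ?thesis
    using integral_distr[of "\<lambda>\<omega> i. \<xi> (\<pi> i) \<omega>" M ?B f] integral_distr[of path M ?B f]
    by (simp add: distr_reindex[OF assms(1)])
qed

text \<open>Duality: reversing the first k steps turns S_k - S_{k-j} into the j-th partial
  sum.\<close>

lemma prob_before_argmax:
  "\<P>(\<omega> in M. \<forall>j<k. partial_sum (path \<omega>) j < partial_sum (path \<omega>) k) = pos k"
proof -
  define \<pi> where "\<pi> i = (if i < k then k - 1 - i else i)" for i
  have inj: "inj \<pi>" unfolding inj_def \<pi>_def by auto
  have rev: "partial_sum (\<lambda>i. x (\<pi> i)) j = partial_sum x k - partial_sum x (k - j)" if "j \<le> k" for j and x :: "nat \<Rightarrow> real"
  proof -
    have "partial_sum (\<lambda>i. x (\<pi> i)) j = (\<Sum>i\<in>{k - j..<k}. x i)"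
      unfolding partial_sum_def
      by (rule sum.reindex_bij_witness[of _ "\<lambda>i. k - 1 - i" "\<lambda>i. k - 1 - i"]) (use that in \<open>auto simp: \<pi>_def\<close>)
    also have "\<dots> = partial_sum x k - partial_sum x (k - j)"
      unfolding partial_sum_def by (simp add: lessThan_atLeast0 sum_diff_nat_ivl[of 0 "k - j" k x])
    finally show ?thesis .
  qed
  have "(\<forall>j<k. partial_sum x j < partial_sum x k) \<longleftrightarrow>
      (\<forall>j. 1 \<le> j \<longrightarrow> j \<le> k \<longrightarrow> 0 < partial_sum (\<lambda>i. x (\<pi> i)) j)" for x
  proof (intro iffI allI impI)
    fix j assume "\<forall>j<k. partial_sum x j < partial_sum x k" "1 \<le> j" "j \<le> k"
    then show "0 < partial_sum (\<lambda>i. x (\<pi> i)) j" by (simp add: rev)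
  next
    fix j assume *: "\<forall>j. 1 \<le> j \<longrightarrow> j \<le> k \<longrightarrow> 0 < partial_sum (\<lambda>i. x (\<pi> i)) j" and "j < k"
    then have "0 < partial_sum (\<lambda>i. x (\<pi> i)) (k - j)" by simp
    then show "partial_sum x j < partial_sum x k" using \<open>j < k\<close> by (simp add: rev)
  qed
  then show ?thesis
    using prob_reindex[OF inj, of "\<lambda>x. \<forall>j. 1 \<le> j \<longrightarrow> j \<le> k \<longrightarrow> 0 < partial_sum x j"]
    by (simp add: pos_def)
qed

text \<open>The steps after time k form a copy of the walk.\<close>

lemma prob_after_argmax:
  assumes "k \<le> n"
  shows "\<P>(\<omega> in M. \<forall>j. k < j \<longrightarrow> j \<le> n \<longrightarrow> partial_sum (path \<omega>) j \<le> partial_sum (path \<omega>) k) = neg (n - k)"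
proof -
  define \<pi> where "\<pi> i = k + i" for i
  have inj: "inj \<pi>" unfolding inj_def \<pi>_def by auto
  have shift: "partial_sum x (k + j) = partial_sum x k + partial_sum (\<lambda>i. x (\<pi> i)) j" for j and x :: "nat \<Rightarrow> real"
    unfolding partial_sum_def \<pi>_def by (induction j) auto
  have "(\<forall>j. k < j \<longrightarrow> j \<le> n \<longrightarrow> partial_sum x j \<le> partial_sum x k) \<longleftrightarrow>
      (\<forall>j. 1 \<le> j \<longrightarrow> j \<le> n - k \<longrightarrow> partial_sum (\<lambda>i. x (\<pi> i)) j \<le> 0)" for x
  proof (intro iffI allI impI)
    fix j assume *: "\<forall>j. k < j \<longrightarrow> j \<le> n \<longrightarrow> partial_sum x j \<le> partial_sum x k" "1 \<le> j" "j \<le> n - k"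
    then have "partial_sum x (k + j) \<le> partial_sum x k" using assms by simp
    then show "partial_sum (\<lambda>i. x (\<pi> i)) j \<le> 0" by (simp add: shift)
  next
    fix j assume *: "\<forall>j. 1 \<le> j \<longrightarrow> j \<le> n - k \<longrightarrow> partial_sum (\<lambda>i. x (\<pi> i)) j \<le> 0" and "k < j" "j \<le> n"
    then have "partial_sum (\<lambda>i. x (\<pi> i)) (j - k) \<le> 0" by simp
    then show "partial_sum x j \<le> partial_sum x k" using shift[of x "j - k"] \<open>k < j\<close> by simp
  qed
  then show ?thesis
    using prob_reindex[OF inj, of "\<lambda>x. \<forall>j. 1 \<le> j \<longrightarrow> j \<le> n - k \<longrightarrow> partial_sum x j \<le> 0"]
    by (simp add: neg_def)
qed

text \<open>The event is the intersection of a condition on the steps before k and one on the steps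
  from k on. These are independent; duality and the shift identify the two factors.\<close>

lemma prob_first_argmax:
  assumes "k \<le> n"
  shows "\<P>(\<omega> in M. first_argmax (path \<omega>) n = k) = pos k * neg (n - k)"
proof -
  let ?A = "{..<k}" and ?B = "{k..}"
  let ?PA = "Pi\<^sub>M ?A (\<lambda>_. borel :: real measure)" and ?PB = "Pi\<^sub>M ?B (\<lambda>_. borel :: real measure)"
  \<comment> \<open>The bound \<open>min j k\<close> confines the sum to coordinates below k for
    every j, so its measurability on the restricted product holds without the side condition j <
    k.\<close>
  define E1 where "E1 = {y \<in> space ?PA. \<forall>j<k. (\<Sum>i<min j k. y i) < (\<Sum>i<k. y i)}"
  define E2 where "E2 = {y \<in> space ?PB. \<forall>j. k < j \<longrightarrow> j \<le> n \<longrightarrow> (\<Sum>i\<in>{k..<j}. y i) \<le> 0}"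
  have meas1: "(\<lambda>y. \<Sum>i<min j k. y i) \<in> borel_measurable ?PA" for j
    by (intro borel_measurable_sum measurable_component_singleton) auto
  from meas1[of k] have meas1': "(\<lambda>y. \<Sum>i<k. y i) \<in> borel_measurable ?PA" by simp
  have meas2: "(\<lambda>y. \<Sum>i\<in>{k..<j}. y i) \<in> borel_measurable ?PB" for j
    by (intro borel_measurable_sum measurable_component_singleton) auto
  note [measurable] = meas1 meas1' meas2
  have E1: "E1 \<in> sets ?PA" unfolding E1_def by measurable
  have E2: "E2 \<in> sets ?PB" unfolding E2_def by measurable
  have ind: "indep_var ?PA (\<lambda>\<omega>. restrict (path \<omega>) ?A) ?PB (\<lambda>\<omega>. restrict (path \<omega>) ?B)"
    by (rule indep_var_restrict[OF indep]) auto
  have 1: "restrict (path \<omega>) ?A \<in> E1 \<longleftrightarrow> (\<forall>j<k. partial_sum (path \<omega>) j < partial_sum (path \<omega>) k)" for \<omega>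
    unfolding E1_def partial_sum_def by (auto simp: space_PiM)
  have 2: "restrict (path \<omega>) ?B \<in> E2 \<longleftrightarrow> (\<forall>j. k < j \<longrightarrow> j \<le> n \<longrightarrow> partial_sum (path \<omega>) j \<le> partial_sum (path \<omega>) k)" for \<omega>
  proof -
    have "(\<Sum>i\<in>{k..<j}. \<xi> i \<omega>) = partial_sum (path \<omega>) j - partial_sum (path \<omega>) k" if "k < j" for j
      using that unfolding partial_sum_def by (simp add: lessThan_atLeast0 sum_diff_nat_ivl)
    then show ?thesis unfolding E2_def by (auto simp: space_PiM)
  qed
  have "\<P>(\<omega> in M. first_argmax (path \<omega>) n = k)
    = prob ((\<lambda>\<omega>. (restrict (path \<omega>) ?A, restrict (path \<omega>) ?B)) -` (E1 \<times> E2) \<inter> space M)"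
    by (intro arg_cong[where f = prob]) (auto simp: first_argmax_eq_iff[OF assms] 1 2)
  also have "\<dots> = prob ((\<lambda>\<omega>. restrict (path \<omega>) ?A) -` E1 \<inter> space M) * prob ((\<lambda>\<omega>. restrict (path \<omega>) ?B) -` E2 \<inter> space M)"
    by (rule indep_varD[OF ind E1 E2])
  also have "(\<lambda>\<omega>. restrict (path \<omega>) ?A) -` E1 \<inter> space M = {\<omega> \<in> space M. \<forall>j<k. partial_sum (path \<omega>) j < partial_sum (path \<omega>) k}"
    by (auto simp: 1)
  also have "(\<lambda>\<omega>. restrict (path \<omega>) ?B) -` E2 \<inter> space M =
      {\<omega> \<in> space M. \<forall>j. k < j \<longrightarrow> j \<le> n \<longrightarrow> partial_sum (path \<omega>) j \<le> partial_sum (path \<omega>) k}"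
    by (auto simp: 2)
  finally show ?thesis by (simp add: prob_before_argmax prob_after_argmax[OF assms])
qed

lemma prob_first_argmax_in:
  assumes "J \<subseteq> {..n}"
  shows "\<P>(\<omega> in M. first_argmax (path \<omega>) n \<in> J) = (\<Sum>k\<in>J. pos k * neg (n - k))"
proof -
  have "{\<omega> \<in> space M. first_argmax (path \<omega>) n \<in> J} = (\<Union>k\<in>J. {\<omega> \<in> space M. first_argmax (path \<omega>) n = k})"
    by auto
  also have "prob \<dots> = (\<Sum>k\<in>J. \<P>(\<omega> in M. first_argmax (path \<omega>) n = k))"
    using assms finite_subset by (intro finite_measure_finite_Union) (auto simp: disjoint_family_on_def)
  also have "\<dots> = (\<Sum>k\<in>J. pos k * neg (n - k))"
    using assms by (intro sum.cong) (auto simp: prob_first_argmax)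
  finally show ?thesis .
qed

lemma pos_neg_convolution: "(\<Sum>k\<le>n. pos k * neg (n - k)) = 1"
proof -
  have "(\<Sum>k\<le>n. pos k * neg (n - k)) = \<P>(\<omega> in M. first_argmax (path \<omega>) n \<in> {..n})"
    by (rule prob_first_argmax_in[symmetric]) simp
  also have "\<dots> = 1" by (simp add: first_argmax_le prob_space)
  finally show ?thesis .
qed

lemma argmax_integrable:
  assumes "f \<in> measurable M (Pi\<^sub>M UNIV (\<lambda>_. borel))" "Measurable.pred M Q"
  shows "integrable M (\<lambda>\<omega>. if Q \<omega> then real (first_argmax (f \<omega>) n) else 0)"
proof (rule integrable_const_bound[of _ "real n"])
  show "(\<lambda>\<omega>. if Q \<omega> then real (first_argmax (f \<omega>) n) else 0) \<in> borel_measurable M"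
    using assms by measurable
qed (auto simp: first_argmax_le)

text \<open>Sparre Andersen's recursion: if \<open>S\<^bsub>n+1\<^esub> \<le> 0\<close> the last step does not move the first maximum,
  and if \<open>S\<^bsub>n+1\<^esub> > 0\<close> the maximum is that of the walk without its first step, shifted by one;
  a cyclic shift of the steps, which leaves \<open>S\<^bsub>n+1\<^esub>\<close> unchanged, identifies the two.\<close>

lemma expectation_argmax_Suc:
  "expectation (\<lambda>\<omega>. real (first_argmax (path \<omega>) (Suc n)))
    = expectation (\<lambda>\<omega>. real (first_argmax (path \<omega>) n)) + p (Suc n)"
proof -
  define \<pi> where "\<pi> i = (if i < n then Suc i else if i = n then 0 else i)" for i
  have inj: "inj \<pi>" unfolding inj_def \<pi>_def by (auto split: if_splits)
  let ?Q = "\<lambda>x. 0 < partial_sum x (Suc n)"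
  define f where "f x = (if ?Q x then real (first_argmax x n) else 0)" for x
  have f[measurable]: "f \<in> borel_measurable (Pi\<^sub>M UNIV (\<lambda>_. borel))" unfolding f_def by measurable
  have cyc: "f (\<lambda>i. x (\<pi> i)) = (if ?Q x then real (first_argmax (\<lambda>i. x (Suc i)) n) else 0)" for x :: "nat \<Rightarrow> real"
  proof -
    have "partial_sum (\<lambda>i. x (\<pi> i)) n = partial_sum (\<lambda>i. x (Suc i)) n"
      by (rule partial_sum_cong) (simp add: \<pi>_def)
    then have "partial_sum (\<lambda>i. x (\<pi> i)) (Suc n) = partial_sum x (Suc n)"
      by (simp add: partial_sum_Suc_shift[of x]) (simp add: partial_sum_def \<pi>_def)
    moreover have "first_argmax (\<lambda>i. x (\<pi> i)) n = first_argmax (\<lambda>i. x (Suc i)) n"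
      by (rule first_argmax_cong) (simp add: \<pi>_def)
    ultimately show ?thesis by (simp add: f_def)
  qed
  have shift: "(\<lambda>\<omega> i. \<xi> (Suc i) \<omega>) \<in> measurable M (Pi\<^sub>M UNIV (\<lambda>_. borel))"
    by (rule measurable_PiM_single') auto
  have Q: "Measurable.pred M (\<lambda>\<omega>. ?Q (path \<omega>))" by measurable
  have I1: "integrable M (\<lambda>\<omega>. if \<not> ?Q (path \<omega>) then real (first_argmax (path \<omega>) n) else 0)"
    by (rule argmax_integrable[OF path_measurable pred_intros_logic(2)[OF Q]])
  have I2: "integrable M (\<lambda>\<omega>. if ?Q (path \<omega>) then real (first_argmax (\<lambda>i. \<xi> (Suc i) \<omega>) n) else 0)"
    by (rule argmax_integrable[OF shift Q])
  have I3: "integrable M (\<lambda>\<omega>. f (path \<omega>))"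
    unfolding f_def by (rule argmax_integrable[OF path_measurable Q])
  have I4: "integrable M (indicator {\<omega> \<in> space M. ?Q (path \<omega>)} :: 'a \<Rightarrow> real)"
    by (intro integrable_real_indicator) (auto simp: emeasure_eq_measure)
  let ?E = "expectation (\<lambda>\<omega>. if \<not> ?Q (path \<omega>) then real (first_argmax (path \<omega>) n) else 0)"
  have "expectation (\<lambda>\<omega>. real (first_argmax (path \<omega>) (Suc n))) =
    expectation (\<lambda>\<omega>. (if \<not> ?Q (path \<omega>) then real (first_argmax (path \<omega>) n) else 0)
      + (indicator {\<omega> \<in> space M. ?Q (path \<omega>)} \<omega> + (if ?Q (path \<omega>) then real (first_argmax (\<lambda>i. \<xi> (Suc i) \<omega>) n) else 0)))"
    by (intro Bochner_Integration.integral_cong) (auto simp: first_argmax_Suc_nonpos first_argmax_Suc_pos)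
  then have 1: "expectation (\<lambda>\<omega>. real (first_argmax (path \<omega>) (Suc n)))
      = ?E + (p (Suc n) + expectation (\<lambda>\<omega>. f (\<lambda>i. \<xi> (\<pi> i) \<omega>)))"
    using I1 I2 I4 by (simp add: cyc[of "path _"] p_def)
  have 2: "expectation (\<lambda>\<omega>. f (\<lambda>i. \<xi> (\<pi> i) \<omega>)) = expectation (\<lambda>\<omega>. f (path \<omega>))"
    by (rule expectation_reindex[OF inj f])
  have "?E + expectation (\<lambda>\<omega>. f (path \<omega>))
      = expectation (\<lambda>\<omega>. (if \<not> ?Q (path \<omega>) then real (first_argmax (path \<omega>) n) else 0) + f (path \<omega>))"
    using I1 I3 by simp
  also have "\<dots> = expectation (\<lambda>\<omega>. real (first_argmax (path \<omega>) n))"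
    by (intro Bochner_Integration.integral_cong) (auto simp: f_def)
  finally have 3: "?E + expectation (\<lambda>\<omega>. f (path \<omega>)) = expectation (\<lambda>\<omega>. real (first_argmax (path \<omega>) n))" .
  show ?thesis using 1 2 3 by linarith
qed

lemma expectation_argmax:
  "expectation (\<lambda>\<omega>. real (first_argmax (path \<omega>) n)) = (\<Sum>k=1..n. p k)"
proof (induction n)
  case 0
  have "first_argmax x 0 = 0" for x using first_argmax_le[of x 0] by simp
  then have "(\<lambda>\<omega>. real (first_argmax (path \<omega>) 0)) = (\<lambda>_. 0)" by (intro ext) simp
  then show ?case by (simp only: Bochner_Integration.integral_zero) simp
next
  case (Suc n)
  then show ?case by (simp only: expectation_argmax_Suc) simp
qed

text \<open>The mean position of the first maximum evaluated in two ways, by its law and by Sparre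
  Andersen's recursion. This is the hypothesis \<open>mean\<close> of
  \<open>convolution_recurrence\<close>.\<close>

lemma pos_neg_mean: "(\<Sum>k\<le>n. real k * pos k * neg (n - k)) = (\<Sum>k=1..n. p k)"
proof -
  have "expectation (\<lambda>\<omega>. real (first_argmax (path \<omega>) n))
    = expectation (\<lambda>\<omega>. \<Sum>k\<le>n. real k * indicator {\<omega> \<in> space M. first_argmax (path \<omega>) n = k} \<omega>)"
  proof (intro Bochner_Integration.integral_cong refl)
    fix \<omega> assume "\<omega> \<in> space M"
    then have "(\<Sum>k\<le>n. real k * indicator {\<omega> \<in> space M. first_argmax (path \<omega>) n = k} \<omega>)
      = (\<Sum>k\<le>n. if k = first_argmax (path \<omega>) n then real k else 0)"
      by (intro sum.cong) auto
    then show "real (first_argmax (path \<omega>) n) = (\<Sum>k\<le>n. real k * indicator {\<omega> \<in> space M. first_argmax (path \<omega>) n = k} \<omega>)"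
      by (simp add: first_argmax_le)
  qed
  also have "\<dots> = (\<Sum>k\<le>n. real k * \<P>(\<omega> in M. first_argmax (path \<omega>) n = k))"
    by (subst Bochner_Integration.integral_sum) (auto intro!: integrable_real_indicator simp: emeasure_eq_measure)
  also have "\<dots> = (\<Sum>k\<le>n. real k * pos k * neg (n - k))"
    by (intro sum.cong) (auto simp: prob_first_argmax)
  finally show ?thesis by (simp only: expectation_argmax)
qed

lemma pos_rec: "real n * pos n = (\<Sum>k=1..n. p k * pos (n - k))"
  by (rule convolution_recurrence[OF pos_neg_convolution pos_neg_mean])

text \<open>Exchanging the two sequences replaces the position L of the maximum by m - L, whose mean
  is the sum of 1 - p_k.\<close>

lemma neg_rec: "real n * neg n = (\<Sum>k=1..n. (1 - p k) * neg (n - k))"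
proof (rule convolution_recurrence)
  fix m
  have flip: "(\<Sum>k\<le>m. f k) = (\<Sum>k\<le>m. f (m - k))" for f :: "nat \<Rightarrow> real"
    by (rule sum.reindex_bij_witness[of _ "\<lambda>k. m - k" "\<lambda>k. m - k"]) auto
  show "(\<Sum>k\<le>m. neg k * pos (m - k)) = 1"
    unfolding flip[of "\<lambda>k. neg k * pos (m - k)"] pos_neg_convolution[of m, symmetric]
    by (intro sum.cong) auto
  have "(\<Sum>k\<le>m. real k * neg k * pos (m - k)) = (\<Sum>k\<le>m. (real m - real k) * pos k * neg (m - k))"
    unfolding flip[of "\<lambda>k. real k * neg k * pos (m - k)"] by (intro sum.cong) (auto simp: of_nat_diff)
  also have "\<dots> = real m * (\<Sum>k\<le>m. pos k * neg (m - k)) - (\<Sum>k\<le>m. real k * pos k * neg (m - k))"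
    by (simp add: left_diff_distrib sum_subtractf sum_distrib_left mult.assoc)
  also have "\<dots> = (\<Sum>k=1..m. 1 - p k)"
    unfolding pos_neg_convolution pos_neg_mean by (simp only: sum_subtractf) simp
  finally show "(\<Sum>k\<le>m. real k * neg k * pos (m - k)) = (\<Sum>k=1..m. 1 - p k)" .
qed

lemma pos_neg_nonneg: "0 \<le> pos n" "0 \<le> neg n"
  by (simp_all add: pos_def neg_def)

lemma pos_antimono: "antimono pos"
  unfolding antimono_def pos_def by (intro allI impI finite_measure_mono) auto

lemma neg_antimono: "antimono neg"
  unfolding antimono_def neg_def by (intro allI impI finite_measure_mono) auto

lemma p01: "0 \<le> p n \<and> p n \<le> 1"
  by (simp add: p_def)

end

section \<open>The supremum time of a cadlag path\<close>

text \<open>A finite subcover makes local constants uniform. The single parameter d must get weaker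
  as it shrinks, so applications encode bounds, gaps and thresholds alike as one small
  number.\<close>

lemma compact_uniform_positive:
  fixes K :: "real set" and P :: "real \<Rightarrow> real \<Rightarrow> bool"
  assumes "compact K"
    and loc: "\<And>l. l \<in> K \<Longrightarrow> \<exists>d>0. \<forall>\<^sub>F y in nhds l. y \<in> K \<longrightarrow> P d y"
    and mono: "\<And>d d' y. y \<in> K \<Longrightarrow> 0 < d' \<Longrightarrow> d' \<le> d \<Longrightarrow> P d y \<Longrightarrow> P d' y"
  shows "\<exists>d>0. \<forall>y\<in>K. P d y"
proof -
  have "\<forall>l\<in>K. \<exists>U d. open U \<and> l \<in> U \<and> 0 < d \<and> (\<forall>y\<in>U. y \<in> K \<longrightarrow> P d y)"
    using loc unfolding eventually_nhds by blast
  then obtain U d where U: "\<And>l. l \<in> K \<Longrightarrow> open (U l)" "\<And>l. l \<in> K \<Longrightarrow> l \<in> U l"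
    and d: "\<And>l. l \<in> K \<Longrightarrow> 0 < (d l :: real)" "\<And>l y. l \<in> K \<Longrightarrow> y \<in> U l \<Longrightarrow> y \<in> K \<Longrightarrow> P (d l) y"
    unfolding bchoice_iff by blast
  have cover: "K \<subseteq> (\<Union>l\<in>K. U l)" using U(2) by blast
  obtain C where C: "C \<subseteq> K" "finite C" "K \<subseteq> (\<Union>l\<in>C. U l)"
    by (rule compactE_image[OF \<open>compact K\<close> U(1) cover])
  \<comment> \<open>The element 1 keeps the minimum meaningful when the cover is empty.\<close>
  define d0 where "d0 = Min (insert 1 (d ` C))"
  have d0: "0 < d0" "\<And>l. l \<in> C \<Longrightarrow> d0 \<le> d l"
    using C d(1) by (auto simp: d0_def)
  have "P d0 y" if y: "y \<in> K" for y
  proof -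
    obtain l where l: "l \<in> C" "y \<in> U l" using C(3) y by blast
    then have "P (d l) y" using d(2) C(1) y by blast
    then show ?thesis using mono[OF y] d0 l(1) by blast
  qed
  then show ?thesis using d0(1) by blast
qed

lemma left_lim_tendsto:
  assumes "cadlag f" "0 < t"
  shows "(f \<longlongrightarrow> left_lim f t) (at_left t)"
proof -
  obtain l where l: "(f \<longlongrightarrow> l) (at_left t)" using assms unfolding cadlag_def by blast
  then have "Lim (at_left t) f = l" by (intro tendsto_Lim) auto
  then show ?thesis using l assms by (simp add: left_lim_def)
qed

lemma cadlag_right: "cadlag f \<Longrightarrow> 0 \<le> t \<Longrightarrow> (f \<longlongrightarrow> f t) (at_right t)"
  by (simp add: cadlag_def)

text \<open>A cadlag function need not be upper semicontinuous, but f(l) governs the right side of l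
  and f(l-) the left. At l = 0 the condition 0 \<le> y discards the left side.\<close>

lemma cadlag_eventually_less:
  assumes f: "cadlag f" and l: "0 \<le> l" and less: "f l < m" "left_lim f l < m"
  shows "\<forall>\<^sub>F y in nhds l. 0 \<le> y \<longrightarrow> f y < m"
proof -
  have "\<forall>\<^sub>F y in at_right l. f y < m"
    using order_tendstoD(2)[OF cadlag_right[OF f l] less(1)] .
  then have r: "\<forall>\<^sub>F y in at_right l. 0 \<le> y \<longrightarrow> f y < m" by eventually_elim simp
  have "\<forall>\<^sub>F y in at_left l. 0 \<le> y \<longrightarrow> f y < m"
  proof (cases "l = 0")
    case True
    have "\<forall>\<^sub>F y in at_left (0::real). y < 0" by (simp add: eventually_at_filter)
    then show ?thesis unfolding True by eventually_elim simp
  next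
    case False
    then have "\<forall>\<^sub>F y in at_left l. f y < m"
      using order_tendstoD(2)[OF left_lim_tendsto[OF f] less(2)] l by simp
    then show ?thesis by eventually_elim simp
  qed
  with r show ?thesis
    using less(1) by (simp add: eventually_nhds_conv_at eventually_at_split)
qed

lemma left_lim_le:
  assumes f: "cadlag f" and "0 \<le> y" and le: "\<And>s. 0 \<le> s \<Longrightarrow> s \<le> y \<Longrightarrow> f s \<le> m"
  shows "left_lim f y \<le> m"
proof (cases "y = 0")
  case True
  then show ?thesis using le[of 0] by (simp add: left_lim_def)
next
  case False
  then have y: "0 < y" using assms by simp
  have "\<forall>\<^sub>F s in at_left y. s \<in> {0<..<y}" by (rule eventually_at_left_real[OF y])
  then have "\<forall>\<^sub>F s in at_left y. f s \<le> m" by eventually_elim (use le in auto)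
  then show ?thesis using left_lim_tendsto[OF f y] by (intro tendsto_upperbound) auto
qed

lemma cadlag_bdd_above:
  assumes f: "cadlag f"
  shows "bdd_above (f ` {0..1})"
proof -
  \<comment> \<open>The bound is written as 1/d so that a smaller d gives a weaker claim, as the
    compactness lemma requires.\<close>
  have "\<exists>d>0. \<forall>y\<in>{0..1}. f y \<le> 1 / d"
  proof (rule compact_uniform_positive)
    fix l :: real assume l: "l \<in> {0..1}"
    define m where "m = max 1 (max (f l) (left_lim f l) + 1)"
    have "\<forall>\<^sub>F y in nhds l. 0 \<le> y \<longrightarrow> f y < m"
      using l by (intro cadlag_eventually_less f) (auto simp: m_def)
    then have "\<forall>\<^sub>F y in nhds l. y \<in> {0..1} \<longrightarrow> f y \<le> 1 / (1 / m)"
      by eventually_elim auto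
    moreover have "0 < 1 / m" by (simp add: m_def)
    ultimately show "\<exists>d>0. \<forall>\<^sub>F y in nhds l. y \<in> {0..1} \<longrightarrow> f y \<le> 1 / d" by blast
  next
    fix d d' y :: real assume "0 < d'" "d' \<le> d" "f y \<le> 1 / d"
    then show "f y \<le> 1 / d'" using frac_le[of 1 1 d' d] by linarith
  qed simp
  then obtain d where "\<forall>y\<in>{0..1}. f y \<le> 1 / d" by blast
  then show ?thesis by (intro bdd_aboveI2[of _ _ "1 / d"]) blast
qed

lemma le_sup_value: "cadlag f \<Longrightarrow> t \<in> {0..1} \<Longrightarrow> f t \<le> sup_value f"
  unfolding sup_value_def by (intro cSUP_upper cadlag_bdd_above)

lemma less_sup_value:
  assumes "cadlag f" "m < sup_value f"
  obtains t where "0 \<le> t" "t \<le> 1" "m < f t"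
  using assms less_cSUP_iff[of "{0..1::real}" f m] cadlag_bdd_above[of f]
  unfolding sup_value_def by auto

text \<open>If the supremum is attained nowhere on [0, x], not even as a left limit, then by
  compactness f stays below it by a fixed d there, against \<open>near\<close>. With x = 1 this
  gives existence of a maximiser; smaller x locates one.\<close>

lemma sup_attained:
  assumes f: "cadlag f" and x: "x \<le> 1"
    and near: "\<And>t r. 0 \<le> t \<Longrightarrow> t \<le> 1 \<Longrightarrow> 0 < r \<Longrightarrow> \<exists>s. 0 \<le> s \<and> s \<le> x \<and> f t < f s + r"
  shows "\<exists>l. 0 \<le> l \<and> l \<le> x \<and> max (f l) (left_lim f l) = sup_value f"
proof (rule ccontr)
  assume contr: "\<not> ?thesis"
  have "\<exists>d>0. \<forall>y\<in>{0..x}. f y \<le> sup_value f - d"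
  proof (rule compact_uniform_positive)
    fix l :: real assume l: "l \<in> {0..x}"
    have "f l \<le> sup_value f" "left_lim f l \<le> sup_value f"
      using l x by (auto intro!: le_sup_value left_lim_le f)
    moreover have "max (f l) (left_lim f l) \<noteq> sup_value f" using contr l by auto
    ultimately have less: "max (f l) (left_lim f l) < sup_value f" by linarith
    define d where "d = (sup_value f - max (f l) (left_lim f l)) / 2"
    have d: "0 < d" using less by (simp add: d_def)
    have "f l < sup_value f - d" "left_lim f l < sup_value f - d"
      using less by (auto simp: d_def field_simps)
    then have "\<forall>\<^sub>F y in nhds l. 0 \<le> y \<longrightarrow> f y < sup_value f - d"
      using l by (intro cadlag_eventually_less f) auto
    then have "\<forall>\<^sub>F y in nhds l. y \<in> {0..x} \<longrightarrow> f y \<le> sup_value f - d"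
      by eventually_elim auto
    then show "\<exists>d>0. \<forall>\<^sub>F y in nhds l. y \<in> {0..x} \<longrightarrow> f y \<le> sup_value f - d"
      using d by blast
  qed auto
  then obtain d where d: "d > 0" "\<forall>y\<in>{0..x}. f y \<le> sup_value f - d" by blast
  obtain t where t: "0 \<le> t" "t \<le> 1" "sup_value f - d / 2 < f t"
    by (rule less_sup_value[OF f, of "sup_value f - d / 2"]) (use d in auto)
  obtain s where "0 \<le> s" "s \<le> x" "f t < f s + d / 2" using near[OF t(1,2), of "d/2"] d by auto
  then show False using d(2) t(3) by force
qed

text \<open>The set behind \<open>sup_time\<close> ranges over all t \<ge> 0, so times after 1 may
  belong to it; a member in [0, 1] guarantees that the infimum is at most 1.\<close>

lemma sup_time_set:
  assumes f: "cadlag f"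
  shows "bdd_below {t. 0 \<le> t \<and> max (f t) (left_lim f t) = sup_value f}"
    and "\<exists>l. 0 \<le> l \<and> l \<le> 1 \<and> max (f l) (left_lim f l) = sup_value f"
proof -
  show "bdd_below {t. 0 \<le> t \<and> max (f t) (left_lim f t) = sup_value f}"
    by (intro bdd_belowI[of _ 0]) auto
  show "\<exists>l. 0 \<le> l \<and> l \<le> 1 \<and> max (f l) (left_lim f l) = sup_value f"
    by (rule sup_attained[OF f]) (auto intro: exI)
qed

lemma sup_time_nonneg:
  assumes f: "cadlag f"
  shows "0 \<le> sup_time f"
  unfolding sup_time_def using sup_time_set(2)[OF f] by (intro cInf_greatest) auto

text \<open>This trades the infimum and the left limits for values of f alone. If [0, x] stays r
  below some value f t, right-continuity extends the gap r/2 to some u > x, and no maximiser lies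
  before u.\<close>

lemma sup_time_le_iff:
  assumes f: "cadlag f" and x: "0 \<le> x" "x < 1"
  shows "sup_time f \<le> x \<longleftrightarrow> (\<forall>t r. 0 \<le> t \<longrightarrow> t \<le> 1 \<longrightarrow> 0 < r \<longrightarrow> (\<exists>s. 0 \<le> s \<and> s \<le> x \<and> f t < f s + r))"
proof
  assume "\<forall>t r. 0 \<le> t \<longrightarrow> t \<le> 1 \<longrightarrow> 0 < r \<longrightarrow> (\<exists>s. 0 \<le> s \<and> s \<le> x \<and> f t < f s + r)"
  then obtain l where l: "0 \<le> l" "l \<le> x" "max (f l) (left_lim f l) = sup_value f"
    using sup_attained[OF f less_imp_le[OF x(2)]] by blast
  then have "sup_time f \<le> l"
    unfolding sup_time_def using sup_time_set(1)[OF f] by (intro cInf_lower) auto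
  then show "sup_time f \<le> x" using l by simp
next
  assume le: "sup_time f \<le> x"
  show "\<forall>t r. 0 \<le> t \<longrightarrow> t \<le> 1 \<longrightarrow> 0 < r \<longrightarrow> (\<exists>s. 0 \<le> s \<and> s \<le> x \<and> f t < f s + r)"
  proof (rule ccontr)
    assume "\<not> ?thesis"
    then obtain t r where tr: "0 \<le> t" "t \<le> 1" "0 < r" "\<And>s. 0 \<le> s \<Longrightarrow> s \<le> x \<Longrightarrow> f s \<le> f t - r"
      by (auto simp: not_less algebra_simps)
    have "f t \<le> sup_value f" using le_sup_value[OF f] tr by auto
    then have below: "f s \<le> sup_value f - r" if "0 \<le> s" "s \<le> x" for s
      using tr(4)[OF that] by simp
    have "\<forall>\<^sub>F y in at_right x. f y < sup_value f - r / 2"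
      using below[of x] x tr(3) by (intro order_tendstoD(2)[OF cadlag_right[OF f x(1)]]) auto
    then obtain u where u: "x < u" "\<And>y. x < y \<Longrightarrow> y < u \<Longrightarrow> f y < sup_value f - r / 2"
      unfolding eventually_at_right_field by blast
    have low: "f y \<le> sup_value f - r / 2" if "0 \<le> y" "y < u" for y
      using below[of y] u(2)[of y] that tr(3) by (cases "y \<le> x") auto
    have "u \<le> l" if l: "0 \<le> l" "max (f l) (left_lim f l) = sup_value f" for l
    proof (rule ccontr)
      assume "\<not> u \<le> l"
      then have "f l \<le> sup_value f - r / 2" "left_lim f l \<le> sup_value f - r / 2"
        using l(1) by (auto intro!: low left_lim_le f)
      then show False using l(2) tr(3) by simp
    qed
    then have "u \<le> sup_time f"
      unfolding sup_time_def using sup_time_set(2)[OF f] by (intro cInf_greatest) auto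
    then show False using le u(1) by simp
  qed
qed

section \<open>Discretisation of a path on dyadic grids\<close>

text \<open>These are the increments of f t - \<delta>t. Dyadic meshes are nested, so a grid point
  belongs to every finer grid.\<close>

definition grid_steps :: "real \<Rightarrow> nat \<Rightarrow> (real \<Rightarrow> real) \<Rightarrow> nat \<Rightarrow> real" where
  "grid_steps \<delta> e f i = f (real (Suc i) / 2 ^ e) - f (real i / 2 ^ e) - \<delta> / 2 ^ e"

lemma partial_sum_grid_steps:
  "partial_sum (grid_steps \<delta> e f) j = f (real j / 2 ^ e) - f 0 - \<delta> * (real j / 2 ^ e)"
  by (induction j) (simp_all add: partial_sum_def grid_steps_def add_divide_distrib distrib_left)

abbreviation grid_argmax :: "real \<Rightarrow> nat \<Rightarrow> (real \<Rightarrow> real) \<Rightarrow> nat" where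
  "grid_argmax \<delta> e f \<equiv> first_argmax (grid_steps \<delta> e f) (2 ^ e)"

lemma grid_argmax_ge:
  assumes "j \<le> 2 ^ e"
  shows "f (real j / 2 ^ e) - \<delta> * (real j / 2 ^ e)
    \<le> f (real (grid_argmax \<delta> e f) / 2 ^ e) - \<delta> * (real (grid_argmax \<delta> e f) / 2 ^ e)"
  using first_argmax_ge[OF assms, of "grid_steps \<delta> e f"] unfolding partial_sum_grid_steps by simp

lemma grid_point_right:
  assumes f: "cadlag f" and s: "0 \<le> s" "s < u" and c: "c < f s"
  obtains y where "s < y" "y < u" "c < f y" "\<forall>\<^sub>F e in sequentially. \<exists>j::nat. y = real j / 2 ^ e"
proof -
  have "\<forall>\<^sub>F y in at_right s. c < f y"
    by (rule order_tendstoD(1)[OF cadlag_right[OF f s(1)] c])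
  then obtain v where v: "s < v" "\<And>y. s < y \<Longrightarrow> y < v \<Longrightarrow> c < f y"
    unfolding eventually_at_right_field by blast
  define w where "w = min u v"
  have w: "s < w" "w \<le> u" "w \<le> v" using s v by (auto simp: w_def)
  obtain m where m: "(1/2) ^ m < w - s" using real_arch_pow_inv[of "w - s" "1/2"] w by auto
  then have m': "1 < (w - s) * 2 ^ m" by (simp add: power_divide field_simps)
  \<comment> \<open>k/2^m is the first mesh point strictly to the right of s; it precedes w because
    the mesh is finer than w - s.\<close>
  define k where "k = nat \<lfloor>s * 2 ^ m\<rfloor> + 1"
  have "real k = real_of_int \<lfloor>s * 2 ^ m\<rfloor> + 1" using s by (simp add: k_def)
  then have k: "s * 2 ^ m < real k" "real k \<le> s * 2 ^ m + 1" by linarith+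
  define y where "y = real k / 2 ^ m"
  have y: "s < y" "y < w"
    using k m' by (auto simp: y_def pos_less_divide_eq pos_divide_less_eq algebra_simps)
  have "y = real (k * 2 ^ (e - m)) / 2 ^ e" if me: "m \<le> e" for e
  proof -
    obtain i where "e = m + i" using me by (auto simp: le_iff_add)
    then show ?thesis by (simp add: y_def power_add)
  qed
  then have "\<forall>\<^sub>F e in sequentially. \<exists>j::nat. y = real j / 2 ^ e"
    unfolding eventually_sequentially by blast
  then show thesis using that[of y] y v(2)[of y] w by auto
qed

text \<open>Some grid point y below the midpoint of x and x' has a drifted value above sup f -
  \<delta>x'. Beyond x' no grid point reaches this level, since f is at most its supremum
  there.\<close>

lemma grid_argmax_eventually_le:
  assumes f: "cadlag f" and x: "0 \<le> x" "x < x'" "x' < 1" and \<delta>: "0 < \<delta>" and le: "sup_time f \<le> x"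
  shows "\<forall>\<^sub>F e in sequentially. real (grid_argmax \<delta> e f) \<le> x' * 2 ^ e"
proof -
  \<comment> \<open>Choosing t and then s loses r each time; the total \<delta>(x' - x)/2 is the
    drift between the midpoint and x'.\<close>
  define r where "r = \<delta> * (x' - x) / 4"
  have r: "0 < r" using \<delta> x by (simp add: r_def)
  obtain t where t: "0 \<le> t" "t \<le> 1" "sup_value f - r < f t"
    by (rule less_sup_value[OF f, of "sup_value f - r"]) (use r in auto)
  obtain s where s: "0 \<le> s" "s \<le> x" "f t < f s + r"
    using le t(1,2) r x unfolding sup_time_le_iff[OF f x(1) less_trans[OF x(2,3)]] by blast
  obtain y where y: "s < y" "y < (x + x') / 2" "sup_value f - 2 * r < f y"
      and grid: "\<forall>\<^sub>F e in sequentially. \<exists>j::nat. y = real j / 2 ^ e"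
    by (rule grid_point_right[OF f s(1), of "(x + x') / 2" "sup_value f - 2 * r"]) (use s t x in auto)
  have "\<delta> * y < \<delta> * ((x + x') / 2)" using y(2) \<delta> by (intro mult_strict_left_mono)
  then have key: "sup_value f - \<delta> * x' < f y - \<delta> * y"
    using y(3) unfolding r_def by (simp add: algebra_simps add_divide_distrib diff_divide_distrib)
  show ?thesis using grid
  proof eventually_elim
    case (elim e)
    then obtain j where j: "y = real j / 2 ^ e" by blast
    have "(x + x') / 2 < x'" using x by (simp add: field_simps)
    then have "y \<le> 1" using y(2) x(3) by linarith
    then have j': "j \<le> 2 ^ e" using j by (simp add: pos_divide_le_eq)
    define k where "k = grid_argmax \<delta> e f"
    have k: "k \<le> 2 ^ e" unfolding k_def by (rule first_argmax_le)
    show ?case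
    proof (rule ccontr)
      assume "\<not> ?thesis"
      then have kx: "x' < real k / 2 ^ e" by (simp add: k_def field_simps)
      have "real k \<le> 2 ^ e" using k by (metis of_nat_le_iff of_nat_numeral of_nat_power)
      then have "real k / 2 ^ e \<in> {0..1}" by simp
      then have "f (real k / 2 ^ e) \<le> sup_value f" by (rule le_sup_value[OF f])
      moreover have "\<delta> * x' \<le> \<delta> * (real k / 2 ^ e)" using kx \<delta> by (intro mult_left_mono) auto
      ultimately show False
        using grid_argmax_ge[OF j', of f \<delta>] key unfolding k_def[symmetric] j[symmetric] by linarith
    qed
  qed
qed

text \<open>On [0, x] the path stays r below some f t. A grid point with value above f t - r/2 then
  beats all of [0, x] provided that the total drift is at most r/2.\<close>

lemma grid_argmax_eventually_gt:
  assumes f: "cadlag f" and x: "0 \<le> x" "x < 1" and less: "x < sup_time f"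
  shows "\<exists>\<delta>0>0. \<forall>\<delta>. 0 < \<delta> \<longrightarrow> \<delta> \<le> \<delta>0 \<longrightarrow> (\<forall>\<^sub>F e in sequentially. x * 2 ^ e < real (grid_argmax \<delta> e f))"
proof -
  have "\<not> sup_time f \<le> x" using less by simp
  then obtain t r where tr: "0 \<le> t" "t \<le> 1" "0 < r" "\<And>s. 0 \<le> s \<Longrightarrow> s \<le> x \<Longrightarrow> f s \<le> f t - r"
    unfolding sup_time_le_iff[OF f x] by (auto simp: not_less algebra_simps)
  have "\<exists>y. 0 \<le> y \<and> y \<le> 1 \<and> f t - r / 2 < f y \<and> (\<forall>\<^sub>F e in sequentially. \<exists>j::nat. y = real j / 2 ^ e)"
  proof (cases "t < 1")
    case True
    obtain y where "t < y" "y < 1" "f t - r / 2 < f y" "\<forall>\<^sub>F e in sequentially. \<exists>j::nat. y = real j / 2 ^ e"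
      by (rule grid_point_right[OF f tr(1) True, of "f t - r / 2"]) (use tr in auto)
    then show ?thesis using tr(1) by (intro exI[of _ y]) simp
  next
    \<comment> \<open>For t = 1 points to the right would leave [0, 1], but 1 itself lies on every
      grid.\<close>
    case False
    have "(1::real) = real (2 ^ e) / 2 ^ e" for e by simp
    then have "\<forall>\<^sub>F e in sequentially. \<exists>j::nat. (1::real) = real j / 2 ^ e"
      by (intro always_eventually allI) blast
    moreover have "t = 1" using False tr by simp
    ultimately show ?thesis using tr(3) by (intro exI[of _ 1]) auto
  qed
  then obtain y where y: "0 \<le> y" "y \<le> 1" "f t - r / 2 < f y"
    and grid: "\<forall>\<^sub>F e in sequentially. \<exists>j::nat. y = real j / 2 ^ e" by blast
  show ?thesis
  proof (intro exI[of _ "r / 2"] conjI allI impI)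
    show "0 < r / 2" using tr by simp
    fix \<delta> assume \<delta>: "0 < \<delta>" "\<delta> \<le> r / 2"
    show "\<forall>\<^sub>F e in sequentially. x * 2 ^ e < real (grid_argmax \<delta> e f)"
      using grid
    proof eventually_elim
      case (elim e)
      then obtain j where j: "y = real j / 2 ^ e" by blast
      have j': "j \<le> 2 ^ e" using j y(2) by (simp add: pos_divide_le_eq)
      define k where "k = grid_argmax \<delta> e f"
      show ?case
      proof (rule ccontr)
        assume "\<not> ?thesis"
        then have kx: "real k / 2 ^ e \<le> x" by (simp add: k_def field_simps)
        then have "f (real k / 2 ^ e) \<le> f t - r" by (intro tr(4)) auto
        moreover have "0 \<le> \<delta> * (real k / 2 ^ e)" using \<delta> by simp
        moreover have "\<delta> * y \<le> r / 2" using mult_mono[OF \<delta>(2) y(2)] \<delta> y tr by simp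
        ultimately show False
          using grid_argmax_ge[OF j', of f \<delta>] y(3) unfolding k_def[symmetric] j[symmetric] by linarith
      qed
    qed
  qed
qed

text \<open>The right-hand side involves only countably many grid events; measurability of
  \<open>sup_time\<close> rests on this.\<close>

lemma sup_time_le_iff_grid:
  assumes f: "cadlag f" and x: "0 \<le> x" "x < 1"
  shows "sup_time f \<le> x \<longleftrightarrow> (\<forall>n m::nat. x + 1 / Suc n < 1 \<longrightarrow>
    (\<forall>\<^sub>F e in sequentially. real (grid_argmax (1 / Suc m) e f) \<le> (x + 1 / Suc n) * 2 ^ e))"
    (is "_ \<longleftrightarrow> ?R")
proof
  assume "sup_time f \<le> x"
  then show ?R using x by (intro allI impI grid_argmax_eventually_le[OF f x(1)]) auto
next
  assume R: ?R
  show "sup_time f \<le> x"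
  proof (rule ccontr)
    assume "\<not> sup_time f \<le> x"
    then have "0 < min 1 (sup_time f) - x" using x by simp
    then obtain n where n: "1 / real (Suc n) < min 1 (sup_time f) - x"
      using nat_approx_posE by metis
    define x' where "x' = x + 1 / real (Suc n)"
    have x': "0 \<le> x'" "x' < 1" "x' < sup_time f" using n x by (auto simp: x'_def)
    obtain \<delta>0 where \<delta>0: "0 < \<delta>0" and gt: "\<forall>\<delta>. 0 < \<delta> \<longrightarrow> \<delta> \<le> \<delta>0 \<longrightarrow> (\<forall>\<^sub>F e in sequentially. x' * 2 ^ e < real (grid_argmax \<delta> e f))"
      using grid_argmax_eventually_gt[OF f x'] by (elim exE conjE) (rule that)
    obtain m where m: "1 / real (Suc m) < \<delta>0" using nat_approx_posE[OF \<delta>0] by metis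
    have "\<forall>\<^sub>F e in sequentially. x' * 2 ^ e < real (grid_argmax (1 / Suc m) e f)"
      using gt m by simp
    moreover have "\<forall>\<^sub>F e in sequentially. real (grid_argmax (1 / Suc m) e f) \<le> x' * 2 ^ e"
      using R x'(2) unfolding x'_def by blast
    ultimately have "\<forall>\<^sub>F e in sequentially. False"
      by eventually_elim linarith
    then show False by simp
  qed
qed

section \<open>Levy processes\<close>

text \<open>P(E) \<le> liminf P(F_n) when E lies in the limit inferior of the F_n, by continuity
  from below along \<open>G\<close>.\<close>

lemma (in prob_space) prob_le_eventually:
  assumes [measurable]: "E \<in> events" "\<And>n::nat. F n \<in> events"
    and sub: "\<And>\<omega>. \<omega> \<in> E \<Longrightarrow> \<forall>\<^sub>F n in sequentially. \<omega> \<in> F n" and \<zeta>: "0 < \<zeta>"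
  shows "\<forall>\<^sub>F n in sequentially. prob E \<le> prob (F n) + \<zeta>"
proof -
  define G where "G n = E \<inter> (\<Inter>m\<in>{n..}. F m)" for n
  have G[measurable]: "G n \<in> events" for n unfolding G_def by measurable
  have "incseq G" unfolding G_def incseq_def by force
  then have "(\<lambda>n. prob (G n)) \<longlonglongrightarrow> prob (\<Union>n. G n)"
    by (intro finite_Lim_measure_incseq) auto
  also have "(\<Union>n. G n) = E"
    using sub unfolding G_def eventually_sequentially by fastforce
  finally have "\<forall>\<^sub>F n in sequentially. prob E - \<zeta> < prob (G n)"
    using \<zeta> by (intro order_tendstoD(1)) auto
  then show ?thesis
  proof eventually_elim
    case (elim n)
    have "prob (G n) \<le> prob (F n)" by (intro finite_measure_mono) (auto simp: G_def)
    then show ?case using elim by linarith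
  qed
qed

text \<open>Chebyshev's inequality for the number of events that occur: its variance is |J|(q -
  q^2), and on B it equals 0, at distance |J|q from its mean.\<close>

lemma (in prob_space) pairwise_independent_none:
  assumes J: "finite J" and Z[measurable]: "\<And>j. j \<in> J \<Longrightarrow> Z j \<in> events"
    and p: "\<And>j. j \<in> J \<Longrightarrow> prob (Z j) = q"
    and pair: "\<And>j k. j \<in> J \<Longrightarrow> k \<in> J \<Longrightarrow> j \<noteq> k \<Longrightarrow> prob (Z j \<inter> Z k) = q * q"
    and B: "B \<in> events" "\<And>\<omega> j. \<omega> \<in> B \<Longrightarrow> j \<in> J \<Longrightarrow> \<omega> \<notin> Z j"
  shows "(real (card J) * q)\<^sup>2 * prob B \<le> real (card J) * (q - q * q)"
proof -
  define V where "V \<omega> = (\<Sum>j\<in>J. (indicator (Z j) \<omega> - q :: real))" for \<omega>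
  have prod: "(indicator (Z j) \<omega> - q) * (indicator (Z k) \<omega> - q)
      = indicator (Z j \<inter> Z k) \<omega> - q * indicator (Z j) \<omega> - q * indicator (Z k) \<omega> + (q * q :: real)" for j k \<omega>
    by (simp add: indicator_inter_arith algebra_simps)
  have int: "integrable M (indicator A :: 'a \<Rightarrow> real)" if "A \<in> events" for A
    using that by (intro integrable_real_indicator) (auto simp: emeasure_eq_measure)
  have int2: "integrable M (\<lambda>\<omega>. (indicator (Z j) \<omega> - q) * (indicator (Z k) \<omega> - q))"
    and exp2: "expectation (\<lambda>\<omega>. (indicator (Z j) \<omega> - q) * (indicator (Z k) \<omega> - q)) = (if j = k then q - q * q else 0)"
    if jk: "j \<in> J" "k \<in> J" for j k
  proof -
    note i = int[OF Z[OF jk(1)]] int[OF Z[OF jk(2)]] int[OF sets.Int[OF Z[OF jk(1)] Z[OF jk(2)]]]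
    show "integrable M (\<lambda>\<omega>. (indicator (Z j) \<omega> - q) * (indicator (Z k) \<omega> - q))"
      unfolding prod using i by auto
    have "expectation (\<lambda>\<omega>. (indicator (Z j) \<omega> - q) * (indicator (Z k) \<omega> - q))
      = prob (Z j \<inter> Z k) - q * prob (Z j) - q * prob (Z k) + q * q"
      unfolding prod using i jk by (simp add: prob_space)
    then show "expectation (\<lambda>\<omega>. (indicator (Z j) \<omega> - q) * (indicator (Z k) \<omega> - q)) = (if j = k then q - q * q else 0)"
      using p[OF jk(1)] p[OF jk(2)] pair[OF jk] by auto
  qed
  have sq: "(V \<omega>)\<^sup>2 = (\<Sum>j\<in>J. \<Sum>k\<in>J. (indicator (Z j) \<omega> - q) * (indicator (Z k) \<omega> - q))" for \<omega>
    by (simp add: V_def power2_eq_square sum_product)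
  have "expectation (\<lambda>\<omega>. (V \<omega>)\<^sup>2) = (\<Sum>j\<in>J. \<Sum>k\<in>J. if j = k then q - q * q else 0)"
    unfolding sq by (subst Bochner_Integration.integral_sum)
      (auto intro!: sum.cong Bochner_Integration.integrable_sum int2 simp: Bochner_Integration.integral_sum int2 exp2)
  also have "\<dots> = real (card J) * (q - q * q)" using J by simp
  finally have EV: "expectation (\<lambda>\<omega>. (V \<omega>)\<^sup>2) = real (card J) * (q - q * q)" .
  have "(real (card J) * q)\<^sup>2 * prob B = expectation (\<lambda>\<omega>. (real (card J) * q)\<^sup>2 * indicator B \<omega>)"
    using B(1) by simp
  also have "\<dots> \<le> expectation (\<lambda>\<omega>. (V \<omega>)\<^sup>2)"
  proof (rule integral_mono)
    show "integrable M (\<lambda>\<omega>. (real (card J) * q)\<^sup>2 * indicator B \<omega>)" using int[OF B(1)] by simp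
    show "integrable M (\<lambda>\<omega>. (V \<omega>)\<^sup>2)"
      unfolding sq by (intro Bochner_Integration.integrable_sum int2)
    fix \<omega>
    show "(real (card J) * q)\<^sup>2 * indicator B \<omega> \<le> (V \<omega>)\<^sup>2"
    proof (cases "\<omega> \<in> B")
      case True
      then have "V \<omega> = (\<Sum>j\<in>J. - q)" unfolding V_def using B(2) by (intro sum.cong) auto
      then show ?thesis using True by simp
    qed simp
  qed
  finally show ?thesis using EV by simp
qed

section \<open>Increments and marginal laws of a Levy process\<close>

context levy_process
begin

lemma rv_X [measurable (raw)]: "0 \<le> t \<Longrightarrow> X t \<in> borel_measurable M"
  using random_variable_X .

lemma prob_increment:
  assumes st: "0 \<le> s" "s \<le> t" and A: "A \<in> sets borel"
  shows "\<P>(\<omega> in M. X t \<omega> - X s \<omega> \<in> A) = \<P>(\<omega> in M. X (t - s) \<omega> \<in> A)"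
proof -
  have "distr M borel (\<lambda>\<omega>. X t \<omega> - X s \<omega>) = distr M borel (X (t - s))"
    using stationary_increments[of s "t - s"] st by simp
  then have "measure (distr M borel (\<lambda>\<omega>. X t \<omega> - X s \<omega>)) A = measure (distr M borel (X (t - s))) A"
    by simp
  moreover have "(\<lambda>\<omega>. X t \<omega> - X s \<omega>) \<in> borel_measurable M" "X (t - s) \<in> borel_measurable M"
    using st by (auto intro!: borel_measurable_diff rv_X)
  ultimately show ?thesis
    using A by (simp add: measure_distr vimage_def Int_def conj_commute)
qed

lemma indep_grid_increments:
  assumes "0 \<le> h"
  shows "indep_vars (\<lambda>_. borel) (\<lambda>i \<omega>. X (real (Suc i) * h) \<omega> - X (real i * h) \<omega>) UNIV"
proof -
  have fin: "indep_vars (\<lambda>_. borel) (\<lambda>i \<omega>. X (real (Suc i) * h) \<omega> - X (real i * h) \<omega>) {..<n}" for n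
    using indep_increments[of "\<lambda>i. real i * h" n] assms by (simp add: mult_right_mono)
  show ?thesis
    unfolding indep_vars_def2
  proof (intro conjI ballI)
    show "random_variable borel (\<lambda>\<omega>. X (real (Suc i) * h) \<omega> - X (real i * h) \<omega>)" for i
      using assms by (intro borel_measurable_diff rv_X) auto
    show "indep_sets (\<lambda>i. {(\<lambda>\<omega>. X (real (Suc i) * h) \<omega> - X (real i * h) \<omega>) -` A \<inter> space M |A. A \<in> sets borel}) UNIV"
    proof (subst indep_sets_finite_index_sets, intro allI impI)
      fix J :: "nat set" assume J: "J \<subseteq> UNIV" "J \<noteq> {}" "finite J"
      then have "J \<subseteq> {..<Suc (Max J)}" by (auto simp: less_Suc_eq_le)
      with fin[of "Suc (Max J)"] have "indep_vars (\<lambda>_. borel) (\<lambda>i \<omega>. X (real (Suc i) * h) \<omega> - X (real i * h) \<omega>) J"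
        by (rule indep_vars_subset)
      then show "indep_sets (\<lambda>i. {(\<lambda>\<omega>. X (real (Suc i) * h) \<omega> - X (real i * h) \<omega>) -` A \<inter> space M |A. A \<in> sets borel}) J"
        unfolding indep_vars_def2 by blast
    qed
  qed
qed

lemma grid_walk: "iid_walk M (\<lambda>i \<omega>. grid_steps \<delta> e (\<lambda>t. X t \<omega>) i)"
proof
  define h :: real where "h = 1 / 2 ^ e"
  have h: "0 \<le> h" "\<And>r :: real. r / 2 ^ e = r * h" by (auto simp: h_def)
  have steps: "(\<lambda>i \<omega>. grid_steps \<delta> e (\<lambda>t. X t \<omega>) i)
    = (\<lambda>i \<omega>. (X (real (Suc i) * h) \<omega> - X (real i * h) \<omega>) - \<delta> * h)"
    by (simp add: fun_eq_iff grid_steps_def h(2))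
  show "indep_vars (\<lambda>_. borel) (\<lambda>i \<omega>. grid_steps \<delta> e (\<lambda>t. X t \<omega>) i) UNIV"
    unfolding steps by (rule indep_vars_compose2[OF indep_grid_increments[OF h(1)]]) simp
  have "distr M borel (\<lambda>\<omega>. (X (real (Suc n) * h) \<omega> - X (real n * h) \<omega>) - \<delta> * h)
    = distr (distr M borel (X h)) borel (\<lambda>x. x - \<delta> * h)" for n
  proof -
    have meas: "(\<lambda>\<omega>. X (real (Suc n) * h) \<omega> - X (real n * h) \<omega>) \<in> borel_measurable M"
      using h by (intro borel_measurable_diff rv_X) auto
    have "distr M borel (\<lambda>\<omega>. (X (real (Suc n) * h) \<omega> - X (real n * h) \<omega>) - \<delta> * h)
      = distr (distr M borel (\<lambda>\<omega>. X (real (Suc n) * h) \<omega> - X (real n * h) \<omega>)) borel (\<lambda>x. x - \<delta> * h)"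
      by (subst distr_distr[OF _ meas]) (simp_all add: comp_def)
    moreover have "real (Suc n) * h = real n * h + h" by (simp add: distrib_right)
    ultimately show ?thesis using stationary_increments[of "real n * h" h] h(1) by (simp only: mult_nonneg_nonneg of_nat_0_le_iff)
  qed
  then show "distr M borel (\<lambda>\<omega>. grid_steps \<delta> e (\<lambda>t. X t \<omega>) n) = distr M borel (\<lambda>\<omega>. grid_steps \<delta> e (\<lambda>t. X t \<omega>) 0)" for n
    unfolding fun_cong[OF steps, of n] fun_cong[OF steps, of 0] by (simp only:)
qed

lemma prob_two_increments:
  assumes st: "0 \<le> s" "s \<le> t" and A: "A \<in> sets borel" and B: "B \<in> sets borel"
  shows "\<P>(\<omega> in M. X s \<omega> \<in> A \<and> X t \<omega> - X s \<omega> \<in> B)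
    = \<P>(\<omega> in M. X s \<omega> \<in> A) * \<P>(\<omega> in M. X (t - s) \<omega> \<in> B)"
proof -
  define u :: "nat \<Rightarrow> real" where "u i = (if i = 0 then 0 else if i = 1 then s else t)" for i
  have [measurable]: "X 0 \<in> borel_measurable M" "X s \<in> borel_measurable M" "X t \<in> borel_measurable M"
    using st by auto
  note [measurable] = A B
  have ind: "indep_vars (\<lambda>_. borel) (\<lambda>i \<omega>. X (u (Suc i)) \<omega> - X (u i) \<omega>) {..<2}"
    using st by (intro indep_increments) (auto simp: u_def)
  let ?C = "\<lambda>i::nat. if i = 0 then A else B"
  have "prob (\<Inter>i\<in>{..<2}. (\<lambda>\<omega>. X (u (Suc i)) \<omega> - X (u i) \<omega>) -` ?C i \<inter> space M)
    = (\<Prod>i<2. prob ((\<lambda>\<omega>. X (u (Suc i)) \<omega> - X (u i) \<omega>) -` ?C i \<inter> space M))"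
    by (rule indep_varsD_finite[OF ind]) (auto intro: A B simp: lessThan_empty_iff)
  moreover have two: "{..<2} = {0, 1::nat}" by auto
  ultimately have *: "\<P>(\<omega> in M. X s \<omega> - X 0 \<omega> \<in> A \<and> X t \<omega> - X s \<omega> \<in> B)
    = \<P>(\<omega> in M. X s \<omega> - X 0 \<omega> \<in> A) * \<P>(\<omega> in M. X t \<omega> - X s \<omega> \<in> B)"
    by (simp add: two u_def vimage_def Int_def conj_ac)
  have "\<P>(\<omega> in M. X s \<omega> \<in> A \<and> X t \<omega> - X s \<omega> \<in> B)
    = \<P>(\<omega> in M. X s \<omega> - X 0 \<omega> \<in> A \<and> X t \<omega> - X s \<omega> \<in> B)"
    using start_zero by (intro finite_measure_eq_AE) auto
  moreover have "\<P>(\<omega> in M. X s \<omega> \<in> A) = \<P>(\<omega> in M. X s \<omega> - X 0 \<omega> \<in> A)"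
    using start_zero by (intro finite_measure_eq_AE) auto
  ultimately show ?thesis using * prob_increment[OF st B] by simp
qed

lemma path_cadlag: "\<omega> \<in> space M \<Longrightarrow> cadlag (\<lambda>t. X t \<omega>)"
  using cadlag_paths .

lemma tendsto_in_probability_0:
  assumes r: "0 < r"
  shows "((\<lambda>t. \<P>(\<omega> in M. r < \<bar>X t \<omega>\<bar>)) \<longlongrightarrow> 0) (at_right 0)"
proof (rule tendsto_at_right_sequentially[where b = 1])
  fix S :: "nat \<Rightarrow> real" assume S: "\<And>n. 0 < S n" "S \<longlonglongrightarrow> 0"
  then have [measurable]: "X (S n) \<in> borel_measurable M" for n by (intro rv_X) (simp add: less_imp_le)
  have S': "filterlim S (at_right 0) sequentially"
    using S(2) by (simp add: filterlim_at S(1) less_imp_neq[OF S(1), symmetric])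
  have "(\<lambda>n. expectation (indicator {\<omega> \<in> space M. r < \<bar>X (S n) \<omega>\<bar>})) \<longlonglongrightarrow> expectation (\<lambda>_. 0 :: real)"
  proof (rule integral_dominated_convergence[where w = "\<lambda>_. 1"])
    show "AE \<omega> in M. (\<lambda>n. indicator {\<omega> \<in> space M. r < \<bar>X (S n) \<omega>\<bar>} \<omega> :: real) \<longlonglongrightarrow> 0"
      using start_zero
    proof (rule AE_mp, intro AE_I2 impI)
      fix \<omega> assume \<omega>: "\<omega> \<in> space M" "X 0 \<omega> = 0"
      have "((\<lambda>t. X t \<omega>) \<longlongrightarrow> X 0 \<omega>) (at_right 0)"
        using cadlag_right[OF path_cadlag[OF \<omega>(1)]] by simp
      then have "(\<lambda>n. X (S n) \<omega>) \<longlonglongrightarrow> X 0 \<omega>"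
        by (rule filterlim_compose[OF _ S'])
      then have "(\<lambda>n. X (S n) \<omega>) \<longlonglongrightarrow> 0" by (simp only: \<omega>(2))
      then have "(\<lambda>n. \<bar>X (S n) \<omega>\<bar>) \<longlonglongrightarrow> 0" by (rule tendsto_rabs_zero)
      from order_tendstoD(2)[OF this r]
      have "\<forall>\<^sub>F n in sequentially. indicator {\<omega> \<in> space M. r < \<bar>X (S n) \<omega>\<bar>} \<omega> = (0 :: real)"
        by eventually_elim auto
      then show "(\<lambda>n. indicator {\<omega> \<in> space M. r < \<bar>X (S n) \<omega>\<bar>} \<omega> :: real) \<longlonglongrightarrow> 0"
        by (rule tendsto_eventually)
    qed
  qed auto
  then show "(\<lambda>n. \<P>(\<omega> in M. r < \<bar>X (S n) \<omega>\<bar>)) \<longlonglongrightarrow> 0" by simp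
qed simp

text \<open>Right-continuity at 0 makes X_t small in probability as t -> 0; stationarity carries
  this to all increments, with d independent of s and t.\<close>

lemma continuous_in_probability:
  assumes r: "0 < r" and \<eta>: "0 < \<eta>"
  shows "\<exists>d>0. \<forall>s\<ge>0. \<forall>t\<ge>0. \<bar>t - s\<bar> < d \<longrightarrow> \<P>(\<omega> in M. r < \<bar>X t \<omega> - X s \<omega>\<bar>) < \<eta>"
proof -
  obtain d where d: "d > 0" "\<And>t. 0 < t \<Longrightarrow> t < d \<Longrightarrow> \<P>(\<omega> in M. r < \<bar>X t \<omega>\<bar>) < \<eta>"
    using order_tendstoD(2)[OF tendsto_in_probability_0[OF r] \<eta>] unfolding eventually_at_right_field by auto
  have ordered: "\<P>(\<omega> in M. r < \<bar>X t \<omega> - X s \<omega>\<bar>) < \<eta>" if st: "0 \<le> s" "s < t" "t - s < d" for s t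
    using prob_increment[of s t "{x. r < \<bar>x\<bar>}"] d(2)[of "t - s"] st by simp
  show ?thesis
  proof (intro exI[of _ d] conjI allI impI d(1))
    fix s t :: real assume st: "0 \<le> s" "0 \<le> t" "\<bar>t - s\<bar> < d"
    consider "s < t" | "t < s" | "s = t" by linarith
    then show "\<P>(\<omega> in M. r < \<bar>X t \<omega> - X s \<omega>\<bar>) < \<eta>"
    proof cases
      case 1
      then show ?thesis using ordered st by simp
    next
      case 2
      then show ?thesis using ordered[of t s] st by (simp add: abs_minus_commute)
    next
      case 3
      then show ?thesis using r \<eta> by simp
    qed
  qed
qed

text \<open>Near l, P(X_y > r) is at least P(X_l > 2r) minus the probability of a move by more than
  r, hence at least q/2 - q/4. Using c both as level and as probability gives the one-parameter
  form; the positive level leaves room for a small drift.\<close>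

lemma prob_pos_uniform:
  assumes pos: "\<And>t. 0 < t \<Longrightarrow> 0 < \<P>(\<omega> in M. 0 < X t \<omega>)" and t1: "0 < t1"
  shows "\<exists>c>0. \<forall>t\<in>{t1..t2}. c \<le> \<P>(\<omega> in M. c < X t \<omega>)"
proof (rule compact_uniform_positive)
  fix l assume l: "l \<in> {t1..t2}"
  define q where "q = \<P>(\<omega> in M. 0 < X l \<omega>)"
  have q: "0 < q" using pos l t1 by (simp add: q_def)
  have [measurable]: "X l \<in> borel_measurable M" using l t1 by simp
  have "\<forall>\<^sub>F n in sequentially. q \<le> \<P>(\<omega> in M. 2 / real (Suc n) < X l \<omega>) + q / 2"
    unfolding q_def
  proof (rule prob_le_eventually)
    fix \<omega> assume \<omega>: "\<omega> \<in> {\<omega> \<in> space M. 0 < X l \<omega>}"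
    have "(\<lambda>n. 2 / real (Suc n)) \<longlonglongrightarrow> 0" by real_asymp
    from order_tendstoD(2)[OF this, of "X l \<omega>"]
    show "\<forall>\<^sub>F n in sequentially. \<omega> \<in> {\<omega> \<in> space M. 2 / real (Suc n) < X l \<omega>}" using \<omega> by simp
  qed (use q in \<open>auto simp: q_def\<close>)
  then obtain n where n: "q \<le> \<P>(\<omega> in M. 2 / real (Suc n) < X l \<omega>) + q / 2"
    using eventually_happens' sequentially_bot by blast
  define r where "r = 1 / real (Suc n)"
  have r: "0 < r" "q / 2 \<le> \<P>(\<omega> in M. 2 * r < X l \<omega>)" using n by (auto simp: r_def)
  have q4: "0 < q / 4" using q by simp
  obtain d where d: "d > 0"
    "\<forall>s\<ge>0. \<forall>t\<ge>0. \<bar>t - s\<bar> < d \<longrightarrow> \<P>(\<omega> in M. r < \<bar>X t \<omega> - X s \<omega>\<bar>) < q / 4"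
    using continuous_in_probability[OF r(1) q4] by (elim exE conjE) (rule that)
  define c where "c = min r (q / 4)"
  have "\<forall>\<^sub>F y in nhds l. dist y l < d" by (rule eventually_nhds_metric[THEN iffD2]) (use d in auto)
  then have "\<forall>\<^sub>F y in nhds l. y \<in> {t1..t2} \<longrightarrow> c \<le> \<P>(\<omega> in M. c < X y \<omega>)"
  proof (eventually_elim, intro impI)
    fix y assume y: "dist y l < d" "y \<in> {t1..t2}"
    have [measurable]: "X y \<in> borel_measurable M" using y t1 by simp
    have "\<P>(\<omega> in M. 2 * r < X l \<omega>)
      \<le> prob ({\<omega> \<in> space M. c < X y \<omega>} \<union> {\<omega> \<in> space M. r < \<bar>X y \<omega> - X l \<omega>\<bar>})"
      by (intro finite_measure_mono) (auto simp: c_def)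
    also have "\<dots> \<le> \<P>(\<omega> in M. c < X y \<omega>) + \<P>(\<omega> in M. r < \<bar>X y \<omega> - X l \<omega>\<bar>)"
      by (intro measure_Un_le) auto
    also have "\<P>(\<omega> in M. r < \<bar>X y \<omega> - X l \<omega>\<bar>) < q / 4"
      using d(2) y l t1 by (simp add: dist_real_def)
    finally show "c \<le> \<P>(\<omega> in M. c < X y \<omega>)" using r(2) by (simp add: c_def)
  qed
  moreover have "0 < c" using r q by (simp add: c_def)
  ultimately show "\<exists>d>0. \<forall>\<^sub>F y in nhds l. y \<in> {t1..t2} \<longrightarrow> d \<le> \<P>(\<omega> in M. d < X y \<omega>)" by blast
next
  fix d d' y :: real assume d: "y \<in> {t1..t2}" "0 < d'" "d' \<le> d" "d \<le> \<P>(\<omega> in M. d < X y \<omega>)"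
  have [measurable]: "X y \<in> borel_measurable M" using d t1 by simp
  have "\<P>(\<omega> in M. d < X y \<omega>) \<le> \<P>(\<omega> in M. d' < X y \<omega>)"
    using d by (intro finite_measure_mono) auto
  then show "d' \<le> \<P>(\<omega> in M. d' < X y \<omega>)" using d by linarith
qed simp

text \<open>On a window of times away from 0, a drift of total size at most r then changes P(X_t >
  0) by at most \<eta>. Half of the gap q is spent on enlarging the atom at 0 to a ball, half on
  moving from l to y.\<close>

lemma prob_zero_uniform:
  assumes zero: "\<And>t. t1 \<le> t \<Longrightarrow> t \<le> t2 \<Longrightarrow> \<P>(\<omega> in M. X t \<omega> = 0) < \<eta>" and t1: "0 < t1"
  shows "\<exists>r>0. \<forall>t\<in>{t1..t2}. \<P>(\<omega> in M. \<bar>X t \<omega>\<bar> \<le> r) \<le> \<eta>"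
proof (rule compact_uniform_positive)
  fix l assume l: "l \<in> {t1..t2}"
  define q where "q = \<eta> - \<P>(\<omega> in M. X l \<omega> = 0)"
  have q: "0 < q" using zero l by (simp add: q_def)
  have q_eq: "\<P>(\<omega> in M. X l \<omega> = 0) = \<eta> - q" by (simp add: q_def)
  have [measurable]: "X l \<in> borel_measurable M" using l t1 by simp
  have "\<forall>\<^sub>F n in sequentially. \<P>(\<omega> in M. X l \<omega> \<noteq> 0) \<le> \<P>(\<omega> in M. 2 / real (Suc n) < \<bar>X l \<omega>\<bar>) + q / 2"
  proof (rule prob_le_eventually)
    fix \<omega> assume \<omega>: "\<omega> \<in> {\<omega> \<in> space M. X l \<omega> \<noteq> 0}"
    have "(\<lambda>n. 2 / real (Suc n)) \<longlonglongrightarrow> 0" by real_asymp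
    from order_tendstoD(2)[OF this, of "\<bar>X l \<omega>\<bar>"]
    show "\<forall>\<^sub>F n in sequentially. \<omega> \<in> {\<omega> \<in> space M. 2 / real (Suc n) < \<bar>X l \<omega>\<bar>}" using \<omega> by simp
  qed (use q in auto)
  then obtain n where n: "\<P>(\<omega> in M. X l \<omega> \<noteq> 0) \<le> \<P>(\<omega> in M. 2 / real (Suc n) < \<bar>X l \<omega>\<bar>) + q / 2"
    using eventually_happens' sequentially_bot by blast
  define r where "r = 1 / real (Suc n)"
  have r: "0 < r" by (simp add: r_def)
  have "\<P>(\<omega> in M. X l \<omega> \<noteq> 0) = 1 - \<P>(\<omega> in M. X l \<omega> = 0)"
    by (rule prob_neg) simp
  moreover have "\<P>(\<omega> in M. \<bar>X l \<omega>\<bar> \<le> 2 * r) = 1 - \<P>(\<omega> in M. 2 * r < \<bar>X l \<omega>\<bar>)"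
    using prob_neg[of "\<lambda>\<omega>. 2 * r < \<bar>X l \<omega>\<bar>"] by (simp add: not_less)
  moreover have "\<P>(\<omega> in M. X l \<omega> \<noteq> 0) \<le> \<P>(\<omega> in M. 2 * r < \<bar>X l \<omega>\<bar>) + q / 2"
    using n by (simp add: r_def)
  ultimately have small: "\<P>(\<omega> in M. \<bar>X l \<omega>\<bar> \<le> 2 * r) \<le> \<eta> - q / 2"
    using q_eq by linarith
  have q2: "0 < q / 2" using q by simp
  obtain d where d: "d > 0"
    "\<forall>s\<ge>0. \<forall>t\<ge>0. \<bar>t - s\<bar> < d \<longrightarrow> \<P>(\<omega> in M. r < \<bar>X t \<omega> - X s \<omega>\<bar>) < q / 2"
    using continuous_in_probability[OF r q2] by (elim exE conjE) (rule that)
  have "\<forall>\<^sub>F y in nhds l. dist y l < d" by (rule eventually_nhds_metric[THEN iffD2]) (use d in auto)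
  then have "\<forall>\<^sub>F y in nhds l. y \<in> {t1..t2} \<longrightarrow> \<P>(\<omega> in M. \<bar>X y \<omega>\<bar> \<le> r) \<le> \<eta>"
  proof (eventually_elim, intro impI)
    fix y assume y: "dist y l < d" "y \<in> {t1..t2}"
    have [measurable]: "X y \<in> borel_measurable M" using y t1 by simp
    have "\<P>(\<omega> in M. \<bar>X y \<omega>\<bar> \<le> r)
      \<le> prob ({\<omega> \<in> space M. \<bar>X l \<omega>\<bar> \<le> 2 * r} \<union> {\<omega> \<in> space M. r < \<bar>X y \<omega> - X l \<omega>\<bar>})"
      by (intro finite_measure_mono) auto
    also have "\<dots> \<le> \<P>(\<omega> in M. \<bar>X l \<omega>\<bar> \<le> 2 * r) + \<P>(\<omega> in M. r < \<bar>X y \<omega> - X l \<omega>\<bar>)"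
      by (intro measure_Un_le) auto
    also have "\<P>(\<omega> in M. r < \<bar>X y \<omega> - X l \<omega>\<bar>) < q / 2"
      using d(2) y l t1 by (simp add: dist_real_def)
    finally show "\<P>(\<omega> in M. \<bar>X y \<omega>\<bar> \<le> r) \<le> \<eta>" using small by linarith
  qed
  with r show "\<exists>d>0. \<forall>\<^sub>F y in nhds l. y \<in> {t1..t2} \<longrightarrow> \<P>(\<omega> in M. \<bar>X y \<omega>\<bar> \<le> d) \<le> \<eta>" by blast
next
  fix d d' y :: real assume d: "y \<in> {t1..t2}" "0 < d'" "d' \<le> d" "\<P>(\<omega> in M. \<bar>X y \<omega>\<bar> \<le> d) \<le> \<eta>"
  have [measurable]: "X y \<in> borel_measurable M" using d t1 by simp
  have "\<P>(\<omega> in M. \<bar>X y \<omega>\<bar> \<le> d') \<le> \<P>(\<omega> in M. \<bar>X y \<omega>\<bar> \<le> d)"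
    using d by (intro finite_measure_mono) auto
  then show "\<P>(\<omega> in M. \<bar>X y \<omega>\<bar> \<le> d') \<le> \<eta>" using d by linarith
qed simp

text \<open>Two independent negative increments over h make X_{2h} negative, so P(X_{2h} < 0) = 0
  forces P(X_h < 0) = 0. Starting from t and halving, almost surely no increment over a mesh
  interval of length t/2^k is negative, and right-continuity makes the path monotone.\<close>

lemma prob_neg_pos:
  assumes not_mono: "\<not> nondecreasing_process M X" and t: "0 < t"
  shows "0 < \<P>(\<omega> in M. X t \<omega> < 0)"
proof (rule ccontr)
  assume "\<not> ?thesis"
  then have t0: "\<P>(\<omega> in M. X t \<omega> < 0) = 0" using measure_nonneg[of M] by (simp add: not_less antisym)
  have half: "\<P>(\<omega> in M. X h \<omega> < 0) = 0"
    if h: "0 < h" and two: "\<P>(\<omega> in M. X (2 * h) \<omega> < 0) = 0" for h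
  proof -
    have [measurable]: "X h \<in> borel_measurable M" "X (2 * h) \<in> borel_measurable M" using h by auto
    have "\<P>(\<omega> in M. X h \<omega> < 0) * \<P>(\<omega> in M. X h \<omega> < 0)
      = \<P>(\<omega> in M. X h \<omega> < 0 \<and> X (2 * h) \<omega> - X h \<omega> < 0)"
      using prob_two_increments[of h "2 * h" "{..<0}" "{..<0}"] h by simp
    also have "\<dots> \<le> \<P>(\<omega> in M. X (2 * h) \<omega> < 0)"
      by (intro finite_measure_mono) auto
    finally have "\<P>(\<omega> in M. X h \<omega> < 0) * \<P>(\<omega> in M. X h \<omega> < 0) \<le> 0"
      by (simp add: two)
    then show ?thesis by (simp add: mult_le_0_iff measure_le_0_iff)
  qed
  define h where "h k = t / 2 ^ k" for k :: nat
  have h: "0 < h k" for k using t by (simp add: h_def)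
  have zero: "\<P>(\<omega> in M. X (h k) \<omega> < 0) = 0" for k
  proof (induction k)
    case 0
    then show ?case using t0 by (simp add: h_def)
  next
    case (Suc k)
    moreover have "2 * h (Suc k) = h k" by (simp add: h_def)
    ultimately show ?case using half[OF h] by simp
  qed
  have "AE \<omega> in M. \<forall>k i. 0 \<le> X (real (Suc i) * h k) \<omega> - X (real i * h k) \<omega>"
  proof (subst AE_all_countable, intro allI, subst AE_all_countable, intro allI)
    fix k i
    define s u where "s = real i * h k" and "u = real (Suc i) * h k"
    have su: "0 \<le> s" "s \<le> u" "u - s = h k"
      using h[of k] by (auto simp: s_def u_def distrib_right)
    have [measurable]: "X s \<in> borel_measurable M" "X u \<in> borel_measurable M"
      using su by (auto intro: rv_X)
    have "\<P>(\<omega> in M. X u \<omega> - X s \<omega> \<in> {..<0}) = 0"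
      using prob_increment[of s u "{..<0}"] su zero[of k] by simp
    moreover have "{\<omega> \<in> space M. X u \<omega> - X s \<omega> \<in> {..<0}} \<in> events" by measurable
    ultimately have "AE \<omega> in M. \<omega> \<notin> {\<omega> \<in> space M. X u \<omega> - X s \<omega> \<in> {..<0}}"
      using prob_eq_0 by blast
    then have "AE \<omega> in M. 0 \<le> X u \<omega> - X s \<omega>"
      by (rule AE_mp) (auto intro!: AE_I2)
    then show "AE \<omega> in M. 0 \<le> X (real (Suc i) * h k) \<omega> - X (real i * h k) \<omega>"
      unfolding s_def u_def .
  qed
  then have "AE \<omega> in M. mono_on {0..} (\<lambda>t. X t \<omega>)"
  proof (rule AE_mp, intro AE_I2 impI)
    fix \<omega> assume \<omega>: "\<omega> \<in> space M" and incr: "\<forall>k i. 0 \<le> X (real (Suc i) * h k) \<omega> - X (real i * h k) \<omega>"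
    \<comment> \<open>The first mesh point strictly to the right of s; strictness is needed because
      right-continuity is a limit along \<open>at_right\<close>.\<close>
    define d where "d s k = real (nat \<lfloor>s / h k\<rfloor> + 1) * h k" for s k
    have hlim: "h \<longlonglongrightarrow> 0" unfolding h_def by real_asymp
    have d_bounds: "s < d s k" "d s k \<le> s + h k" if "0 \<le> s" for s k
    proof -
      have "real (nat \<lfloor>s / h k\<rfloor> + 1) = real_of_int \<lfloor>s / h k\<rfloor> + 1" using that h[of k] by simp
      then have "s / h k < real (nat \<lfloor>s / h k\<rfloor> + 1)" "real (nat \<lfloor>s / h k\<rfloor> + 1) \<le> s / h k + 1" by linarith+
      then show "s < d s k" "d s k \<le> s + h k"
        using h[of k] unfolding d_def by (auto simp: field_simps)
    qed
    have lim: "(\<lambda>k. X (d s k) \<omega>) \<longlonglongrightarrow> X s \<omega>" if s: "0 \<le> s" for s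
    proof -
      have "(\<lambda>k. d s k) \<longlonglongrightarrow> s"
      proof (rule tendsto_sandwich[of "\<lambda>_. s" _ _ "\<lambda>k. s + h k"])
        show "(\<lambda>k. s + h k) \<longlonglongrightarrow> s" using tendsto_add[OF tendsto_const hlim] by fastforce
      qed (use d_bounds[OF s] in \<open>auto simp: less_imp_le\<close>)
      then have "filterlim (d s) (at_right s) sequentially"
        using d_bounds(1)[OF s] by (simp add: filterlim_at less_imp_neq[OF d_bounds(1)[OF s], symmetric])
      then show ?thesis by (rule filterlim_compose[OF cadlag_right[OF path_cadlag[OF \<omega>] s]])
    qed
    have grid_mono: "X (real i * h k) \<omega> \<le> X (real j * h k) \<omega>" if "i \<le> j" for i j k
      using that
    proof (induction j rule: dec_induct)
      case (step n)
      then show ?case using incr[rule_format, where k = k and i = n] by linarith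
    qed simp
    show "mono_on {0..} (\<lambda>t. X t \<omega>)"
    proof (rule mono_onI)
      fix s u :: real assume su: "s \<in> {0..}" "u \<in> {0..}" "s \<le> u"
      have le: "X (d s k) \<omega> \<le> X (d u k) \<omega>" for k
        unfolding d_def using su h[of k]
        by (intro grid_mono add_mono nat_mono floor_mono divide_right_mono) auto
      show "X s \<omega> \<le> X u \<omega>"
        using su by (intro LIMSEQ_le[OF lim lim]) (use le in auto)
    qed
  qed
  then show False using not_mono by (simp add: nondecreasing_process_def)
qed

lemma uminus_levy: "levy_process M (\<lambda>t \<omega>. - X t \<omega>)"
proof
  show "random_variable borel (\<lambda>\<omega>. - X t \<omega>)" if "0 \<le> t" for t using that by simp
  show "AE \<omega> in M. - X 0 \<omega> = 0" using start_zero by simp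
  show "indep_vars (\<lambda>_. borel) (\<lambda>i \<omega>. - X (t (Suc i)) \<omega> - - X (t i) \<omega>) {..<n}"
    if "0 \<le> t 0" "\<And>i. i < n \<Longrightarrow> t i \<le> t (Suc i)" for t :: "nat \<Rightarrow> real" and n
    using indep_vars_compose2[OF indep_increments[OF that], where Y = "\<lambda>_ x. - x" and N = "\<lambda>_. borel"] by simp
  show "distr M borel (\<lambda>\<omega>. - X (s + h) \<omega> - - X s \<omega>) = distr M borel (\<lambda>\<omega>. - X h \<omega>)"
    if sh: "0 \<le> s" "0 \<le> h" for s h
  proof -
    have "(\<lambda>\<omega>. X (s + h) \<omega> - X s \<omega>) \<in> borel_measurable M" "X h \<in> borel_measurable M"
      using sh by (auto intro!: borel_measurable_diff)
    then have "distr M borel (\<lambda>\<omega>. - (X (s + h) \<omega> - X s \<omega>)) = distr M borel (\<lambda>\<omega>. - X h \<omega>)"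
      using distr_distr[of "uminus :: real \<Rightarrow> real" borel borel "\<lambda>\<omega>. X (s + h) \<omega> - X s \<omega>" M]
        distr_distr[of "uminus :: real \<Rightarrow> real" borel borel "X h" M] stationary_increments[OF sh]
      by (simp add: comp_def)
    then show ?thesis by (simp add: algebra_simps)
  qed
  show "cadlag (\<lambda>t. - X t \<omega>)" if \<omega>: "\<omega> \<in> space M" for \<omega>
    unfolding cadlag_def
  proof (intro conjI allI impI)
    fix t :: real
    show "((\<lambda>t. - X t \<omega>) \<longlongrightarrow> - X t \<omega>) (at_right t)" if "0 \<le> t"
      using cadlag_right[OF path_cadlag[OF \<omega>] that] by (rule tendsto_minus)
    show "\<exists>l. ((\<lambda>t. - X t \<omega>) \<longlongrightarrow> l) (at_left t)" if "0 < t"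
      using tendsto_minus[OF left_lim_tendsto[OF path_cadlag[OF \<omega>] that]] by (rule exI)
  qed
qed

text \<open>Scaling gives P(X_c = 0) = q for all c > 0, and independence of increments makes the
  events {X_s = 0} and {X_t = 0} independent. If q > 0, Chebyshev's inequality finds zeros
  immediately after time 1 with probability near 1. But X_1 \<noteq> 0 excludes them by
  right-continuity, so X_1 = 0 almost surely. For the limit process this makes 0 a continuity point
  of its distribution function at time 1.\<close>

lemma self_similar_prob_zero:
  assumes ss: "self_similar M X H" and nz: "\<not> (AE \<omega> in M. X 1 \<omega> = 0)"
  shows "\<P>(\<omega> in M. X 1 \<omega> = 0) = 0"
proof (rule ccontr)
  define q where "q = \<P>(\<omega> in M. X 1 \<omega> = 0)"
  assume "\<P>(\<omega> in M. X 1 \<omega> = 0) \<noteq> 0"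
  then have q: "0 < q" using measure_nonneg[of M] by (simp add: q_def less_le)
  have [measurable]: "X 1 \<in> borel_measurable M" by simp
  have scale: "\<P>(\<omega> in M. X c \<omega> = 0) = q" if c: "0 < c" for c
  proof -
    have [measurable]: "X c \<in> borel_measurable M" using c by simp
    let ?P = "Pi\<^sub>M {1::real} (\<lambda>_. borel :: real measure)"
    have m1: "(\<lambda>\<omega>. \<lambda>t\<in>{1}. X (c * t) \<omega>) \<in> measurable M ?P"
      by (rule measurable_restrict) (use c in simp)
    have m2: "(\<lambda>\<omega>. \<lambda>t\<in>{1}. c powr H * X t \<omega>) \<in> measurable M ?P"
      by (rule measurable_restrict) simp
    let ?Z = "{f \<in> space ?P. f 1 = 0}"
    have Z: "?Z \<in> sets ?P" by measurable
    have "distr M ?P (\<lambda>\<omega>. \<lambda>t\<in>{1}. X (c * t) \<omega>) = distr M ?P (\<lambda>\<omega>. \<lambda>t\<in>{1}. c powr H * X t \<omega>)"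
      using ss[unfolded self_similar_def, rule_format, of c "{1}"] c by fastforce
    then have "measure (distr M ?P (\<lambda>\<omega>. \<lambda>t\<in>{1}. X (c * t) \<omega>)) ?Z
      = measure (distr M ?P (\<lambda>\<omega>. \<lambda>t\<in>{1}. c powr H * X t \<omega>)) ?Z" by (rule arg_cong)
    moreover have "(\<lambda>\<omega>. \<lambda>t\<in>{1}. X (c * t) \<omega>) -` ?Z \<inter> space M = {\<omega> \<in> space M. X c \<omega> = 0}"
      by (auto simp: space_PiM)
    moreover have "(\<lambda>\<omega>. \<lambda>t\<in>{1}. c powr H * X t \<omega>) -` ?Z \<inter> space M = {\<omega> \<in> space M. X 1 \<omega> = 0}"
      using c by (auto simp: space_PiM)
    ultimately show ?thesis unfolding q_def by (simp only: measure_distr[OF m1 Z] measure_distr[OF m2 Z])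
  qed
  have scale_pair: "prob ({\<omega> \<in> space M. X s \<omega> = 0} \<inter> {\<omega> \<in> space M. X t \<omega> = 0}) = q * q" if st: "0 < s" "s < t" for s t
  proof -
    have "prob ({\<omega> \<in> space M. X s \<omega> = 0} \<inter> {\<omega> \<in> space M. X t \<omega> = 0})
      = \<P>(\<omega> in M. X s \<omega> \<in> {0} \<and> X t \<omega> - X s \<omega> \<in> {0})"
      by (intro arg_cong[where f = prob]) auto
    also have "\<dots> = q * q"
      using prob_two_increments[of s t "{0}" "{0}"] st scale[of s] scale[of "t - s"] by simp
    finally show ?thesis .
  qed
  \<comment> \<open>For 1 \<le> j \<le> n these are n times in (1, 1 + 1/n]: their number grows
    while they shrink towards 1.\<close>
  define T where "T n j = 1 + real j / (real n)\<^sup>2" for n j :: nat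
  have T: "0 < T n j" for n j by (auto simp: T_def intro: add_pos_nonneg)
  have T_mono: "T n j < T n k" if "j < k" "0 < n" for n j k using that by (simp add: T_def divide_strict_right_mono)
  define B where "B n = {\<omega> \<in> space M. \<forall>j\<in>{1..n}. X (T n j) \<omega> \<noteq> 0}" for n
  have [measurable]: "X (T n j) \<in> borel_measurable M" for n j using T[of n j] by simp
  have B_meas[measurable]: "B n \<in> events" for n unfolding B_def by measurable
  have bound: "prob (B n) \<le> 1 / (q * real n)" if n: "0 < n" for n
  proof -
    have "(real (card {1..n}) * q)\<^sup>2 * prob (B n) \<le> real (card {1..n}) * (q - q * q)"
    proof (rule pairwise_independent_none[where Z = "\<lambda>j. {\<omega> \<in> space M. X (T n j) \<omega> = 0}"])
      fix j k assume jk: "j \<in> {1..n}" "k \<in> {1..n}" "j \<noteq> k"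
      then consider "j < k" | "k < j" by linarith
      then show "prob ({\<omega> \<in> space M. X (T n j) \<omega> = 0} \<inter> {\<omega> \<in> space M. X (T n k) \<omega> = 0}) = q * q"
      proof cases
        case 1
        then show ?thesis using scale_pair[OF T T_mono[OF 1 n]] by simp
      next
        case 2
        then show ?thesis using scale_pair[OF T T_mono[OF 2 n]] by (simp add: Int_commute)
      qed
    next
      show "\<P>(\<omega> in M. X (T n j) \<omega> = 0) = q" for j by (rule scale[OF T])
    qed (auto simp: B_def)
    also have "\<dots> \<le> real n * q" using q by (simp add: mult_left_mono)
    finally have "(real n * q) * ((real n * q) * prob (B n)) \<le> (real n * q) * 1"
      by (simp add: power2_eq_square mult.assoc)
    then have "(real n * q) * prob (B n) \<le> 1" using n q by (subst (asm) mult_le_cancel_left_pos) auto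
    then show ?thesis using n q by (simp add: field_simps)
  qed
  have "\<P>(\<omega> in M. X 1 \<omega> \<noteq> 0) \<le> 0"
  proof (rule field_le_epsilon)
    fix \<zeta> :: real assume \<zeta>: "0 < \<zeta>"
    have "\<forall>\<^sub>F n in sequentially. \<P>(\<omega> in M. X 1 \<omega> \<noteq> 0) \<le> prob (B n) + \<zeta> / 2"
    proof (rule prob_le_eventually)
      fix \<omega> assume \<omega>: "\<omega> \<in> {\<omega> \<in> space M. X 1 \<omega> \<noteq> 0}"
      then have "\<forall>\<^sub>F s in at_right 1. X s \<omega> \<noteq> 0"
        using tendsto_imp_eventually_ne[OF cadlag_right[OF path_cadlag, of \<omega> 1]] by simp
      then obtain u where u: "1 < u" "\<And>s. 1 < s \<Longrightarrow> s < u \<Longrightarrow> X s \<omega> \<noteq> 0"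
        unfolding eventually_at_right_field by blast
      have "(\<lambda>n. 1 / real n) \<longlonglongrightarrow> 0" by real_asymp
      then have "\<forall>\<^sub>F n in sequentially. 1 / real n < u - 1" using u by (intro order_tendstoD(2)) auto
      then show "\<forall>\<^sub>F n in sequentially. \<omega> \<in> B n"
        using eventually_gt_at_top[of 0]
      proof eventually_elim
        case (elim n)
        have "X (T n j) \<omega> \<noteq> 0" if j: "j \<in> {1..n}" for j
        proof (rule u(2))
          show "1 < T n j" using j elim by (simp add: T_def)
          have "real j / (real n)\<^sup>2 \<le> real n / (real n)\<^sup>2" using j by (intro divide_right_mono) auto
          also have "\<dots> = 1 / real n" using elim by (simp add: power2_eq_square)
          finally show "T n j < u" using elim by (simp add: T_def)
        qed
        then show ?case using \<omega> by (simp add: B_def)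
      qed
    qed (use \<zeta> in auto)
    moreover have "\<forall>\<^sub>F n in sequentially. 1 / (q * real n) < \<zeta> / 2"
    proof -
      have "(\<lambda>n. 1 / (q * real n)) \<longlonglongrightarrow> 0" using q by real_asymp
      then show ?thesis using \<zeta> by (intro order_tendstoD(2)) auto
    qed
    ultimately have "\<forall>\<^sub>F n in sequentially. \<P>(\<omega> in M. X 1 \<omega> \<noteq> 0) \<le> \<zeta>"
      using eventually_gt_at_top[of 0]
    proof eventually_elim
      case (elim n)
      then show ?case using bound[of n] by linarith
    qed
    then show "\<P>(\<omega> in M. X 1 \<omega> \<noteq> 0) \<le> 0 + \<zeta>" by (simp add: eventually_const)
  qed
  then have "\<P>(\<omega> in M. X 1 \<omega> \<noteq> 0) = 0" using measure_nonneg[of M] by (simp add: antisym)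
  then have "AE \<omega> in M. \<not> X 1 \<omega> \<noteq> 0" by (subst (asm) prob_eq_0) auto
  then show False using nz by simp
qed

end

text \<open>At stage j only the finitely many conditions with code at most j are imposed on E j;
  each condition is then met from its own code onwards.\<close>

lemma diagonal_eventually:
  fixes Q :: "'c::countable \<Rightarrow> nat \<Rightarrow> nat \<Rightarrow> bool"
  assumes "\<And>m j. \<forall>\<^sub>F e in sequentially. Q m j e"
  shows "\<exists>E. (\<forall>j. j \<le> E j) \<and> (\<forall>m. \<forall>\<^sub>F j in sequentially. Q m j (E j))"
proof -
  have "\<exists>e\<ge>j. \<forall>m\<in>{m. to_nat m \<le> j}. Q m j e" for j
  proof -
    have "finite {m :: 'c. to_nat m \<le> j}"
      by (rule finite_imageD[of to_nat]) (auto intro: finite_subset[of _ "{..j}"] inj_on_subset[OF inj_to_nat])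
    then have "\<forall>\<^sub>F e in sequentially. \<forall>m\<in>{m. to_nat m \<le> j}. Q m j e"
      using assms by (intro eventually_ball_finite) auto
    with eventually_ge_at_top[of j] have "\<forall>\<^sub>F e in sequentially. e \<ge> j \<and> (\<forall>m\<in>{m. to_nat m \<le> j}. Q m j e)"
      by eventually_elim simp
    then show ?thesis using eventually_happens' sequentially_bot by blast
  qed
  then obtain E where E: "\<And>j. j \<le> E j" "\<And>j m. to_nat m \<le> j \<Longrightarrow> Q m j (E j)" by (metis mem_Collect_eq)
  have "\<forall>\<^sub>F j in sequentially. Q m j (E j)" for m
    using eventually_ge_at_top[of "to_nat m"] by eventually_elim (rule E(2))
  then show ?thesis using E(1) by blast
qed

section \<open>Measurability and approximation of the supremum time\<close>

context levy_process
begin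

lemma grid_argmax_measurable [measurable]:
  "(\<lambda>\<omega>. grid_argmax \<delta> e (\<lambda>t. X t \<omega>)) \<in> measurable M (count_space UNIV)"
  using measurable_compose[OF iid_walk.path_measurable[OF grid_walk[of \<delta> e]] measurable_first_argmax[of "2 ^ e"]]
  by simp

lemma sup_time_measurable [measurable]: "(\<lambda>\<omega>. sup_time (\<lambda>t. X t \<omega>)) \<in> borel_measurable M"
proof (subst borel_measurable_iff_le, intro allI)
  fix x :: real
  consider "x < 0" | "0 \<le> x" "x < 1" | "1 \<le> x" by linarith
  then show "{\<omega> \<in> space M. sup_time (\<lambda>t. X t \<omega>) \<le> x} \<in> sets M"
  proof cases
    case 1
    have "\<not> sup_time (\<lambda>t. X t \<omega>) \<le> x" if "\<omega> \<in> space M" for \<omega>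
      using sup_time_nonneg[OF path_cadlag[OF that]] 1 by simp
    then have "{\<omega> \<in> space M. sup_time (\<lambda>t. X t \<omega>) \<le> x} = {}" by auto
    then show ?thesis by (simp only: sets.empty_sets)
  next
    case 2
    have "{\<omega> \<in> space M. sup_time (\<lambda>t. X t \<omega>) \<le> x}
      = {\<omega> \<in> space M. \<forall>n m::nat. x + 1 / Suc n < 1 \<longrightarrow>
        (\<exists>K. \<forall>e\<ge>K. real (grid_argmax (1 / Suc m) e (\<lambda>t. X t \<omega>)) \<le> (x + 1 / Suc n) * 2 ^ e)}"
      using sup_time_le_iff_grid[OF path_cadlag 2] unfolding eventually_sequentially by blast
    also have "\<dots> \<in> sets M" by measurable
    finally show ?thesis .
  next
    case 3
    have "sup_time (\<lambda>t. X t \<omega>) \<le> x" if "\<omega> \<in> space M" for \<omega>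
    proof -
      note f = path_cadlag[OF that]
      obtain l where "0 \<le> l" "l \<le> 1" "max (X l \<omega>) (left_lim (\<lambda>t. X t \<omega>) l) = sup_value (\<lambda>t. X t \<omega>)"
        using sup_time_set(2)[OF f] by blast
      then have "sup_time (\<lambda>t. X t \<omega>) \<le> l"
        unfolding sup_time_def using sup_time_set(1)[OF f] by (intro cInf_lower) auto
      then show ?thesis using \<open>l \<le> 1\<close> 3 by simp
    qed
    then have "{\<omega> \<in> space M. sup_time (\<lambda>t. X t \<omega>) \<le> x} = space M" by auto
    then show ?thesis by simp
  qed
qed

text \<open>The drift \<open>-1/(j+1)\<close> breaks ties in favour of the first maximum, so that no uniqueness of the
  time of the supremum is needed; the mesh \<open>2\<^bsup>-E j\<^esup>\<close> must be fine enough for the given drift.\<close>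

lemma sup_time_approximation:
  "\<exists>E :: nat \<Rightarrow> nat. (\<forall>j. j \<le> E j) \<and> (\<forall>x x' z. 0 \<le> x \<longrightarrow> x < x' \<longrightarrow> x' < 1 \<longrightarrow> 0 < z \<longrightarrow>
    (\<forall>\<^sub>F j in sequentially. \<P>(\<omega> in M. sup_time (\<lambda>t. X t \<omega>) \<le> x)
      \<le> \<P>(\<omega> in M. real (grid_argmax (1 / Suc j) (E j) (\<lambda>t. X t \<omega>)) \<le> x' * 2 ^ E j) + z) \<and>
    (\<forall>\<^sub>F j in sequentially. \<P>(\<omega> in M. real (grid_argmax (1 / Suc j) (E j) (\<lambda>t. X t \<omega>)) \<le> x * 2 ^ E j)
      \<le> \<P>(\<omega> in M. sup_time (\<lambda>t. X t \<omega>) \<le> x') + z))"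
proof -
  define L where "L j e \<omega> = real (grid_argmax (1 / Suc j) e (\<lambda>t. X t \<omega>))" for j e \<omega>
  define \<tau> where "\<tau> \<omega> = sup_time (\<lambda>t. X t \<omega>)" for \<omega>
  have [measurable]: "L j e \<in> borel_measurable M" for j e unfolding L_def by measurable
  have [measurable]: "\<tau> \<in> borel_measurable M" unfolding \<tau>_def by measurable
  \<comment> \<open>The j-th drift may be too large to detect x < \<tau> for a given path, so at
    fixed j only this smaller event is handled by refining the mesh. As j grows, every path with x <
    \<tau> eventually enters it.\<close>
  define H where "H j x = {\<omega> \<in> space M. x < \<tau> \<omega> \<and> (\<exists>K. \<forall>e\<ge>K. x * 2 ^ e < L j e \<omega>)}" for j x
  have [measurable]: "H j x \<in> events" for j x unfolding H_def by measurable
  \<comment> \<open>Rational levels leave countably many conditions for the diagonal choice;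
    arbitrary x < x' are served by rationals between them.\<close>
  define Q :: "rat \<times> rat \<Rightarrow> nat \<Rightarrow> nat \<Rightarrow> bool" where
    "Q m j e \<longleftrightarrow> (case m of (p, q) \<Rightarrow> 0 \<le> real_of_rat p \<longrightarrow> real_of_rat p < real_of_rat q \<longrightarrow> real_of_rat q < 1 \<longrightarrow>
      \<P>(\<omega> in M. \<tau> \<omega> \<le> real_of_rat p) \<le> \<P>(\<omega> in M. L j e \<omega> \<le> real_of_rat q * 2 ^ e) + 1 / Suc j \<and>
      prob (H j (real_of_rat p)) \<le> \<P>(\<omega> in M. real_of_rat p * 2 ^ e < L j e \<omega>) + 1 / Suc j)" for m j e
  have Q: "\<forall>\<^sub>F e in sequentially. Q m j e" for m j
  proof (cases m)
    case (Pair p q)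
    show ?thesis
    proof (cases "0 \<le> real_of_rat p \<and> real_of_rat p < (real_of_rat q :: real) \<and> real_of_rat q < (1 :: real)")
      case False
      then show ?thesis unfolding Q_def Pair by (intro always_eventually allI) auto
    next
      case True
      define x x' :: real where "x = real_of_rat p" and "x' = real_of_rat q"
      have x: "0 \<le> x" "x < x'" "x' < 1" using True by (auto simp: x_def x'_def)
      have "\<forall>\<^sub>F e in sequentially. \<P>(\<omega> in M. \<tau> \<omega> \<le> x) \<le> \<P>(\<omega> in M. L j e \<omega> \<le> x' * 2 ^ e) + 1 / Suc j"
      proof (rule prob_le_eventually)
        fix \<omega> assume \<omega>: "\<omega> \<in> {\<omega> \<in> space M. \<tau> \<omega> \<le> x}"
        have "\<forall>\<^sub>F e in sequentially. L j e \<omega> \<le> x' * 2 ^ e"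
          unfolding L_def by (rule grid_argmax_eventually_le[OF path_cadlag x]) (use \<omega> in \<open>auto simp: \<tau>_def\<close>)
        then show "\<forall>\<^sub>F e in sequentially. \<omega> \<in> {\<omega> \<in> space M. L j e \<omega> \<le> x' * 2 ^ e}" using \<omega> by simp
      qed auto
      moreover have "\<forall>\<^sub>F e in sequentially. prob (H j x) \<le> \<P>(\<omega> in M. x * 2 ^ e < L j e \<omega>) + 1 / Suc j"
      proof (rule prob_le_eventually)
        fix \<omega> assume "\<omega> \<in> H j x"
        then show "\<forall>\<^sub>F e in sequentially. \<omega> \<in> {\<omega> \<in> space M. x * 2 ^ e < L j e \<omega>}"
          unfolding H_def eventually_sequentially by auto
      qed auto
      ultimately have "\<forall>\<^sub>F e in sequentially.
        \<P>(\<omega> in M. \<tau> \<omega> \<le> x) \<le> \<P>(\<omega> in M. L j e \<omega> \<le> x' * 2 ^ e) + 1 / Suc j \<and>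
        prob (H j x) \<le> \<P>(\<omega> in M. x * 2 ^ e < L j e \<omega>) + 1 / Suc j"
        by (rule eventually_conj)
      then show ?thesis unfolding Q_def Pair x_def x'_def by eventually_elim simp
    qed
  qed
  obtain E where E: "\<forall>j. j \<le> E j" "\<forall>m. \<forall>\<^sub>F j in sequentially. Q m j (E j)"
    using diagonal_eventually[of Q, OF Q] by (elim exE conjE) (rule that)
  have lim: "\<forall>\<^sub>F j in sequentially. 1 / real (Suc j) < z" if "0 < z" for z
  proof -
    have "(\<lambda>j. 1 / real (Suc j)) \<longlonglongrightarrow> 0" by real_asymp
    then show ?thesis using that by (rule order_tendstoD(2))
  qed
  have low: "\<forall>\<^sub>F j in sequentially. \<P>(\<omega> in M. \<tau> \<omega> \<le> x) \<le> \<P>(\<omega> in M. L j (E j) \<omega> \<le> x' * 2 ^ E j) + z"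
    if x: "0 \<le> x" "x < x'" "x' < 1" and z: "0 < z" for x x' z
  proof -
    obtain p where p: "x < real_of_rat p" "real_of_rat p < x'" using of_rat_dense[OF x(2)] by blast
    obtain q where q: "real_of_rat p < (real_of_rat q :: real)" "real_of_rat q < x'" using of_rat_dense[OF p(2)] by blast
    show ?thesis using E(2)[rule_format, of "(p, q)"] lim[OF z]
    proof eventually_elim
      case (elim j)
      have "\<P>(\<omega> in M. \<tau> \<omega> \<le> x) \<le> \<P>(\<omega> in M. \<tau> \<omega> \<le> real_of_rat p)"
        using p by (intro finite_measure_mono) auto
      moreover have "\<P>(\<omega> in M. L j (E j) \<omega> \<le> real_of_rat q * 2 ^ E j) \<le> \<P>(\<omega> in M. L j (E j) \<omega> \<le> x' * 2 ^ E j)"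
      proof (intro finite_measure_mono)
        have "real_of_rat q * 2 ^ E j \<le> x' * 2 ^ E j" using q by (intro mult_right_mono) auto
        from order_trans[OF _ this]
        show "{\<omega> \<in> space M. L j (E j) \<omega> \<le> real_of_rat q * 2 ^ E j} \<subseteq> {\<omega> \<in> space M. L j (E j) \<omega> \<le> x' * 2 ^ E j}"
          by blast
      qed auto
      moreover have "0 \<le> (real_of_rat p :: real)" "real_of_rat q < (1 :: real)" using p q x by linarith+
      then have "\<P>(\<omega> in M. \<tau> \<omega> \<le> real_of_rat p)
        \<le> \<P>(\<omega> in M. L j (E j) \<omega> \<le> real_of_rat q * 2 ^ E j) + 1 / Suc j"
        using elim(1) q(1) unfolding Q_def prod.case by blast
      ultimately show ?case using elim(2) by linarith
    qed
  qed
  have up: "\<forall>\<^sub>F j in sequentially. \<P>(\<omega> in M. L j (E j) \<omega> \<le> x * 2 ^ E j) \<le> \<P>(\<omega> in M. \<tau> \<omega> \<le> x') + z"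
    if x: "0 \<le> x" "x < x'" "x' < 1" and z: "0 < z" for x x' z
  proof -
    obtain p where p: "x < real_of_rat p" "real_of_rat p < x'" using of_rat_dense[OF x(2)] by blast
    obtain q where q: "real_of_rat p < (real_of_rat q :: real)" "real_of_rat q < x'" using of_rat_dense[OF p(2)] by blast
    define y :: real where "y = real_of_rat p"
    have y: "x < y" "y < x'" using p by (auto simp: y_def)
    have z2: "0 < z / 2" using z by simp
    have "\<forall>\<^sub>F j in sequentially. \<P>(\<omega> in M. y < \<tau> \<omega>) \<le> prob (H j y) + z / 2"
    proof (rule prob_le_eventually)
      fix \<omega> assume \<omega>: "\<omega> \<in> {\<omega> \<in> space M. y < \<tau> \<omega>}"
      then have y': "cadlag (\<lambda>t. X t \<omega>)" "0 \<le> y" "y < 1" "y < sup_time (\<lambda>t. X t \<omega>)"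
        using y x by (auto simp: \<tau>_def path_cadlag)
      obtain \<delta>0 where \<delta>0: "0 < \<delta>0" and gt: "\<forall>\<delta>. 0 < \<delta> \<longrightarrow> \<delta> \<le> \<delta>0 \<longrightarrow>
          (\<forall>\<^sub>F e in sequentially. y * 2 ^ e < real (grid_argmax \<delta> e (\<lambda>t. X t \<omega>)))"
        using grid_argmax_eventually_gt[OF y'] by (elim exE conjE) (rule that)
      show "\<forall>\<^sub>F j in sequentially. \<omega> \<in> H j y"
        using lim[OF \<delta>0]
      proof eventually_elim
        case (elim j)
        have "\<forall>\<^sub>F e in sequentially. y * 2 ^ e < L j e \<omega>"
          unfolding L_def using gt[rule_format, of "1 / Suc j"] elim by simp
        then show ?case using \<omega> unfolding H_def eventually_sequentially by simp
      qed
    qed (use z in auto)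
    then show ?thesis using E(2)[rule_format, of "(p, q)"] lim[OF z2]
    proof eventually_elim
      case (elim j)
      have "0 \<le> (real_of_rat p :: real)" "real_of_rat q < (1 :: real)" using p q x by linarith+
      then have "prob (H j y) \<le> \<P>(\<omega> in M. y * 2 ^ E j < L j (E j) \<omega>) + 1 / Suc j"
        using elim(2) q(1) unfolding Q_def prod.case y_def by blast
      then have 1: "\<P>(\<omega> in M. y < \<tau> \<omega>) \<le> \<P>(\<omega> in M. y * 2 ^ E j < L j (E j) \<omega>) + z"
        using elim(1,3) by linarith
      have 2: "\<P>(\<omega> in M. \<not> \<tau> \<omega> \<le> y) = 1 - \<P>(\<omega> in M. \<tau> \<omega> \<le> y)" by (rule prob_neg) simp
      have 3: "\<P>(\<omega> in M. \<not> L j (E j) \<omega> \<le> y * 2 ^ E j) = 1 - \<P>(\<omega> in M. L j (E j) \<omega> \<le> y * 2 ^ E j)"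
        by (rule prob_neg) simp
      have "\<P>(\<omega> in M. L j (E j) \<omega> \<le> x * 2 ^ E j) \<le> \<P>(\<omega> in M. L j (E j) \<omega> \<le> y * 2 ^ E j)"
      proof (intro finite_measure_mono)
        have "x * 2 ^ E j \<le> y * 2 ^ E j" using y by (intro mult_right_mono) auto
        from order_trans[OF _ this] show "{\<omega> \<in> space M. L j (E j) \<omega> \<le> x * 2 ^ E j} \<subseteq> {\<omega> \<in> space M. L j (E j) \<omega> \<le> y * 2 ^ E j}" by blast
      qed auto
      moreover have "\<P>(\<omega> in M. \<tau> \<omega> \<le> y) \<le> \<P>(\<omega> in M. \<tau> \<omega> \<le> x')"
        using y by (intro finite_measure_mono) auto
      ultimately show ?case using 1 2 3 unfolding not_le by linarith
    qed
  qed
  show ?thesis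
    using E(1) low up unfolding L_def \<tau>_def by (intro exI[of _ E] conjI allI impI) simp_all
qed

section \<open>Small-time limits and the two asymptotic statements\<close>

text \<open>Dividing by a_t > 0 preserves signs, so P(X_t > 0) is read off the distribution function
  of X_t / a_t at 0, where the limit is continuous by \<open>self_similar_prob_zero\<close>.\<close>

lemma small_time_limits:
  assumes dom: "small_time_domain M X \<alpha> \<rho>"
  shows small_time_prob_pos: "((\<lambda>t. \<P>(\<omega> in M. 0 < X t \<omega>)) \<longlongrightarrow> \<rho>) (at_right 0)"
    and small_time_prob_zero: "0 < \<eta> \<Longrightarrow> \<forall>\<^sub>F t in at_right 0. \<P>(\<omega> in M. X t \<omega> = 0) < \<eta>"
    and small_time_rho: "0 \<le> \<rho>" "\<rho> \<le> 1"
proof -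
  obtain a :: "real \<Rightarrow> real" and N :: "(real \<Rightarrow> real) measure" and Y where
    a: "\<forall>\<epsilon>>0. 0 < a \<epsilon>" and Y: "levy_process N Y" and nz: "\<not> (AE \<omega> in N. Y 1 \<omega> = 0)"
    and conv: "weak_conv_filter (\<lambda>\<epsilon>. distr M borel (\<lambda>\<omega>. X \<epsilon> \<omega> / a \<epsilon>)) (distr N borel (Y 1)) (at_right 0)"
    and ss: "self_similar N Y (1 / \<alpha>)" and \<rho>: "\<rho> = measure N {\<omega> \<in> space N. 0 < Y 1 \<omega>}"
    using dom unfolding small_time_domain_def by (elim conjE exE) (rule that)
  interpret Y: levy_process N Y by (rule Y)
  define \<nu> where "\<nu> = distr N borel (Y 1)"
  have Y1[measurable]: "Y 1 \<in> borel_measurable N" by simp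
  interpret \<nu>: real_distribution \<nu> unfolding \<nu>_def by (rule Y.real_distribution_distr[OF Y1])
  have "measure \<nu> {0} = Y.prob {\<omega> \<in> space N. Y 1 \<omega> = 0}"
    unfolding \<nu>_def by (subst measure_distr) (auto intro!: arg_cong[where f = Y.prob])
  then have cont: "isCont (cdf \<nu>) 0"
    using Y.self_similar_prob_zero[OF ss nz] by (simp add: \<nu>.isCont_cdf)
  define G where "G t x = cdf (distr M borel (\<lambda>\<omega>. X t \<omega> / a t)) x" for t x
  have G_lim: "((\<lambda>t. G t x) \<longlongrightarrow> cdf \<nu> x) (at_right 0)" if "isCont (cdf \<nu>) x" for x
    using conv that unfolding weak_conv_filter_def G_def \<nu>_def by blast
  have G: "G t x = \<P>(\<omega> in M. X t \<omega> / a t \<le> x)" if t: "0 < t" for t x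
  proof -
    have [measurable]: "X t \<in> borel_measurable M" using t by simp
    show ?thesis unfolding G_def cdf_def by (subst measure_distr) (auto intro!: arg_cong[where f = prob])
  qed
  have cdf0: "cdf \<nu> 0 = 1 - \<rho>"
  proof -
    have "cdf \<nu> 0 = Y.prob {\<omega> \<in> space N. \<not> 0 < Y 1 \<omega>}"
      unfolding \<nu>_def cdf_def by (subst measure_distr) (auto intro!: arg_cong[where f = Y.prob])
    also have "\<dots> = 1 - \<rho>" unfolding \<rho> by (rule Y.prob_neg) simp
    finally show ?thesis .
  qed
  have G0: "G t 0 = 1 - \<P>(\<omega> in M. 0 < X t \<omega>)" if t: "0 < t" for t
  proof -
    have [measurable]: "X t \<in> borel_measurable M" using t by simp
    have "0 < a t" using a t by simp
    then have "G t 0 = \<P>(\<omega> in M. \<not> 0 < X t \<omega>)"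
      by (simp add: G[OF t] divide_le_0_iff not_less)
    also have "\<dots> = 1 - \<P>(\<omega> in M. 0 < X t \<omega>)" by (rule prob_neg) simp
    finally show ?thesis .
  qed
  have near: "\<forall>\<^sub>F t in at_right 0. (0::real) < t" by (rule eventually_at_right_less)
  have "((\<lambda>t. 1 - G t 0) \<longlongrightarrow> 1 - (1 - \<rho>)) (at_right 0)"
    using G_lim[OF cont] unfolding cdf0 by (intro tendsto_intros)
  then have "((\<lambda>t. 1 - G t 0) \<longlongrightarrow> \<rho>) (at_right 0)" by simp
  then show "((\<lambda>t. \<P>(\<omega> in M. 0 < X t \<omega>)) \<longlongrightarrow> \<rho>) (at_right 0)"
  proof (rule Lim_transform_eventually)
    show "\<forall>\<^sub>F t in at_right 0. 1 - G t 0 = \<P>(\<omega> in M. 0 < X t \<omega>)"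
      using near by eventually_elim (simp add: G0)
  qed
  show "0 \<le> \<rho>" "\<rho> \<le> 1" unfolding \<rho> by simp_all
  show "\<forall>\<^sub>F t in at_right 0. \<P>(\<omega> in M. X t \<omega> = 0) < \<eta>" if \<eta>: "0 < \<eta>"
  proof -
    have "(cdf \<nu> \<longlongrightarrow> cdf \<nu> 0) (at_left 0)"
      using cont by (simp add: isCont_def filterlim_at_split)
    then have "\<forall>\<^sub>F x in at_left 0. cdf \<nu> 0 - \<eta> < cdf \<nu> x" using \<eta> by (intro order_tendstoD(1)) auto
    then obtain u where u: "u < 0" "\<And>x. u < x \<Longrightarrow> x < 0 \<Longrightarrow> cdf \<nu> 0 - \<eta> < cdf \<nu> x"
      unfolding eventually_at_left_field by blast
    \<comment> \<open>A continuity point x < 0 close to 0 is needed: P(X_t = 0) is at most the mass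
      of X_t / a_t in (x, 0], whose limit is less than \<eta>.\<close>
    have "countable {x. \<not> isCont (cdf \<nu>) x}"
      by (rule mono_ctble_discont) (simp add: monoI \<nu>.cdf_nondecreasing)
    then have "\<not> {u<..<0} \<subseteq> {x. \<not> isCont (cdf \<nu>) x}"
      using uncountable_open_interval[of u 0] u(1) countable_subset by blast
    then obtain x where x: "u < x" "x < 0" "isCont (cdf \<nu>) x" by auto
    have "((\<lambda>t. G t 0 - G t x) \<longlongrightarrow> cdf \<nu> 0 - cdf \<nu> x) (at_right 0)"
      by (intro tendsto_intros G_lim cont x)
    moreover have "cdf \<nu> 0 - cdf \<nu> x < \<eta>" using u(2)[OF x(1,2)] by simp
    ultimately have "\<forall>\<^sub>F t in at_right 0. G t 0 - G t x < \<eta>" by (rule order_tendstoD(2))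
    then show ?thesis using near
    proof eventually_elim
      case (elim t)
      have [measurable]: "X t \<in> borel_measurable M" using elim by simp
      have "0 < a t" using a elim by simp
      have "\<P>(\<omega> in M. X t \<omega> = 0) + \<P>(\<omega> in M. X t \<omega> / a t \<le> x)
        = prob ({\<omega> \<in> space M. X t \<omega> = 0} \<union> {\<omega> \<in> space M. X t \<omega> / a t \<le> x})"
        using x(2) by (intro finite_measure_Union[symmetric]) auto
      also have "\<dots> \<le> \<P>(\<omega> in M. X t \<omega> / a t \<le> 0)"
        using x(2) by (intro finite_measure_mono) auto
      finally show ?case using elim by (simp add: G)
    qed
  qed
qed

lemma grid_walk_p:
  "iid_walk.p M (\<lambda>i \<omega>. grid_steps \<delta> e (\<lambda>t. X t \<omega>) i) k
    = \<P>(\<omega> in M. \<delta> * (real k / 2 ^ e) < X (real k / 2 ^ e) \<omega>)"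
proof -
  have [measurable]: "X 0 \<in> borel_measurable M" "X (real k / 2 ^ e) \<in> borel_measurable M" by auto
  show ?thesis
    unfolding iid_walk.p_def[OF grid_walk] partial_sum_grid_steps
    using start_zero by (intro finite_measure_eq_AE) auto
qed

lemma sup_time_regularly_varying:
  assumes dom: "small_time_domain M X \<alpha> \<rho>"
    and up: "\<not> nondecreasing_process M X" and down: "\<not> nondecreasing_process M (\<lambda>t \<omega>. - X t \<omega>)"
  shows "regularly_varying_at_0 \<rho> (\<lambda>\<epsilon>. \<P>(\<omega> in M. sup_time (\<lambda>t. X t \<omega>) \<le> \<epsilon>))"
    and "regularly_varying_at_0 (1 - \<rho>) (\<lambda>\<epsilon>. \<P>(\<omega> in M. 1 - \<epsilon> \<le> sup_time (\<lambda>t. X t \<omega>)))"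
proof -
  obtain E where E: "\<forall>j. j \<le> E j" and approx:
    "\<forall>x x' z. 0 \<le> x \<longrightarrow> x < x' \<longrightarrow> x' < 1 \<longrightarrow> 0 < z \<longrightarrow>
    (\<forall>\<^sub>F j in sequentially. \<P>(\<omega> in M. sup_time (\<lambda>t. X t \<omega>) \<le> x)
      \<le> \<P>(\<omega> in M. real (grid_argmax (1 / Suc j) (E j) (\<lambda>t. X t \<omega>)) \<le> x' * 2 ^ E j) + z) \<and>
    (\<forall>\<^sub>F j in sequentially. \<P>(\<omega> in M. real (grid_argmax (1 / Suc j) (E j) (\<lambda>t. X t \<omega>)) \<le> x * 2 ^ E j)
      \<le> \<P>(\<omega> in M. sup_time (\<lambda>t. X t \<omega>) \<le> x') + z)"
    using sup_time_approximation by (elim exE conjE) (rule that)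
  define N :: "nat \<Rightarrow> nat" where "N j = 2 ^ E j" for j
  define \<xi> where "\<xi> j = (\<lambda>i \<omega>. grid_steps (1 / Suc j) (E j) (\<lambda>t. X t \<omega>) i)" for j
  have walk: "iid_walk M (\<xi> j)" for j unfolding \<xi>_def by (rule grid_walk)
  define a where "a j = iid_walk.pos M (\<xi> j)" for j
  define b where "b j = iid_walk.neg M (\<xi> j)" for j
  define p where "p j = iid_walk.p M (\<xi> j)" for j
  have p_eq: "p j k = \<P>(\<omega> in M. 1 / Suc j * (real k / real (N j)) < X (real k / real (N j)) \<omega>)" for j k
    unfolding p_def \<xi>_def grid_walk_p N_def by simp
  define L where "L j \<omega> = grid_argmax (1 / Suc j) (E j) (\<lambda>t. X t \<omega>)" for j \<omega>
  define \<tau> where "\<tau> \<omega> = sup_time (\<lambda>t. X t \<omega>)" for \<omega>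
  have [measurable]: "L j \<in> measurable M (count_space UNIV)" for j unfolding L_def by measurable
  have [measurable]: "\<tau> \<in> borel_measurable M" unfolding \<tau>_def by measurable
  have N_pos: "0 < N j" for j by (simp add: N_def)
  have L_in: "\<P>(\<omega> in M. L j \<omega> \<in> J) = (\<Sum>k\<in>J. a j k * b j (N j - k))" if "J \<subseteq> {..N j}" for j J
    using iid_walk.prob_first_argmax_in[OF walk that] unfolding a_def b_def L_def \<xi>_def N_def .
  have L_le: "L j \<omega> \<le> N j" for j \<omega> unfolding L_def N_def by (rule first_argmax_le)
  have low: "\<forall>\<^sub>F j in sequentially. \<P>(\<omega> in M. \<tau> \<omega> \<le> x) \<le> \<P>(\<omega> in M. real (L j \<omega>) \<le> x' * real (N j)) + z"
    and high: "\<forall>\<^sub>F j in sequentially. \<P>(\<omega> in M. real (L j \<omega>) \<le> x * real (N j)) \<le> \<P>(\<omega> in M. \<tau> \<omega> \<le> x') + z"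
    if "0 \<le> x" "x < x'" "x' < 1" "0 < z" for x x' z
    using approx[rule_format, OF that] unfolding L_def \<tau>_def N_def by simp_all

  have p01: "0 \<le> p j k \<and> p j k \<le> 1" for j k unfolding p_def by (rule iid_walk.p01[OF walk])
  have N_top: "filterlim N at_top sequentially"
  proof (rule filterlim_at_top_mono[OF filterlim_ident])
    have "j \<le> N j" for j using E[rule_format, of j] less_exp[of "E j"] unfolding N_def by linarith
    then show "\<forall>\<^sub>F j in sequentially. j \<le> N j" by simp
  qed
  have drift: "\<forall>\<^sub>F j in sequentially. 1 / real (Suc j) < z" if "0 < z" for z
  proof -
    have "(\<lambda>j. 1 / real (Suc j)) \<longlonglongrightarrow> 0" by real_asymp
    then show ?thesis using that by (rule order_tendstoD(2))
  qed

  \<comment> \<open>Small t brings P(X_t > 0) within \<eta>/2 of \<rho>. The drift costs at most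
    P(\<bar>X_t\<bar> \<le> r) \<le> \<eta>/2 once it is at most r; r depends on t1, so the bound
    holds only for late j.\<close>
  have p_close: "\<exists>t0>0. \<forall>t1>0. \<forall>\<^sub>F j in sequentially.
      \<forall>k. t1 * real (N j) \<le> real k \<longrightarrow> real k \<le> t0 * real (N j) \<longrightarrow> \<bar>p j k - \<rho>\<bar> \<le> \<eta>" if \<eta>: "0 < \<eta>" for \<eta>
  proof -
    have \<eta>2: "0 < \<eta> / 2" using \<eta> by simp
    have "\<forall>\<^sub>F t in at_right 0. dist (\<P>(\<omega> in M. 0 < X t \<omega>)) \<rho> < \<eta> / 2"
      by (rule tendstoD[OF small_time_prob_pos[OF dom] \<eta>2])
    then have "\<forall>\<^sub>F t in at_right 0. dist (\<P>(\<omega> in M. 0 < X t \<omega>)) \<rho> < \<eta> / 2 \<and> \<P>(\<omega> in M. X t \<omega> = 0) < \<eta> / 2"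
      using small_time_prob_zero[OF dom \<eta>2] by (rule eventually_conj)
    then obtain u where u: "0 < u" "\<And>t. 0 < t \<Longrightarrow> t < u \<Longrightarrow>
        dist (\<P>(\<omega> in M. 0 < X t \<omega>)) \<rho> < \<eta> / 2 \<and> \<P>(\<omega> in M. X t \<omega> = 0) < \<eta> / 2"
      unfolding eventually_at_right_field by blast
    define t0 where "t0 = u / 2"
    have t0: "0 < t0" "t0 < u" using u by (auto simp: t0_def)
    show ?thesis
    proof (intro exI[of _ t0] conjI t0(1) allI impI)
      fix t1 :: real assume t1: "0 < t1"
      obtain r where r: "0 < r" "\<forall>t\<in>{t1..t0}. \<P>(\<omega> in M. \<bar>X t \<omega>\<bar> \<le> r) \<le> \<eta> / 2"
        using prob_zero_uniform[of t1 t0 "\<eta> / 2"] u(2) t0 t1 by force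
      have "0 < r / t0" using r t0 by simp
      from drift[OF this]
      show "\<forall>\<^sub>F j in sequentially. \<forall>k. t1 * real (N j) \<le> real k \<longrightarrow> real k \<le> t0 * real (N j) \<longrightarrow> \<bar>p j k - \<rho>\<bar> \<le> \<eta>"
      proof (eventually_elim, intro allI impI)
        fix j k assume j: "1 / real (Suc j) < r / t0" and k: "t1 * real (N j) \<le> real k" "real k \<le> t0 * real (N j)"
        define t where "t = real k / real (N j)"
        have t: "t1 \<le> t" "t \<le> t0" using k N_pos[of j] by (auto simp: t_def pos_le_divide_eq pos_divide_le_eq)
        have [measurable]: "X t \<in> borel_measurable M" using t t1 by simp
        have "1 / real (Suc j) * t \<le> r / t0 * t0" using j t t1 r(1) t0 by (intro mult_mono) auto
        then have small: "1 / real (Suc j) * t \<le> r" using t0 by simp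
        have nonneg: "0 \<le> 1 / real (Suc j) * t" using t t1 by simp
        have p_t: "p j k = \<P>(\<omega> in M. 1 / real (Suc j) * t < X t \<omega>)" unfolding p_eq t_def ..
        have 1: "p j k \<le> \<P>(\<omega> in M. 0 < X t \<omega>)"
          unfolding p_t using nonneg by (intro finite_measure_mono) auto
        have "\<P>(\<omega> in M. 0 < X t \<omega>)
          \<le> prob ({\<omega> \<in> space M. 1 / real (Suc j) * t < X t \<omega>} \<union> {\<omega> \<in> space M. \<bar>X t \<omega>\<bar> \<le> r})"
          using small by (intro finite_measure_mono) auto
        also have "\<dots> \<le> p j k + \<P>(\<omega> in M. \<bar>X t \<omega>\<bar> \<le> r)"
          unfolding p_t by (intro measure_Un_le) auto
        finally have 2: "\<P>(\<omega> in M. 0 < X t \<omega>) \<le> p j k + \<eta> / 2"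
          using bspec[OF r(2), of t] t by simp
        have "0 < t" "t < u" using t t1 t0 by auto
        from u(2)[OF this] have "\<bar>\<P>(\<omega> in M. 0 < X t \<omega>) - \<rho>\<bar> < \<eta> / 2" by (simp add: dist_real_def)
        then show "\<bar>p j k - \<rho>\<bar> \<le> \<eta>" using 1 2 by linarith
      qed
    qed
  qed

  have neg: "levy_process M (\<lambda>t \<omega>. - X t \<omega>)" by (rule uminus_levy)
  \<comment> \<open>\<open>up\<close> excludes nondecreasing paths and so produces negative values;
    \<open>down\<close> produces positive ones.\<close>
  have neg_pos: "0 < \<P>(\<omega> in M. 0 < - X t \<omega>)" if "0 < t" for t
    using prob_neg_pos[OF up that] by simp
  have pos_pos: "0 < \<P>(\<omega> in M. 0 < X t \<omega>)" if "0 < t" for t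
    using levy_process.prob_neg_pos[OF neg down that] by simp
  \<comment> \<open>The downward drift favours this bound, so one c serves every j.\<close>
  have q_pos: "\<exists>c>0. \<forall>\<^sub>F j in sequentially. \<forall>k. t * real (N j) \<le> real k \<longrightarrow> k \<le> N j \<longrightarrow> c \<le> 1 - p j k"
    if t: "0 < t" for t
  proof -
    obtain c where c: "0 < c" "\<forall>s\<in>{t..1}. c \<le> \<P>(\<omega> in M. c < - X s \<omega>)"
      using levy_process.prob_pos_uniform[OF neg neg_pos t, of 1] by auto
    have "c \<le> 1 - p j k" if k: "t * real (N j) \<le> real k" "k \<le> N j" for j k
    proof -
      define s where "s = real k / real (N j)"
      have s: "t \<le> s" "s \<le> 1" using k N_pos[of j] by (auto simp: s_def pos_le_divide_eq pos_divide_le_eq)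
      have [measurable]: "X s \<in> borel_measurable M" using s t by simp
      have nonneg: "0 \<le> 1 / real (Suc j) * s" using s t by simp
      have "c \<le> \<P>(\<omega> in M. c < - X s \<omega>)" using c(2) s by auto
      also have "\<dots> \<le> \<P>(\<omega> in M. \<not> 1 / real (Suc j) * s < X s \<omega>)"
        using nonneg c(1) by (intro finite_measure_mono) auto
      also have "\<dots> = 1 - p j k" unfolding p_eq s_def[symmetric] by (rule prob_neg) simp
      finally show ?thesis .
    qed
    then show ?thesis using c(1) by (intro exI[of _ c]) simp
  qed
  \<comment> \<open>Here the drift works against the bound; up to time 1 it totals at most 1/(j +
    1), which is below the level c for late j.\<close>
  have p_pos: "\<exists>c>0. \<forall>\<^sub>F j in sequentially. \<forall>k. t * real (N j) \<le> real k \<longrightarrow> k \<le> N j \<longrightarrow> c \<le> 1 - (1 - p j k)"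
    if t: "0 < t" for t
  proof -
    obtain c where c: "0 < c" "\<forall>s\<in>{t..1}. c \<le> \<P>(\<omega> in M. c < X s \<omega>)"
      using prob_pos_uniform[OF pos_pos t, of 1] by auto
    have "c \<le> p j k" if j: "1 / real (Suc j) < c" and k: "t * real (N j) \<le> real k" "k \<le> N j" for j k
    proof -
      define s where "s = real k / real (N j)"
      have s: "t \<le> s" "s \<le> 1" using k N_pos[of j] by (auto simp: s_def pos_le_divide_eq pos_divide_le_eq)
      have [measurable]: "X s \<in> borel_measurable M" using s t by simp
      have "1 / real (Suc j) * s \<le> c * 1" using j s t c(1) by (intro mult_mono) auto
      then have "\<P>(\<omega> in M. c < X s \<omega>) \<le> p j k"
        unfolding p_eq s_def[symmetric] by (intro finite_measure_mono) auto
      then show ?thesis using c(2) s by force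
    qed
    then show ?thesis
      using drift[OF c(1)] c(1) by (intro exI[of _ c] conjI) (auto elim: eventually_mono)
  qed

  have ab: "0 \<le> a j k" "0 \<le> b j k" "antimono (a j)" "antimono (b j)" "(\<Sum>k\<le>n. a j k * b j (n - k)) = 1"
    "real n * a j n = (\<Sum>k=1..n. p j k * a j (n - k))"
    "real n * b j n = (\<Sum>k=1..n. (1 - p j k) * b j (n - k))" for j k n
    unfolding a_def b_def p_def
    using iid_walk.pos_neg_nonneg[OF walk] iid_walk.pos_antimono[OF walk] iid_walk.neg_antimono[OF walk]
      iid_walk.pos_neg_convolution[OF walk] iid_walk.pos_rec[OF walk] iid_walk.neg_rec[OF walk] by auto
  have flip: "(\<Sum>k\<le>n. b j k * a j (n - k)) = 1" for j n
    unfolding ab(5)[of j n, symmetric]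
    by (rule sum.reindex_bij_witness[of _ "\<lambda>k. n - k" "\<lambda>k. n - k"]) auto
  note rho = small_time_rho[OF dom]
  interpret first: renewal_array a b p N \<rho>
    by unfold_locales (use ab rho p01 N_top p_close q_pos in auto)
  have p_close': "\<exists>t0>0. \<forall>t1>0. \<forall>\<^sub>F j in sequentially.
      \<forall>k. t1 * real (N j) \<le> real k \<longrightarrow> real k \<le> t0 * real (N j) \<longrightarrow> \<bar>1 - p j k - (1 - \<rho>)\<bar> \<le> \<eta>" if \<eta>: "0 < \<eta>" for \<eta>
  proof -
    have "\<bar>1 - p j k - (1 - \<rho>)\<bar> = \<bar>p j k - \<rho>\<bar>" for j k by linarith
    then show ?thesis using p_close[OF \<eta>] by simp
  qed
  interpret last: renewal_array b a "\<lambda>j k. 1 - p j k" N "1 - \<rho>"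
    by unfold_locales (use ab flip rho p01 N_top p_close' p_pos in auto)

  have first_W: "first.W j x = \<P>(\<omega> in M. real (L j \<omega>) \<le> x * real (N j))" if x: "0 < x" "x < 1" for j x
  proof -
    have "real (first.g j x) \<le> 1 * real (N j)"
      using first.g_le[of x j] mult_right_mono[of x 1 "real (N j)"] x by simp
    then have "first.W j x = \<P>(\<omega> in M. L j \<omega> \<in> {..first.g j x})"
      unfolding first.W_def by (intro L_in[symmetric]) auto
    also have "{\<omega> \<in> space M. L j \<omega> \<in> {..first.g j x}} = {\<omega> \<in> space M. real (L j \<omega>) \<le> x * real (N j)}"
    proof -
      have "l \<le> first.g j x \<longleftrightarrow> real l \<le> x * real (N j)" for l
        using first.g_le[of x j] first.less_g[of x j] x by linarith
      then show ?thesis by simp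
    qed
    finally show ?thesis .
  qed
  show "regularly_varying_at_0 \<rho> (\<lambda>\<epsilon>. \<P>(\<omega> in M. sup_time (\<lambda>t. X t \<omega>) \<le> \<epsilon>))"
    unfolding \<tau>_def[symmetric]
  proof (rule first.regularly_varying_of_sandwich)
    fix x y :: real assume "x \<le> y"
    then show "\<P>(\<omega> in M. \<tau> \<omega> \<le> x) \<le> \<P>(\<omega> in M. \<tau> \<omega> \<le> y)"
      by (intro finite_measure_mono) auto
  next
    fix x x' z :: real assume "0 < x" "x < x'" "x' < 1" "0 < z"
    then show "\<forall>\<^sub>F j in sequentially. \<P>(\<omega> in M. \<tau> \<omega> \<le> x) \<le> first.W j x' + z"
      "\<forall>\<^sub>F j in sequentially. first.W j x \<le> \<P>(\<omega> in M. \<tau> \<omega> \<le> x') + z"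
      using low[of x x' z] high[of x x' z] by (simp_all add: first_W)
  qed

  have last_W: "last.W j x = \<P>(\<omega> in M. (1 - x) * real (N j) \<le> real (L j \<omega>))" if x: "0 < x" "x < 1" for j x
  proof -
    have "real (last.g j x) \<le> 1 * real (N j)"
      using last.g_le[of x j] mult_right_mono[of x 1 "real (N j)"] x by simp
    then have g: "last.g j x \<le> N j" by simp
    have "last.W j x = (\<Sum>k\<in>{N j - last.g j x..N j}. a j k * b j (N j - k))"
      unfolding last.W_def
      by (rule sum.reindex_bij_witness[of _ "\<lambda>k. N j - k" "\<lambda>k. N j - k"]) (use g in auto)
    also have "\<dots> = \<P>(\<omega> in M. L j \<omega> \<in> {N j - last.g j x..N j})"
      by (rule L_in[symmetric]) auto
    also have "{\<omega> \<in> space M. L j \<omega> \<in> {N j - last.g j x..N j}} = {\<omega> \<in> space M. (1 - x) * real (N j) \<le> real (L j \<omega>)}"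
    proof -
      have "l \<in> {N j - last.g j x..N j} \<longleftrightarrow> (1 - x) * real (N j) \<le> real l" if l: "l \<le> N j" for l
      proof -
        have "N j - l \<le> last.g j x \<longleftrightarrow> real (N j - l) \<le> x * real (N j)"
          using last.g_le[of x j] last.less_g[of x j] x by linarith
        then show ?thesis using l by (auto simp: of_nat_diff left_diff_distrib)
      qed
      then show ?thesis using L_le by blast
    qed
    finally show ?thesis .
  qed
  have complement: "\<P>(\<omega> in M. c < f \<omega>) = 1 - \<P>(\<omega> in M. f \<omega> \<le> c)"
    if [measurable]: "f \<in> borel_measurable M" for f and c :: real
    using prob_neg[of "\<lambda>\<omega>. f \<omega> \<le> c"] by (simp add: not_le)
  have [measurable]: "(\<lambda>\<omega>. real (L j \<omega>)) \<in> borel_measurable M" for j by measurable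
  show "regularly_varying_at_0 (1 - \<rho>) (\<lambda>\<epsilon>. \<P>(\<omega> in M. 1 - \<epsilon> \<le> sup_time (\<lambda>t. X t \<omega>)))"
    unfolding \<tau>_def[symmetric]
  proof (rule last.regularly_varying_of_sandwich)
    fix x y :: real assume "x \<le> y"
    then show "\<P>(\<omega> in M. 1 - x \<le> \<tau> \<omega>) \<le> \<P>(\<omega> in M. 1 - y \<le> \<tau> \<omega>)"
      by (intro finite_measure_mono) auto
  next
    fix x x' z :: real assume x: "0 < x" "x < x'" "x' < 1" and z: "0 < z"
    \<comment> \<open>Complements turn weak inequalities into strict ones; the room around y
      restores them, even if \<tau> has atoms.\<close>
    obtain y where y: "x < y" "y < x'" using dense[OF x(2)] by blast
    have "\<forall>\<^sub>F j in sequentially. \<P>(\<omega> in M. real (L j \<omega>) \<le> (1 - x') * real (N j)) \<le> \<P>(\<omega> in M. \<tau> \<omega> \<le> 1 - y) + z"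
      using x y z by (intro high) auto
    then show "\<forall>\<^sub>F j in sequentially. \<P>(\<omega> in M. 1 - x \<le> \<tau> \<omega>) \<le> last.W j x' + z"
    proof eventually_elim
      case (elim j)
      have "\<P>(\<omega> in M. 1 - x \<le> \<tau> \<omega>) \<le> \<P>(\<omega> in M. 1 - y < \<tau> \<omega>)"
        using y by (intro finite_measure_mono) auto
      moreover have "\<P>(\<omega> in M. (1 - x') * real (N j) < real (L j \<omega>)) \<le> last.W j x'"
        unfolding last_W[OF less_trans[OF x(1,2)] x(3)] by (intro finite_measure_mono) auto
      ultimately show ?case using elim by (simp add: complement)
    qed
    have "\<forall>\<^sub>F j in sequentially. \<P>(\<omega> in M. \<tau> \<omega> \<le> 1 - x') \<le> \<P>(\<omega> in M. real (L j \<omega>) \<le> (1 - y) * real (N j)) + z"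
      using x y z by (intro low) auto
    then show "\<forall>\<^sub>F j in sequentially. last.W j x \<le> \<P>(\<omega> in M. 1 - x' \<le> \<tau> \<omega>) + z"
    proof eventually_elim
      case (elim j)
      have "(1 - y) * real (N j) < (1 - x) * real (N j)"
        using y N_pos[of j] by (intro mult_strict_right_mono) auto
      then have "last.W j x \<le> \<P>(\<omega> in M. (1 - y) * real (N j) < real (L j \<omega>))"
        unfolding last_W[OF x(1) less_trans[OF x(2,3)]] by (intro finite_measure_mono) auto
      moreover have "\<P>(\<omega> in M. 1 - x' < \<tau> \<omega>) \<le> \<P>(\<omega> in M. 1 - x' \<le> \<tau> \<omega>)"
        by (intro finite_measure_mono) auto
      ultimately show ?case using elim by (simp add: complement)
    qed
  qed
qed

end

theorem proposition6:
  fixes M :: "'a measure" and X :: "real \<Rightarrow> 'a \<Rightarrow> real" and \<alpha> \<rho> :: real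
  assumes "levy_process M X"
    and "small_time_domain M X \<alpha> \<rho>"
    and "\<not> nondecreasing_process M X"
    and "\<not> nondecreasing_process M (\<lambda>t \<omega>. - X t \<omega>)"
  shows "regularly_varying_at_0 \<rho>
           (\<lambda>\<epsilon>. measure M {\<omega> \<in> space M. sup_time (\<lambda>t. X t \<omega>) \<le> \<epsilon>}) \<and>
         regularly_varying_at_0 (1 - \<rho>)
           (\<lambda>\<epsilon>. measure M {\<omega> \<in> space M. 1 - \<epsilon> \<le> sup_time (\<lambda>t. X t \<omega>)})"
  using levy_process.sup_time_regularly_varying[OF assms] by blast

end
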